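(* (1) For every finite structure $M$ (in the sense of model theory) there exists a simple plane $P_M$ such that $P_M$ is finite and $\mathrm{Aut}(P_M)\cong\mathrm{Aut}(M)$. (2) For every infinite structure $M$ (in the sense of model theory) there exists a simple plane $P_M$ such that $|M|=|P_M|$ and $\mathrm{Aut}(P_M)\cong\mathrm{Aut}(M)$. (3) For every infinite structure $M$ (in the sense of model theory) there exists a non-Desarguesian projective plane $P_M$ such that $|M|=|P_M|$ and $\mathrm{Aut}(P_M)\cong\mathrm{Aut}(M)$.
   Context: A plane is a system of points and lines (lines being regarded as sets of points) such that: (A) every pair of distinct points determines a unique line (i.e. lies on exactly one common line); (B) every pair of distinct lines intersects in at most one point; (C) every line contains at least two points; (D) there exist at least three non-collinear points. A plane is projective if in addition (B') every pair of distinct lines intersects in exactly one point. The size $|P|$ of a plane $P$ is the cardinality of its set of points. Automorphisms (collineations) of a plane are bijections of points and lines preserving incidence and non-incidence. A point and a line are incident if the point is contained in the line. A line is trivial if it is incident with exactly two points, and non-trivial otherwise. A plane is simple (or $17$-simple) if, except for $17$ points, every point is incident with at most two non-trivial lines. For distinct points $a,b$, $a\vee b$ is the unique line they determine; for distinct lines $\ell,\ell'$ of a projective plane, $\ell\wedge\ell'$ is their unique common point. A projective plane is Desarguesian if for any two triples of distinct points $p,q,r$ and $p',q',r'$, if the lines $p\vee p'$, $q\vee q'$ and $r\vee r'$ are incident with a common point, then the points $(p\vee q)\wedge(p'\vee q')$, $(p\vee r)\wedge(p'\vee r')$ and $(q\vee r)\wedge(q'\vee r')$ are collinear, i.e. lie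 on a common line (this is required whenever all the lines and points mentioned are defined). A projective plane is non-Desarguesian if it is not Desarguesian. *)

theory Defs
  imports "HOL-Algebra.Bij" "HOL-Library.Equipollence"
begin

section \<open>First-order structures\<close>

text \<open>
  Single-sorted structures over an arbitrary (possibly infinite) first-order language: the sets
  of function and relation symbols, their arities, and an interpretation. Constants are function
  symbols of arity 0. Argument tuples are lists whose length is the arity; the values of an
  interpretation on other lists are irrelevant.
\<close>

record ('a, 'f, 'r) model =
  universe :: "'a set"
  funs :: "'f set"
  rels :: "'r set"
  fun_arity :: "'f \<Rightarrow> nat"
  rel_arity :: "'r \<Rightarrow> nat"
  fun_int :: "'f \<Rightarrow> 'a list \<Rightarrow> 'a"
  rel_int :: "'r \<Rightarrow> 'a list \<Rightarrow> bool"

definition tuples :: "'a set \<Rightarrow> nat \<Rightarrow> 'a list set" where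
  "tuples A n = {xs. length xs = n \<and> set xs \<subseteq> A}"

locale fo_structure =
  fixes M :: "('a, 'f, 'r) model"
  assumes fun_int_closed:
    "\<And>s xs. s \<in> funs M \<Longrightarrow> xs \<in> tuples (universe M) (fun_arity M s) \<Longrightarrow> fun_int M s xs \<in> universe M"

definition model_automorphisms :: "('a, 'f, 'r) model \<Rightarrow> ('a \<Rightarrow> 'a) set" where
  "model_automorphisms M =
    {h \<in> Bij (universe M).
      (\<forall>s \<in> funs M. \<forall>xs \<in> tuples (universe M) (fun_arity M s).
        h (fun_int M s xs) = fun_int M s (map h xs)) \<and>
      (\<forall>r \<in> rels M. \<forall>xs \<in> tuples (universe M) (rel_arity M r).
        rel_int M r xs \<longleftrightarrow> rel_int M r (map h xs))}"

definition Aut_model :: "('a, 'f, 'r) model \<Rightarrow> ('a \<Rightarrow> 'a) monoid" where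
  "Aut_model M = BijGroup (universe M) \<lparr>carrier := model_automorphisms M\<rparr>"


section \<open>Planes\<close>

record 'p incidence =
  points :: "'p set"
  lines :: "'p set set"

definition collinear :: "'p incidence \<Rightarrow> 'p \<Rightarrow> 'p \<Rightarrow> 'p \<Rightarrow> bool" where
  "collinear P a b c \<longleftrightarrow> (\<exists>l \<in> lines P. a \<in> l \<and> b \<in> l \<and> c \<in> l)"

locale plane =
  fixes P :: "'p incidence"
  assumes lines_subset: "\<And>l. l \<in> lines P \<Longrightarrow> l \<subseteq> points P"
    and unique_line:
      "\<And>a b. a \<in> points P \<Longrightarrow> b \<in> points P \<Longrightarrow> a \<noteq> b \<Longrightarrow> \<exists>!l. l \<in> lines P \<and> a \<in> l \<and> b \<in> l"
    and at_most_one_point: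
      "\<And>l m x y. l \<in> lines P \<Longrightarrow> m \<in> lines P \<Longrightarrow> l \<noteq> m \<Longrightarrow>
        x \<in> l \<inter> m \<Longrightarrow> y \<in> l \<inter> m \<Longrightarrow> x = y"
    and two_points: "\<And>l. l \<in> lines P \<Longrightarrow> \<exists>a \<in> l. \<exists>b \<in> l. a \<noteq> b"
    and non_collinear:
      "\<exists>a \<in> points P. \<exists>b \<in> points P. \<exists>c \<in> points P.
        a \<noteq> b \<and> a \<noteq> c \<and> b \<noteq> c \<and> \<not> collinear P a b c"

locale projective_plane = plane P for P :: "'p incidence" +
  assumes unique_point:
    "\<And>l m. l \<in> lines P \<Longrightarrow> m \<in> lines P \<Longrightarrow> l \<noteq> m \<Longrightarrow> \<exists>!x. x \<in> l \<inter> m"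

definition trivial_line :: "'p set \<Rightarrow> bool" where
  "trivial_line l \<longleftrightarrow> card l = 2"

definition nontrivial_lines_at :: "'p incidence \<Rightarrow> 'p \<Rightarrow> 'p set set" where
  "nontrivial_lines_at P x = {l \<in> lines P. x \<in> l \<and> \<not> trivial_line l}"

text \<open>The finiteness conjunct is needed because \<open>card\<close> is 0 on infinite sets.\<close>

definition simple_plane :: "'p incidence \<Rightarrow> bool" where
  "simple_plane P \<longleftrightarrow> plane P \<and>
    (\<exists>S \<subseteq> points P. card S = 17 \<and>
      (\<forall>x \<in> points P - S.
        finite (nontrivial_lines_at P x) \<and> card (nontrivial_lines_at P x) \<le> 2))"

text \<open>
  A collineation is a pair of bijections, one of the points and one of the lines; both are taken
  extensional, so that each collineation is represented by exactly one pair.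
\<close>

definition collineations :: "'p incidence \<Rightarrow> (('p \<Rightarrow> 'p) \<times> ('p set \<Rightarrow> 'p set)) set" where
  "collineations P =
    {(f, g). f \<in> Bij (points P) \<and> g \<in> Bij (lines P) \<and>
      (\<forall>x \<in> points P. \<forall>l \<in> lines P. x \<in> l \<longleftrightarrow> f x \<in> g l)}"

definition Aut_plane :: "'p incidence \<Rightarrow> (('p \<Rightarrow> 'p) \<times> ('p set \<Rightarrow> 'p set)) monoid" where
  "Aut_plane P =
    (BijGroup (points P) \<times>\<times> BijGroup (lines P)) \<lparr>carrier := collineations P\<rparr>"

definition join :: "'p incidence \<Rightarrow> 'p \<Rightarrow> 'p \<Rightarrow> 'p set" where
  "join P a b = (THE l. l \<in> lines P \<and> a \<in> l \<and> b \<in> l)"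

definition meet :: "'p set \<Rightarrow> 'p set \<Rightarrow> 'p" where
  "meet l m = (THE x. x \<in> l \<inter> m)"

text \<open>
  The inequalities between corresponding points and between corresponding sides are exactly the
  conditions under which all the joins and meets that occur are defined.
\<close>

definition desarguesian :: "'p incidence \<Rightarrow> bool" where
  "desarguesian P \<longleftrightarrow>
    (\<forall>p \<in> points P. \<forall>q \<in> points P. \<forall>r \<in> points P.
     \<forall>p' \<in> points P. \<forall>q' \<in> points P. \<forall>r' \<in> points P.
      p \<noteq> q \<and> p \<noteq> r \<and> q \<noteq> r \<and> p' \<noteq> q' \<and> p' \<noteq> r' \<and> q' \<noteq> r' \<and>
      p \<noteq> p' \<and> q \<noteq> q' \<and> r \<noteq> r' \<and>
      join P p q \<noteq> join P p' q' \<and> join P p r \<noteq> join P p' r' \<and> join P q r \<noteq> join P q' r' \<and>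
      (\<exists>c \<in> points P. c \<in> join P p p' \<and> c \<in> join P q q' \<and> c \<in> join P r r') \<longrightarrow>
      collinear P
        (meet (join P p q) (join P p' q'))
        (meet (join P p r) (join P p' r'))
        (meet (join P q r) (join P q' r')))"


section \<open>The automorphism groups are groups\<close>

lemma BijGroup_inv:
  assumes "h \<in> Bij S"
  shows "inv\<^bsub>BijGroup S\<^esub> h \<in> Bij S"
    and "\<And>x. x \<in> S \<Longrightarrow> h ((inv\<^bsub>BijGroup S\<^esub> h) x) = x"
    and "\<And>x. x \<in> S \<Longrightarrow> (inv\<^bsub>BijGroup S\<^esub> h) (h x) = x"
proof -
  have bij: "bij_betw h S S" using assms by (simp add: Bij_def)
  then have im: "h x \<in> S" if "x \<in> S" for x using that by (rule bij_betwE[THEN bspec])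
  show "inv\<^bsub>BijGroup S\<^esub> h \<in> Bij S"
    by (simp add: inv_BijGroup assms restrict_inv_into_Bij)
  show "h ((inv\<^bsub>BijGroup S\<^esub> h) x) = x" if "x \<in> S" for x
    using that by (simp add: inv_BijGroup assms bij_betw_inv_into_right[OF bij])
  show "(inv\<^bsub>BijGroup S\<^esub> h) (h x) = x" if "x \<in> S" for x
    using that by (simp add: inv_BijGroup assms im bij_betw_inv_into_left[OF bij])
qed

lemma group_Aut_model:
  assumes "fo_structure M"
  shows "group (Aut_model M)"
proof -
  interpret fo_structure M by fact
  interpret B: group "BijGroup (universe M)" by (rule group_BijGroup)
  have mapt: "map h xs \<in> tuples (universe M) n"
    if "h \<in> Bij (universe M)" "xs \<in> tuples (universe M) n" for h xs n
    using that by (auto simp: tuples_def Bij_def bij_betw_def)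
  have map_inv: "map h (map (inv\<^bsub>BijGroup (universe M)\<^esub> h) xs) = xs"
    if h: "h \<in> Bij (universe M)" and xs: "xs \<in> tuples (universe M) n" for h xs n
  proof -
    have "h ((inv\<^bsub>BijGroup (universe M)\<^esub> h) x) = x" if "x \<in> universe M" for x
      using h that by (rule BijGroup_inv)
    then show ?thesis using xs by (auto simp: tuples_def intro!: map_idI)
  qed
  have "subgroup (model_automorphisms M) (BijGroup (universe M))"
  proof (rule B.subgroupI)
    show "model_automorphisms M \<subseteq> carrier (BijGroup (universe M))"
      by (auto simp: model_automorphisms_def BijGroup_def)
    have "map (\<lambda>x\<in>universe M. x) xs = xs" if "xs \<in> tuples (universe M) n" for xs n
      using that by (auto simp: tuples_def intro!: map_idI)
    then have "(\<lambda>x\<in>universe M. x) \<in> model_automorphisms M"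
      by (simp add: model_automorphisms_def id_Bij fun_int_closed)
    then show "model_automorphisms M \<noteq> {}" by blast
  next
    fix h assume hM: "h \<in> model_automorphisms M"
    then have h: "h \<in> Bij (universe M)" by (simp add: model_automorphisms_def)
    let ?k = "(inv\<^bsub>BijGroup (universe M)\<^esub> h)"
    have k: "?k \<in> Bij (universe M)"
      using h by (rule BijGroup_inv)
    have kh: "?k (h x) = x" if "x \<in> universe M" for x
      using h that by (rule BijGroup_inv)
    show "?k \<in> model_automorphisms M"
      unfolding model_automorphisms_def
    proof (intro CollectI conjI ballI)
      fix s xs assume s: "s \<in> funs M" and xs: "xs \<in> tuples (universe M) (fun_arity M s)"
      have "h (fun_int M s (map ?k xs)) = fun_int M s xs"
        using hM s mapt[OF k xs] map_inv[OF h xs] by (simp add: model_automorphisms_def)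
      then show "?k (fun_int M s xs) = fun_int M s (map ?k xs)"
        using kh fun_int_closed[OF s mapt[OF k xs]] by metis
    next
      fix r xs assume r: "r \<in> rels M" and xs: "xs \<in> tuples (universe M) (rel_arity M r)"
      show "rel_int M r xs \<longleftrightarrow> rel_int M r (map ?k xs)"
        using hM r mapt[OF k xs] map_inv[OF h xs] by (simp add: model_automorphisms_def)
    qed (rule k)
  next
    fix h k assume hM: "h \<in> model_automorphisms M" and kM: "k \<in> model_automorphisms M"
    then have h: "h \<in> Bij (universe M)" and k: "k \<in> Bij (universe M)"
      by (simp_all add: model_automorphisms_def)
    have eq: "map (compose (universe M) h k) xs = map h (map k xs)"
      if "xs \<in> tuples (universe M) n" for xs n
      using that by (auto simp: tuples_def compose_def)
    have "compose (universe M) h k \<in> model_automorphisms M"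
      using hM kM unfolding model_automorphisms_def
      by (auto simp: compose_Bij eq mapt compose_eq fun_int_closed simp del: map_map)
    then show "h \<otimes>\<^bsub>BijGroup (universe M)\<^esub> k \<in> model_automorphisms M"
      using h k by (simp add: BijGroup_def)
  qed
  then show ?thesis unfolding Aut_model_def by (rule B.subgroup_imp_group)
qed

lemma group_Aut_plane: "group (Aut_plane P)"
proof -
  let ?B = "BijGroup (points P)" and ?C = "BijGroup (lines P)"
  interpret D: group "?B \<times>\<times> ?C" by (intro DirProd_group group_BijGroup)
  have "subgroup (collineations P) (?B \<times>\<times> ?C)"
  proof (rule D.subgroupI)
    show "collineations P \<subseteq> carrier (?B \<times>\<times> ?C)"
      by (auto simp: collineations_def BijGroup_def)
    have "((\<lambda>x\<in>points P. x), (\<lambda>l\<in>lines P. l)) \<in> collineations P"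
      by (simp add: collineations_def id_Bij)
    then show "collineations P \<noteq> {}" by blast
  next
    fix a assume a: "a \<in> collineations P"
    obtain f g where ag: "a = (f, g)" by (cases a)
    have f: "f \<in> Bij (points P)" and g: "g \<in> Bij (lines P)"
      and inc: "\<And>x l. x \<in> points P \<Longrightarrow> l \<in> lines P \<Longrightarrow> x \<in> l \<longleftrightarrow> f x \<in> g l"
      using a by (auto simp: ag collineations_def)
    have inv: "inv\<^bsub>?B \<times>\<times> ?C\<^esub> a = (inv\<^bsub>?B\<^esub> f, inv\<^bsub>?C\<^esub> g)"
      unfolding ag
      by (rule inv_DirProd[OF group_BijGroup group_BijGroup]) (simp_all add: BijGroup_def f g)
    have f': "inv\<^bsub>?B\<^esub> f \<in> Bij (points P)" and g': "inv\<^bsub>?C\<^esub> g \<in> Bij (lines P)"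
      using f g by (simp_all add: BijGroup_inv)
    have "x \<in> l \<longleftrightarrow> (inv\<^bsub>?B\<^esub> f) x \<in> (inv\<^bsub>?C\<^esub> g) l" if x: "x \<in> points P" and l: "l \<in> lines P" for x l
    proof -
      have "f ((inv\<^bsub>?B\<^esub> f) x) = x" "g ((inv\<^bsub>?C\<^esub> g) l) = l"
        using f g x l by (simp_all add: BijGroup_inv)
      moreover have "(inv\<^bsub>?B\<^esub> f) x \<in> points P" "(inv\<^bsub>?C\<^esub> g) l \<in> lines P"
        using f' g' x l by (auto simp: Bij_def bij_betw_def)
      ultimately show ?thesis using inc by metis
    qed
    then show "inv\<^bsub>?B \<times>\<times> ?C\<^esub> a \<in> collineations P"
      using f' g' by (simp add: inv collineations_def)
  next
    fix a b assume ab: "a \<in> collineations P" "b \<in> collineations P"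
    obtain f g f' g' where eq: "a = (f, g)" "b = (f', g')" by (cases a, cases b)
    have bij: "f \<in> Bij (points P)" "g \<in> Bij (lines P)" "f' \<in> Bij (points P)" "g' \<in> Bij (lines P)"
      using ab unfolding eq collineations_def by auto
    have inc: "x \<in> l \<longleftrightarrow> f (f' x) \<in> g (g' l)" if "x \<in> points P" "l \<in> lines P" for x l
    proof -
      have "f' x \<in> points P" "g' l \<in> lines P"
        using bij that by (auto simp: Bij_def bij_betw_def)
      moreover have "x \<in> l \<longleftrightarrow> f' x \<in> g' l"
        using ab(2) that unfolding eq collineations_def by blast
      moreover have "y \<in> m \<longleftrightarrow> f y \<in> g m" if "y \<in> points P" "m \<in> lines P" for y m
        using ab(1) that unfolding eq collineations_def by blast
      ultimately show ?thesis by metis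
    qed
    have "(compose (points P) f f', compose (lines P) g g') \<in> collineations P"
      unfolding collineations_def using bij by (simp add: compose_Bij compose_eq flip: inc)
    then show "a \<otimes>\<^bsub>?B \<times>\<times> ?C\<^esub> b \<in> collineations P"
      using bij by (simp add: eq BijGroup_def)
  qed
  then show ?thesis unfolding Aut_plane_def by (rule D.subgroup_imp_group)
qed

end

theory Submission
  imports Defs "HOL-Library.FSet"
begin

text \<open>
  The automorphism group of \<open>M\<close> is determined by its orbits on lists. Take the repetition-free lists over
  the universe as vertices, ordered by a well-order of their orbits, with edges joining a list to its
  one-entry extensions and to its last entry. A well-order is rigid, so an automorphism of this graph
  preserves orbits, and the edges force it to act entrywise; thus it is an automorphism of \<open>M\<close>.

  The graph is turned into a configuration in which every vertex and every ordered pair is a line and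
  all points but a few lie on at most two lines. Adding the trivial lines gives the simple plane. For
  the projective plane, a rigid Fano plane is attached to every point, after which each element lies
  in a finite confined configuration, that is, one in which every point is on at least three lines and
  every line has at least three points. In a free completion all finite confined configurations lie in
  the starting configuration, so its automorphisms extend those of the starting configuration
  uniquely. Three Fano planes sharing a point give a Desargues configuration that does not close.
\<close>

section \<open>Automorphisms of weighted sets\<close>

text \<open>The language may have more symbols than the universe has elements, so symbols cannot be
  coded one by one. What replaces them is the finiteness of arities: it makes the automorphism group
  closed under pointwise convergence, hence recoverable from its orbits on finite lists.
  Repetition-free lists can enumerate every finite set, and they are finite in number over a finite
  universe and at most as many as the elements over an infinite one; both claims about sizes rest on
  this. The orbits enter only through an order on the lists, so they need no vertices of their own.
  The two kinds of planes pull in opposite directions. A simple plane wants points on at most two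
  non-trivial lines, while elements of a free completion are pinned down by lying in configurations
  with three incidences everywhere. The Fano planes reconcile this: they are added after the coding,
  when only the projective plane is wanted, and without adding symmetries. The coding needs three
  exceptional points; the others among the 17 are padding.\<close>

definition weight_auts :: "'b set \<Rightarrow> ('b \<Rightarrow> 'b \<Rightarrow> 'w) \<Rightarrow> ('b \<Rightarrow> 'b) set" where
  "weight_auts B w = {t \<in> Bij B. \<forall>x\<in>B. \<forall>y\<in>B. w (t x) (t y) = w x y}"

text \<open>One kind of group for every stage: the weight is a colour with an adjacency for
  incidence graphs, and a pair of relations for the coded graph. Weights belong to pairs, so a
  colour enters as a function of the first argument.\<close>

definition Aut_weighted :: "'b set \<Rightarrow> ('b \<Rightarrow> 'b \<Rightarrow> 'w) \<Rightarrow> ('b \<Rightarrow> 'b) monoid" where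
  "Aut_weighted B w = BijGroup B \<lparr>carrier := weight_auts B w\<rparr>"

lemma weight_autsD:
  assumes "t \<in> weight_auts B w"
  shows "t \<in> Bij B" "\<And>x. x \<in> B \<Longrightarrow> t x \<in> B" "\<And>x y. x \<in> B \<Longrightarrow> y \<in> B \<Longrightarrow> t x = t y \<longleftrightarrow> x = y"
    "\<And>x y. x \<in> B \<Longrightarrow> y \<in> B \<Longrightarrow> w (t x) (t y) = w x y"
  using assms by (auto simp: weight_auts_def Bij_def bij_betw_def inj_on_def)

lemma weight_auts_surj:
  assumes "t \<in> weight_auts B w" "y \<in> B" obtains x where "x \<in> B" "y = t x"
proof -
  have "t ` B = B" using assms(1) by (auto simp: weight_auts_def Bij_def bij_betw_def)
  then show ?thesis using assms(2) that by blast
qed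

lemma weight_auts_inverse:
  assumes t: "t \<in> weight_auts B w"
  obtains s where "s \<in> weight_auts B w" "\<And>x. x \<in> B \<Longrightarrow> t (s x) = x" "\<And>x. x \<in> B \<Longrightarrow> s (t x) = x"
proof -
  note tB = weight_autsD(1)[OF t]
  let ?s = "inv\<^bsub>BijGroup B\<^esub> t"
  note s = BijGroup_inv[OF tB]
  have "?s x \<in> B" if "x \<in> B" for x using s(1) that by (auto simp: Bij_def bij_betw_def)
  then have "w (?s x) (?s y) = w x y" if "x \<in> B" "y \<in> B" for x y
    using weight_autsD(4)[OF t, of "?s x" "?s y"] that by (simp add: s)
  then have "?s \<in> weight_auts B w" using s(1) by (simp add: weight_auts_def)
  then show ?thesis using s that by blast
qed

lemma weight_auts_compose:
  assumes t: "t \<in> weight_auts B w" and s: "s \<in> weight_auts B w"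
  shows "compose B t s \<in> weight_auts B w"
  using compose_Bij[OF weight_autsD(1)[OF t] weight_autsD(1)[OF s]] weight_autsD[OF t] weight_autsD[OF s]
  by (simp add: weight_auts_def compose_eq)

lemma Aut_weighted_mult:
  "\<lbrakk>t \<in> weight_auts B w; s \<in> weight_auts B w\<rbrakk> \<Longrightarrow> t \<otimes>\<^bsub>Aut_weighted B w\<^esub> s = compose B t s"
  by (simp add: Aut_weighted_def BijGroup_def weight_autsD(1))

lemma carrier_Aut_weighted [simp]: "carrier (Aut_weighted B w) = weight_auts B w"
  by (simp add: Aut_weighted_def)

lemma Bij_mult: "\<lbrakk>f \<in> Bij A; g \<in> Bij A\<rbrakk> \<Longrightarrow> f \<otimes>\<^bsub>BijGroup A \<lparr>carrier := C\<rparr>\<^esub> g = compose A f g"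
  by (simp add: BijGroup_def)

lemma group_Aut_weighted: "group (Aut_weighted B w)"
proof -
  interpret G: group "BijGroup B" by (rule group_BijGroup)
  have "subgroup (weight_auts B w) (BijGroup B)"
  proof (rule G.subgroupI)
    show "weight_auts B w \<subseteq> carrier (BijGroup B)" by (auto simp: weight_auts_def BijGroup_def)
    have "(\<lambda>x\<in>B. x) \<in> weight_auts B w" by (simp add: weight_auts_def id_Bij)
    then show "weight_auts B w \<noteq> {}" by blast
  next
    fix t assume t: "t \<in> weight_auts B w"
    note s = BijGroup_inv[OF weight_autsD(1)[OF t]]
    obtain k where k: "k \<in> weight_auts B w" "\<And>x. x \<in> B \<Longrightarrow> t (k x) = x" "\<And>x. x \<in> B \<Longrightarrow> k (t x) = x"
      using weight_auts_inverse[OF t] by blast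
    have "(inv\<^bsub>BijGroup B\<^esub> t) x = k x" for x
    proof (cases "x \<in> B")
      case True
      then show ?thesis using s k weight_autsD(2)[OF k(1)] by metis
    next
      case False
      then show ?thesis using s(1) weight_autsD(1)[OF k(1)] by (auto simp: Bij_def extensional_def)
    qed
    then show "inv\<^bsub>BijGroup B\<^esub> t \<in> weight_auts B w" using k(1) by presburger
  next
    fix t s assume "t \<in> weight_auts B w" "s \<in> weight_auts B w"
    then show "t \<otimes>\<^bsub>BijGroup B\<^esub> s \<in> weight_auts B w"
      using weight_auts_compose[of t B w s] by (simp add: BijGroup_def weight_autsD(1))
  qed
  then show ?thesis unfolding Aut_weighted_def by (rule G.subgroup_imp_group)
qed

text \<open>
  Each step of the construction adjoins elements to a copy \<open>e ` A\<close> of the previous structure in a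
  functorial way, and \<open>m\<close> is the map function of a datatype. It then suffices that every automorphism
  of the larger structure comes from the functor.
\<close>

lemma functor_iso:
  fixes m :: "('a \<Rightarrow> 'a) \<Rightarrow> 'b \<Rightarrow> 'b" and e :: "'a \<Rightarrow> 'b"
  assumes e: "inj_on e A" "\<And>a. a \<in> A \<Longrightarrow> e a \<in> B" "\<And>h a. m h (e a) = e (h a)"
    and cong: "\<And>x h k. \<lbrakk>x \<in> B; \<And>a. a \<in> A \<Longrightarrow> h a = k a\<rbrakk> \<Longrightarrow> m h x = m k x"
    and ident: "\<And>x. m (\<lambda>a. a) x = x"
    and comp: "\<And>h k x. m h (m k x) = m (\<lambda>a. h (k a)) x"
    and C: "C \<subseteq> Bij A" "group (BijGroup A \<lparr>carrier := C\<rparr>)"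
    and lift: "\<And>h x. h \<in> C \<Longrightarrow> x \<in> B \<Longrightarrow> m h x \<in> B"
      "\<And>h x y. h \<in> C \<Longrightarrow> x \<in> B \<Longrightarrow> y \<in> B \<Longrightarrow> w (m h x) (m h y) = w x y"
    and full: "\<And>t. t \<in> weight_auts B w \<Longrightarrow> \<exists>h. (\<forall>a\<in>A. h a \<in> A) \<and> (\<forall>x\<in>B. t x = m h x)"
    and pres: "\<And>t h. \<lbrakk>t \<in> weight_auts B w; h \<in> Bij A; \<And>x. x \<in> B \<Longrightarrow> t x = m h x\<rbrakk> \<Longrightarrow> h \<in> C"
  shows "Aut_weighted B w \<cong> BijGroup A \<lparr>carrier := C\<rparr>"
proof -
  interpret C: group "BijGroup A \<lparr>carrier := C\<rparr>" by fact
  \<comment> \<open>\<open>full\<close> gives a map without bijectivity. Applied to the inverse of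
    \<open>t\<close> as well, it gives two maps that are inverse to each other on \<open>A\<close>,
    since \<open>e\<close> is injective and commutes with the action. Restricting to
    \<open>A\<close> makes the map extensional, as \<open>Bij A\<close> demands.\<close>
  have repr: "\<exists>h\<in>C. \<forall>x\<in>B. t x = m h x" if t: "t \<in> weight_auts B w" for t
  proof -
    obtain s where s: "s \<in> weight_auts B w" "\<And>x. x \<in> B \<Longrightarrow> t (s x) = x" "\<And>x. x \<in> B \<Longrightarrow> s (t x) = x"
      using weight_auts_inverse[OF t] by blast
    obtain h where h: "\<And>a. a \<in> A \<Longrightarrow> h a \<in> A" "\<And>x. x \<in> B \<Longrightarrow> t x = m h x" using full[OF t] by blast
    obtain k where k: "\<And>a. a \<in> A \<Longrightarrow> k a \<in> A" "\<And>x. x \<in> B \<Longrightarrow> s x = m k x" using full[OF s(1)] by blast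
    have "h (k a) = a \<and> k (h a) = a" if a: "a \<in> A" for a
    proof -
      have "e (h (k a)) = e a" "e (k (h a)) = e a"
        using s(2)[OF e(2)[OF a]] s(3)[OF e(2)[OF a]] a
        by (simp_all add: h(2) k(2) e(2,3) h(1) k(1))
      then show ?thesis using e(1) a h(1) k(1) by (auto simp: inj_on_def)
    qed
    then have "bij_betw h A A" using h(1) k(1) by (intro bij_betw_byWitness[where f' = k]) auto
    then have B: "restrict h A \<in> Bij A" by (auto simp: Bij_def cong: bij_betw_cong)
    have t': "t x = m (restrict h A) x" if "x \<in> B" for x
      using h(2)[OF that] cong[OF that, of h "restrict h A"] by simp
    have "restrict h A \<in> C" by (rule pres[OF t B t'])
    then show ?thesis using t' by blast
  qed
  define \<phi> where "\<phi> t = (SOME h. h \<in> C \<and> (\<forall>x\<in>B. t x = m h x))" for t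
  have phi: "\<phi> t \<in> C \<and> (\<forall>x\<in>B. t x = m (\<phi> t) x)" if "t \<in> weight_auts B w" for t
  proof -
    have "\<exists>h. h \<in> C \<and> (\<forall>x\<in>B. t x = m h x)" using repr[OF that] by blast
    then show ?thesis unfolding \<phi>_def by (rule someI_ex)
  qed
  have CA: "h a \<in> A" if "h \<in> C" "a \<in> A" for h a
    using C(1) that by (auto simp: Bij_def bij_betw_def)
  have uniq: "h = k" if "h \<in> C" "k \<in> C" "\<And>x. x \<in> B \<Longrightarrow> m h x = m k x" for h k
  proof (rule extensionalityI)
    show "h \<in> extensional A" "k \<in> extensional A" using that C(1) by (auto simp: Bij_def)
    show "h a = k a" if "a \<in> A" for a
      using \<open>\<And>x. x \<in> B \<Longrightarrow> m h x = m k x\<close>[OF e(2)[OF that]] e(1) CA \<open>h \<in> C\<close> \<open>k \<in> C\<close> that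
      by (auto simp: e(3) inj_on_def)
  qed
  have "\<phi> \<in> iso (Aut_weighted B w) (BijGroup A \<lparr>carrier := C\<rparr>)"
  proof (rule isoI)
    show "\<phi> \<in> hom (Aut_weighted B w) (BijGroup A \<lparr>carrier := C\<rparr>)"
    proof (rule homI)
      fix t s assume "t \<in> carrier (Aut_weighted B w)" "s \<in> carrier (Aut_weighted B w)"
      then have t: "t \<in> weight_auts B w" and s: "s \<in> weight_auts B w" by simp_all
      have b: "\<phi> t \<in> Bij A" "\<phi> s \<in> Bij A" using phi t s C(1) by blast+
      have c: "compose A (\<phi> t) (\<phi> s) \<in> C"
        using C.m_closed[of "\<phi> t" "\<phi> s"] phi t s Bij_mult[OF b] by simp
      have "\<phi> (compose B t s) = compose A (\<phi> t) (\<phi> s)"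
      proof (rule uniq[OF _ c])
        show "\<phi> (compose B t s) \<in> C" using phi weight_auts_compose[OF t s] by blast
        fix x assume x: "x \<in> B"
        have "m (\<phi> (compose B t s)) x = t (s x)"
          using phi[OF weight_auts_compose[OF t s]] x by (simp add: compose_eq)
        also have "\<dots> = m (\<phi> t) (m (\<phi> s) x)" using phi[OF t] phi[OF s] weight_autsD(2)[OF s x] x by simp
        also have "\<dots> = m (compose A (\<phi> t) (\<phi> s)) x"
          unfolding comp by (rule cong[OF x]) (simp add: compose_eq)
        finally show "m (\<phi> (compose B t s)) x = m (compose A (\<phi> t) (\<phi> s)) x" .
      qed
      then show "\<phi> (t \<otimes>\<^bsub>Aut_weighted B w\<^esub> s) = \<phi> t \<otimes>\<^bsub>BijGroup A \<lparr>carrier := C\<rparr>\<^esub> \<phi> s"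
        by (simp only: Bij_mult[OF b] Aut_weighted_mult[OF t s])
    qed (use phi in simp)
    have "inj_on \<phi> (weight_auts B w)"
    proof (rule inj_onI)
      fix t s assume t: "t \<in> weight_auts B w" and s: "s \<in> weight_auts B w" and "\<phi> t = \<phi> s"
      then have "t x = s x" if "x \<in> B" for x using phi that by metis
      then show "t = s"
        using weight_autsD(1)[OF t] weight_autsD(1)[OF s] by (auto simp: Bij_def intro: extensionalityI)
    qed
    moreover have "\<exists>t\<in>weight_auts B w. h = \<phi> t" if h: "h \<in> C" for h
    proof -
      obtain k where k: "k \<in> C" "compose A h k = (\<lambda>x\<in>A. x)" "compose A k h = (\<lambda>x\<in>A. x)"
      proof -
        obtain k where k: "k \<in> C" "h \<otimes>\<^bsub>BijGroup A \<lparr>carrier := C\<rparr>\<^esub> k = \<one>\<^bsub>BijGroup A \<lparr>carrier := C\<rparr>\<^esub>"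
            "k \<otimes>\<^bsub>BijGroup A \<lparr>carrier := C\<rparr>\<^esub> h = \<one>\<^bsub>BijGroup A \<lparr>carrier := C\<rparr>\<^esub>"
          using C.r_inv[of h] C.l_inv[of h] C.inv_closed[of h] h by auto
        have "h \<in> Bij A" "k \<in> Bij A" using C(1) h k by blast+
        then show ?thesis using k that by (simp only: Bij_mult) (simp add: BijGroup_def)
      qed
      have hk: "h (k a) = a" "k (h a) = a" if "a \<in> A" for a
        using fun_cong[OF k(2), of a] fun_cong[OF k(3), of a] that by (simp_all add: compose_eq)
      have inv: "m h (m k x) = x" "m k (m h x) = x" if "x \<in> B" for x
        using cong[OF that, of "\<lambda>a. h (k a)" "\<lambda>a. a"] cong[OF that, of "\<lambda>a. k (h a)" "\<lambda>a. a"]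
        by (simp_all add: comp hk ident)
      have "bij_betw (m h) B B"
        by (rule bij_betw_byWitness[where f' = "m k"]) (use inv lift(1) h k(1) in auto)
      then have t: "restrict (m h) B \<in> weight_auts B w"
        using lift(2)[OF h] by (auto simp: weight_auts_def Bij_def cong: bij_betw_cong)
      have "h = \<phi> (restrict (m h) B)"
        by (rule uniq) (use phi[OF t] h in auto)
      then show ?thesis using t by blast
    qed
    ultimately show "bij_betw \<phi> (carrier (Aut_weighted B w)) (carrier (BijGroup A \<lparr>carrier := C\<rparr>))"
      using phi by (auto simp: bij_betw_def)
  qed
  then show ?thesis by (auto simp: is_iso_def)
qed

section \<open>Planes from incidence graphs\<close>

text \<open>Points and lines are vertices of one bipartite graph, the colour \<open>c\<close>
  marking the points. The exclusion of four-cycles in \<open>linear\<close> is its own dual: two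
  points have at most one common line, and two lines at most one common point.\<close>

locale incidence_graph =
  fixes V :: "'e set" and c :: "'e \<Rightarrow> bool" and adj :: "'e \<Rightarrow> 'e \<Rightarrow> bool"
  assumes adj_sym: "adj x y \<Longrightarrow> adj y x"
    and bipartite: "\<lbrakk>x \<in> V; y \<in> V; adj x y\<rbrakk> \<Longrightarrow> c x \<noteq> c y"
    and linear: "\<lbrakk>x \<in> V; y \<in> V; a \<in> V; b \<in> V; x \<noteq> y; adj x a; adj y a; adj x b; adj y b\<rbrakk> \<Longrightarrow> a = b"

text \<open>The colour in the weight rules out correlations, which exchange points and
  lines.\<close>

abbreviation inc_weight :: "('e \<Rightarrow> bool) \<Rightarrow> ('e \<Rightarrow> 'e \<Rightarrow> bool) \<Rightarrow> 'e \<Rightarrow> 'e \<Rightarrow> bool \<times> bool" where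
  "inc_weight c adj \<equiv> \<lambda>x y. (c x, adj x y)"

abbreviation inc_auts :: "'e set \<Rightarrow> ('e \<Rightarrow> bool) \<Rightarrow> ('e \<Rightarrow> 'e \<Rightarrow> bool) \<Rightarrow> ('e \<Rightarrow> 'e) set" where
  "inc_auts V c adj \<equiv> weight_auts V (inc_weight c adj)"

lemma inc_autsD:
  assumes "t \<in> inc_auts V c adj"
  shows "\<And>x. x \<in> V \<Longrightarrow> t x \<in> V" "\<And>x y. x \<in> V \<Longrightarrow> y \<in> V \<Longrightarrow> t x = t y \<longleftrightarrow> x = y"
    "\<And>x. x \<in> V \<Longrightarrow> c (t x) = c x" "\<And>x y. x \<in> V \<Longrightarrow> y \<in> V \<Longrightarrow> adj (t x) (t y) = adj x y"
  using weight_autsD[OF assms] by auto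

lemma inc_auts_nbs:
  assumes t: "t \<in> inc_auts V c adj" and l: "l \<in> V"
  shows "{x \<in> V. adj x (t l)} = t ` {x \<in> V. adj x l}"
proof
  show "t ` {x \<in> V. adj x l} \<subseteq> {x \<in> V. adj x (t l)}" using inc_autsD[OF t] l by auto
  show "{x \<in> V. adj x (t l)} \<subseteq> t ` {x \<in> V. adj x l}"
  proof
    fix y assume y: "y \<in> {x \<in> V. adj x (t l)}"
    then obtain x where "x \<in> V" "y = t x" using weight_auts_surj[OF t] by blast
    then show "y \<in> t ` {x \<in> V. adj x l}" using y inc_autsD(4)[OF t] l by blast
  qed
qed

lemma inc_auts_joined:
  assumes t: "t \<in> inc_auts V c adj" and xy: "x \<in> V" "y \<in> V"
  shows "(\<exists>l\<in>V. adj (t x) l \<and> adj (t y) l) \<longleftrightarrow> (\<exists>l\<in>V. adj x l \<and> adj y l)"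
proof
  assume "\<exists>l\<in>V. adj (t x) l \<and> adj (t y) l"
  then obtain l where l: "l \<in> V" "adj (t x) l" "adj (t y) l" by blast
  then obtain k where "k \<in> V" "l = t k" using weight_auts_surj[OF t] by blast
  then show "\<exists>l\<in>V. adj x l \<and> adj y l" using l inc_autsD(4)[OF t] xy by blast
next
  assume "\<exists>l\<in>V. adj x l \<and> adj y l"
  then obtain l where "l \<in> V" "adj x l" "adj y l" by blast
  then show "\<exists>l\<in>V. adj (t x) l \<and> adj (t y) l"
    using inc_autsD(1,4)[OF t] xy by (intro bexI[of _ "t l"]) auto
qed

text \<open>The second set supplies a two-point line for each pair of points that the graph leaves
  unjoined; it is empty for a free completion. The map \<open>\<iota>\<close> moves the points into
  a type fixed in advance, the natural numbers or the type of the universe.\<close>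

definition plane_of :: "('e \<Rightarrow> 'p) \<Rightarrow> 'e set \<Rightarrow> ('e \<Rightarrow> bool) \<Rightarrow> ('e \<Rightarrow> 'e \<Rightarrow> bool) \<Rightarrow> 'p incidence" where
  "plane_of \<iota> V c adj =
    \<lparr>points = \<iota> ` {x \<in> V. c x},
     lines = (\<lambda>l. \<iota> ` {x \<in> V. adj x l}) ` {l \<in> V. \<not> c l} \<union>
       {{\<iota> x, \<iota> y} | x y. x \<in> V \<and> y \<in> V \<and> c x \<and> c y \<and> x \<noteq> y \<and> \<not> (\<exists>l\<in>V. adj x l \<and> adj y l)}\<rparr>"

locale plane_graph = incidence_graph V c adj for V :: "'e set" and c adj +
  fixes \<iota> :: "'e \<Rightarrow> 'p"
  assumes inj: "inj_on \<iota> {x \<in> V. c x}"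
    and two: "\<And>l. \<lbrakk>l \<in> V; \<not> c l\<rbrakk> \<Longrightarrow> \<exists>x\<in>V. \<exists>y\<in>V. x \<noteq> y \<and> adj x l \<and> adj y l"
    and noncol: "\<exists>x\<in>V. \<exists>y\<in>V. \<exists>z\<in>V. c x \<and> c y \<and> c z \<and> x \<noteq> y \<and> x \<noteq> z \<and> y \<noteq> z \<and>
      \<not> (\<exists>l\<in>V. adj x l \<and> adj y l \<and> adj z l)"
begin

abbreviation "P \<equiv> plane_of \<iota> V c adj"

definition line_of :: "'e \<Rightarrow> 'p set" where
  "line_of l = \<iota> ` {x \<in> V. adj x l}"

definition unjoined :: "'e \<Rightarrow> 'e \<Rightarrow> bool" where
  "unjoined x y \<longleftrightarrow> x \<in> V \<and> y \<in> V \<and> c x \<and> c y \<and> x \<noteq> y \<and> \<not> (\<exists>l\<in>V. adj x l \<and> adj y l)"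

lemma points_P: "points P = \<iota> ` {x \<in> V. c x}"
  by (simp add: plane_of_def)

lemma lines_P: "lines P = line_of ` {l \<in> V. \<not> c l} \<union> {{\<iota> x, \<iota> y} | x y. unjoined x y}"
  by (simp add: plane_of_def line_of_def[abs_def] unjoined_def)

lemma inj_iff: "\<lbrakk>x \<in> V; c x; y \<in> V; c y\<rbrakk> \<Longrightarrow> \<iota> x = \<iota> y \<longleftrightarrow> x = y"
  using inj by (auto simp: inj_on_def)

lemma mem_line_of:
  assumes "x \<in> V" "c x" "l \<in> V" "\<not> c l"
  shows "\<iota> x \<in> line_of l \<longleftrightarrow> adj x l"
proof
  assume "\<iota> x \<in> line_of l"
  then obtain y where y: "y \<in> V" "adj y l" "\<iota> x = \<iota> y" by (auto simp: line_of_def)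
  then have "c y" using bipartite[of y l] assms by blast
  then show "adj x l" using y inj_iff assms by metis
qed (use assms in \<open>auto simp: line_of_def\<close>)

lemma line_of_subset: "l \<in> V \<Longrightarrow> \<not> c l \<Longrightarrow> line_of l \<subseteq> points P"
  using bipartite by (fastforce simp: line_of_def points_P)

lemma line_of_inj:
  assumes "l \<in> V" "\<not> c l" "m \<in> V" "\<not> c m" "line_of l = line_of m"
  shows "l = m"
proof -
  obtain x y where xy: "x \<in> V" "y \<in> V" "x \<noteq> y" "adj x l" "adj y l" using two assms by blast
  then have "c x" "c y" using bipartite[of x l] bipartite[of y l] assms by blast+
  then have "adj x m" "adj y m" using mem_line_of xy assms by blast+
  then show ?thesis using linear[of x y l m] xy assms by blast
qed

lemma lineE:
  assumes "L \<in> lines P"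
  obtains l where "l \<in> V" "\<not> c l" "L = line_of l" | x y where "unjoined x y" "L = {\<iota> x, \<iota> y}"
  using assms by (auto simp: lines_P)

lemma line_unique:
  assumes L: "L \<in> lines P" and xy: "x \<in> V" "c x" "y \<in> V" "c y" "x \<noteq> y" "\<iota> x \<in> L" "\<iota> y \<in> L"
  shows "unjoined x y \<and> L = {\<iota> x, \<iota> y} \<or> (\<exists>l\<in>V. \<not> c l \<and> adj x l \<and> adj y l \<and> L = line_of l)"
  using L
proof (cases rule: lineE)
  case (1 l)
  then show ?thesis using mem_line_of xy by blast
next
  case (2 x' y')
  then have "x = x' \<and> y = y' \<or> x = y' \<and> y = x'"
    using xy inj_iff unfolding unjoined_def by auto
  then show ?thesis using 2 by (auto simp: unjoined_def)
qed

lemma line_unique':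
  assumes L: "L \<in> lines P" "M \<in> lines P" and ab: "a \<in> points P" "b \<in> points P" "a \<noteq> b"
    "a \<in> L" "b \<in> L" "a \<in> M" "b \<in> M"
  shows "L = M"
proof -
  obtain x y where xy: "a = \<iota> x" "b = \<iota> y" "x \<in> V" "c x" "y \<in> V" "c y" "x \<noteq> y"
    using ab by (auto simp: points_P)
  then have "unjoined x y \<and> N = {\<iota> x, \<iota> y} \<or> (\<exists>l\<in>V. \<not> c l \<and> adj x l \<and> adj y l \<and> N = line_of l)"
    if "N \<in> lines P" "a \<in> N" "b \<in> N" for N
    using line_unique[OF that(1)] that by blast
  from this[of L] this[of M] show ?thesis
    using L ab xy linear[of x y] unfolding unjoined_def by blast
qed

lemma line_exists:
  assumes "a \<in> points P" "b \<in> points P" "a \<noteq> b"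
  shows "\<exists>L\<in>lines P. a \<in> L \<and> b \<in> L"
proof -
  obtain x y where xy: "a = \<iota> x" "b = \<iota> y" "x \<in> V" "c x" "y \<in> V" "c y" "x \<noteq> y"
    using assms by (auto simp: points_P)
  show ?thesis
  proof (cases "unjoined x y")
    case True
    then show ?thesis using xy unfolding lines_P by blast
  next
    case False
    then obtain l where l: "l \<in> V" "adj x l" "adj y l" using xy by (auto simp: unjoined_def)
    then have "\<not> c l" using bipartite[of x l] xy by blast
    then show ?thesis using l xy mem_line_of by (auto simp: lines_P)
  qed
qed

lemma line_subset: "L \<in> lines P \<Longrightarrow> L \<subseteq> points P"
  by (erule lineE) (use line_of_subset in \<open>auto simp: points_P unjoined_def\<close>)

lemma plane_P: "plane P"
proof
  show "\<exists>!l. l \<in> lines P \<and> a \<in> l \<and> b \<in> l" if "a \<in> points P" "b \<in> points P" "a \<noteq> b" for a b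
    using line_exists[OF that] line_unique'[OF _ _ that] by blast
  show "x = y" if "l \<in> lines P" "m \<in> lines P" "l \<noteq> m" "x \<in> l \<inter> m" "y \<in> l \<inter> m" for l m x y
    using line_unique'[of l m x y] line_subset that by blast
  show "\<exists>a\<in>l. \<exists>b\<in>l. a \<noteq> b" if "l \<in> lines P" for l
    using that
  proof (cases rule: lineE)
    case (1 l')
    then obtain x y where xy: "x \<in> V" "y \<in> V" "x \<noteq> y" "adj x l'" "adj y l'" using two by blast
    then have "c x" "c y" using bipartite[of x l'] bipartite[of y l'] 1 by blast+
    then show ?thesis using xy 1 mem_line_of inj_iff by metis
  next
    case (2 x y)
    then show ?thesis using inj_iff by (auto simp: unjoined_def)
  qed
  obtain x y z where xyz: "x \<in> V" "y \<in> V" "z \<in> V" "c x" "c y" "c z" "x \<noteq> y" "x \<noteq> z" "y \<noteq> z"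
    "\<not> (\<exists>l\<in>V. adj x l \<and> adj y l \<and> adj z l)" using noncol by blast
  have "\<not> collinear P (\<iota> x) (\<iota> y) (\<iota> z)"
  proof
    assume "collinear P (\<iota> x) (\<iota> y) (\<iota> z)"
    then obtain L where L: "L \<in> lines P" "\<iota> x \<in> L" "\<iota> y \<in> L" "\<iota> z \<in> L" by (auto simp: collinear_def)
    show False
      using line_unique[OF L(1) xyz(1,4,2,5,7) L(2,3)]
    proof (elim disjE conjE bexE)
      show False if "L = {\<iota> x, \<iota> y}" using that L(4) xyz inj_iff by auto
      show False if "l \<in> V" "\<not> c l" "adj x l" "adj y l" "L = line_of l" for l
        using that L(4) xyz mem_line_of by blast
    qed
  qed
  then show "\<exists>a\<in>points P. \<exists>b\<in>points P. \<exists>c\<in>points P. a \<noteq> b \<and> a \<noteq> c \<and> b \<noteq> c \<and> \<not> collinear P a b c"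
    using xyz inj_iff unfolding points_P
    by (intro bexI[of _ "\<iota> x"] bexI[of _ "\<iota> y"] bexI[of _ "\<iota> z"]) auto
qed (use line_subset in blast)

lemma simple_P:
  assumes thick: "\<And>l. \<lbrakk>l \<in> V; \<not> c l\<rbrakk> \<Longrightarrow> card {x \<in> V. adj x l} \<noteq> 2"
    and S: "S \<subseteq> {x \<in> V. c x}" "card S = 17"
    and small: "\<And>x. \<lbrakk>x \<in> V; c x; x \<notin> S\<rbrakk> \<Longrightarrow> \<exists>l m. \<forall>k\<in>V. adj x k \<longrightarrow> k = l \<or> k = m"
  shows "simple_plane P"
  unfolding simple_plane_def
proof (intro conjI exI[of _ "\<iota> ` S"] ballI)
  show "\<iota> ` S \<subseteq> points P" using S by (auto simp: points_P)
  show "card (\<iota> ` S) = 17"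
    using S inj by (simp add: card_image inj_on_subset)
  fix a assume "a \<in> points P - \<iota> ` S"
  then obtain x where x: "a = \<iota> x" "x \<in> V" "c x" "x \<notin> S" by (auto simp: points_P)
  obtain l m where lm: "\<forall>k\<in>V. adj x k \<longrightarrow> k = l \<or> k = m" using small x by blast
  \<comment> \<open>The added lines have two points and are trivial, so only graph lines through the
    point count.\<close>
  have "nontrivial_lines_at P a \<subseteq> {line_of l, line_of m}"
  proof
    fix L assume "L \<in> nontrivial_lines_at P a"
    then have L: "L \<in> lines P" "a \<in> L" "card L \<noteq> 2"
      by (auto simp: nontrivial_lines_at_def trivial_line_def)
    from L(1) show "L \<in> {line_of l, line_of m}"
    proof (cases rule: lineE)
      case (1 k)
      then show ?thesis using mem_line_of[of x k] L x lm by blast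
    next
      case (2 y z)
      then show ?thesis using L(3) inj_iff[of y z] by (auto simp: unjoined_def card_insert_if)
    qed
  qed
  then show "finite (nontrivial_lines_at P a)" "card (nontrivial_lines_at P a) \<le> 2"
    by (auto intro: finite_subset dest: card_mono[rotated] simp: card_insert_if split: if_splits)
qed (rule plane_P)

lemma projective_P:
  assumes joined: "\<And>x y. \<lbrakk>x \<in> V; y \<in> V; c x = c y; x \<noteq> y\<rbrakk> \<Longrightarrow> \<exists>z\<in>V. adj x z \<and> adj y z"
  shows "projective_plane P"
proof -
  interpret plane P by (rule plane_P)
  show ?thesis
  proof
    fix L M assume LM: "L \<in> lines P" "M \<in> lines P" "L \<noteq> M"
    have "\<not> unjoined x y" for x y using joined by (auto simp: unjoined_def)
    then obtain l m where lm: "l \<in> V" "\<not> c l" "L = line_of l" "m \<in> V" "\<not> c m" "M = line_of m"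
      using LM lineE by metis
    then obtain x where x: "x \<in> V" "adj l x" "adj m x" using joined[of l m] LM by blast
    then have "c x" using bipartite[of l x] lm by blast
    then have "\<iota> x \<in> L \<inter> M" using x lm mem_line_of adj_sym by blast
    then show "\<exists>!x. x \<in> L \<inter> M" using at_most_one_point[OF LM] by blast
  qed
qed

lemma join_eq:
  assumes "x \<in> V" "y \<in> V" "c x" "x \<noteq> y" "l \<in> V" "adj x l" "adj y l"
  shows "join P (\<iota> x) (\<iota> y) = line_of l"
proof -
  have lc: "\<not> c l" and cy: "c y"
    using bipartite[of x l] bipartite[of y l] assms by blast+
  have l: "line_of l \<in> lines P" "\<iota> x \<in> line_of l" "\<iota> y \<in> line_of l"
    using assms lc cy mem_line_of[of _ l] by (auto simp: lines_P)
  have "\<iota> x \<in> points P" "\<iota> y \<in> points P" "\<iota> x \<noteq> \<iota> y" using assms cy inj_iff by (auto simp: points_P)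
  then show ?thesis unfolding join_def using l line_unique'[OF _ l(1)] by (intro the_equality) auto
qed

lemma meet_eq:
  assumes "l \<in> V" "m \<in> V" "\<not> c l" "l \<noteq> m" "x \<in> V" "adj x l" "adj x m"
  shows "meet (line_of l) (line_of m) = \<iota> x"
proof -
  have x: "c x" and m: "\<not> c m" using bipartite[of x l] bipartite[of x m] assms by blast+
  then have "\<iota> x \<in> line_of l \<inter> line_of m" using mem_line_of assms by blast
  moreover have "a = \<iota> x" if a: "a \<in> line_of l \<inter> line_of m" for a
  proof -
    obtain y where y: "a = \<iota> y" "y \<in> V" "c y" using line_of_subset[of l] assms a unfolding points_P by blast
    then have "adj y l" "adj y m" using mem_line_of a assms m by blast+
    then show ?thesis using linear[of x y l m] y assms by blast
  qed
  ultimately show ?thesis unfolding meet_def by (rule the_equality)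
qed

text \<open>A graph automorphism also permutes the unjoined pairs. Conversely, a collineation must
  not exchange graph lines with added two-point lines: either size tells them apart (an infinite
  line has \<open>card\<close> 0, which also differs from 2), or nothing was added.\<close>

lemma Aut_plane_iso:
  assumes thick: "(\<forall>l\<in>V. \<not> c l \<longrightarrow> card {x \<in> V. adj x l} \<noteq> 2) \<or> (\<forall>x y. \<not> unjoined x y)"
  shows "Aut_plane P \<cong> Aut_weighted V (inc_weight c adj)"
proof -
  let ?X = "points P" and ?L = "lines P" and ?LN = "line_of ` {l \<in> V. \<not> c l}"
  let ?A = "inc_auts V c adj"
  define j where "j = inv_into {x \<in> V. c x} \<iota>"
  have j: "j (\<iota> x) = x" if "x \<in> V" "c x" for x unfolding j_def using inj that by simp
  have X: "j a \<in> V" "c (j a)" "\<iota> (j a) = a" if "a \<in> ?X" for a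
    using that j by (auto simp: points_P)
  define f where "f t = (\<lambda>a\<in>?X. \<iota> (t (j a)))" for t
  define \<phi> where "\<phi> t = (f t, \<lambda>L\<in>?L. f t ` L)" for t
  have f_iota: "f t (\<iota> x) = \<iota> (t x)" if "x \<in> V" "c x" for t x
    using that j by (simp add: f_def points_P)
  have f_X: "f t a \<in> ?X" if "t \<in> ?A" "a \<in> ?X" for t a
    using inc_autsD[OF that(1)] X[OF that(2)] that(2) by (auto simp: f_def points_P)
  have f_comp: "f (compose V t s) a = f t (f s a)" if "t \<in> ?A" "s \<in> ?A" "a \<in> ?X" for t s a
    using inc_autsD[OF that(2)] X[OF that(3)] that(3) f_X[OF that(2,3)] j by (simp add: f_def compose_eq)
  have f_line_of: "f t ` line_of l = line_of (t l)" if t: "t \<in> ?A" and l: "l \<in> V" "\<not> c l" for t l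
  proof -
    have "{x \<in> V. adj x (t l)} = t ` {x \<in> V. adj x l}"
      by (rule inc_auts_nbs[OF t l(1)])
    moreover have "f t ` line_of l = \<iota> ` t ` {x \<in> V. adj x l}"
      unfolding line_of_def image_image
      by (rule image_cong[OF refl]) (use bipartite l f_iota in blast)
    ultimately show ?thesis by (simp add: line_of_def)
  qed
  have f_L: "f t ` L \<in> ?L" if t: "t \<in> ?A" and L: "L \<in> ?L" for t L
    using L
  proof (cases rule: lineE)
    case (1 l)
    then show ?thesis using f_line_of[OF t] inc_autsD[OF t] by (auto simp: lines_P)
  next
    case (2 x y)
    have "\<not> (\<exists>l\<in>V. adj (t x) l \<and> adj (t y) l)"
      using 2 inc_auts_joined[OF t] by (auto simp: unjoined_def)
    then have "unjoined (t x) (t y)" using 2 inc_autsD[OF t] by (simp add: unjoined_def)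
    moreover have "f t ` L = {\<iota> (t x), \<iota> (t y)}" using 2 f_iota by (simp add: unjoined_def)
    ultimately show ?thesis by (auto simp: lines_P)
  qed
  have f_inv: "f t (f s a) = a"
    if "t \<in> ?A" "s \<in> ?A" "\<And>x. x \<in> V \<Longrightarrow> t (s x) = x" "a \<in> ?X" for t s a
    using f_comp[OF that(1,2,4)] X[OF that(4)] that(3,4) by (simp add: f_def compose_eq)
  have coll: "\<phi> t \<in> collineations P" if t: "t \<in> ?A" for t
  proof -
    obtain s where s: "s \<in> ?A" "\<And>x. x \<in> V \<Longrightarrow> t (s x) = x" "\<And>x. x \<in> V \<Longrightarrow> s (t x) = x"
      using weight_auts_inverse[OF t] by blast
    note fi = f_inv[OF t s(1,2)] f_inv[OF s(1) t s(3)]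
    have "bij_betw (f t) ?X ?X"
      by (rule bij_betw_byWitness[where f' = "f s"]) (use fi f_X t s(1) in auto)
    moreover have "f t ` f s ` L = L" "f s ` f t ` L = L" if "L \<in> ?L" for L
      using line_subset[OF that] fi by (force simp: image_image)+
    then have "bij_betw (\<lambda>L. f t ` L) ?L ?L"
      by (intro bij_betw_byWitness[where f' = "\<lambda>L. f s ` L"]) (use f_L t s(1) in auto)
    moreover have "a \<in> L \<longleftrightarrow> f t a \<in> f t ` L" if "a \<in> ?X" "L \<in> ?L" for a L
    proof
      assume "f t a \<in> f t ` L"
      then obtain b where "b \<in> L" "f t a = f t b" by blast
      then show "a \<in> L" using fi(2) line_subset[OF that(2)] that(1) by (metis subsetD)
    qed simp
    ultimately show ?thesis
      by (auto simp: collineations_def \<phi>_def Bij_def f_def cong: bij_betw_cong)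
  qed
  have "\<phi> \<in> iso (Aut_weighted V (inc_weight c adj)) (Aut_plane P)"
  proof (rule isoI)
    show "\<phi> \<in> hom (Aut_weighted V (inc_weight c adj)) (Aut_plane P)"
    proof (rule homI)
      fix t s assume "t \<in> carrier (Aut_weighted V (inc_weight c adj))"
        "s \<in> carrier (Aut_weighted V (inc_weight c adj))"
      then have t: "t \<in> ?A" and s: "s \<in> ?A" by simp_all
      have b: "f t \<in> Bij ?X" "f s \<in> Bij ?X" "(\<lambda>L\<in>?L. f t ` L) \<in> Bij ?L" "(\<lambda>L\<in>?L. f s ` L) \<in> Bij ?L"
        using coll[OF t] coll[OF s] by (auto simp: collineations_def \<phi>_def)
      have 1: "f (compose V t s) = compose ?X (f t) (f s)"
        by (rule ext) (use f_comp[OF t s] in \<open>auto simp: compose_def f_def\<close>)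
      have "f (compose V t s) ` L = f t ` f s ` L" if "L \<in> ?L" for L
        unfolding image_image by (rule image_cong[OF refl]) (use f_comp[OF t s] line_subset[OF that] in blast)
      then have 2: "(\<lambda>L\<in>?L. f (compose V t s) ` L) = compose ?L (\<lambda>L\<in>?L. f t ` L) (\<lambda>L\<in>?L. f s ` L)"
        using f_L[OF s] by (intro ext) (auto simp: compose_def)
      show "\<phi> (t \<otimes>\<^bsub>Aut_weighted V (inc_weight c adj)\<^esub> s) = \<phi> t \<otimes>\<^bsub>Aut_plane P\<^esub> \<phi> s"
        unfolding Aut_weighted_mult[OF t s] using 1 2 b by (simp add: \<phi>_def Aut_plane_def BijGroup_def)
    qed (use coll in \<open>simp add: Aut_plane_def\<close>)
    have "inj_on \<phi> ?A"
    proof (rule inj_onI)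
      fix t s assume t: "t \<in> ?A" and s: "s \<in> ?A" and "\<phi> t = \<phi> s"
      then have eq: "f t = f s" by (simp add: \<phi>_def)
      have "t x = s x" if x: "x \<in> V" for x
      proof (cases "c x")
        case True
        then show ?thesis
          using fun_cong[OF eq, of "\<iota> x"] f_iota[OF x True] inj_iff inc_autsD[OF t] inc_autsD[OF s] x by metis
      next
        case False
        then show ?thesis
          using f_line_of[OF t x] f_line_of[OF s x] eq line_of_inj inc_autsD[OF t] inc_autsD[OF s] x by metis
      qed
      then show "t = s"
        using weight_autsD(1)[OF t] weight_autsD(1)[OF s] by (auto simp: Bij_def intro: extensionalityI)
    qed
    moreover have "\<exists>t\<in>?A. (F, G) = \<phi> t" if FG: "(F, G) \<in> collineations P" for F G
    proof -
      have F: "bij_betw F ?X ?X" "F \<in> extensional ?X" and G: "bij_betw G ?L ?L" "G \<in> extensional ?L"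
        and inc: "\<And>a L. a \<in> ?X \<Longrightarrow> L \<in> ?L \<Longrightarrow> a \<in> L \<longleftrightarrow> F a \<in> G L"
        using FG by (auto simp: collineations_def Bij_def)
      note FX = bij_betwE[OF F(1), rule_format] and GL = bij_betwE[OF G(1), rule_format]
      \<comment> \<open>Lines are sets of points, so the point map of a collineation forces its line
        map.\<close>
      have GF: "G L = F ` L" if L: "L \<in> ?L" for L
      proof
        show "F ` L \<subseteq> G L" using inc line_subset[OF L] L by blast
        show "G L \<subseteq> F ` L"
        proof
          fix b assume b: "b \<in> G L"
          then have "b \<in> ?X" using line_subset[OF GL[OF L]] by blast
          then obtain a where a: "a \<in> ?X" "b = F a" using F(1) by (auto simp: bij_betw_def)
          then show "b \<in> F ` L" using inc L b by blast
        qed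
      qed
      have GLN: "G L \<in> ?LN \<longleftrightarrow> L \<in> ?LN" if L: "L \<in> ?L" for L
        using thick
      proof
        assume *: "\<forall>l\<in>V. \<not> c l \<longrightarrow> card {x \<in> V. adj x l} \<noteq> 2"
        have crit: "M \<in> ?LN \<longleftrightarrow> card M \<noteq> 2" if "M \<in> ?L" for M
        proof -
          have "card (line_of l) \<noteq> 2" if l: "l \<in> V" "\<not> c l" for l
          proof -
            have "inj_on \<iota> {x \<in> V. adj x l}"
              by (rule inj_on_subset[OF inj]) (use bipartite l in blast)
            then show ?thesis using * l by (simp add: line_of_def card_image)
          qed
          moreover have "card {\<iota> x, \<iota> y} = 2" if "unjoined x y" for x y
            using that inj_iff by (auto simp: unjoined_def card_insert_if)
          ultimately show ?thesis using \<open>M \<in> ?L\<close> by (auto simp: lines_P)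
        qed
        have "inj_on F L" using F(1) line_subset[OF L] by (auto simp: bij_betw_def inj_on_subset)
        then show ?thesis using crit[OF L] crit[OF GL[OF L]] by (simp add: GF[OF L] card_image)
      next
        assume "\<forall>x y. \<not> unjoined x y"
        then show ?thesis using L GL[OF L] by (simp add: lines_P)
      qed
      define k where "k = inv_into {l \<in> V. \<not> c l} line_of"
      have k: "k (line_of l) = l" if "l \<in> V" "\<not> c l" for l
        unfolding k_def by (rule inv_into_f_f) (use that line_of_inj in \<open>auto simp: inj_on_def\<close>)
      have kL: "k L \<in> V" "\<not> c (k L)" "line_of (k L) = L" if "L \<in> ?LN" for L
        using that k by auto
      have lnL: "line_of l \<in> ?L" "G (line_of l) \<in> ?LN" if "l \<in> V" "\<not> c l" for l
        using that GLN by (auto simp: lines_P)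
      have ioX: "\<iota> x \<in> ?X" if "x \<in> V" "c x" for x using that by (auto simp: points_P)
      \<comment> \<open>On lines \<open>t\<close> is read off from \<open>G\<close>, which by
        \<open>GLN\<close> sends graph lines to graph lines.\<close>
      define t where "t = (\<lambda>x\<in>V. if c x then j (F (\<iota> x)) else k (G (line_of x)))"
      have tp: "t x \<in> V" "c (t x)" "\<iota> (t x) = F (\<iota> x)" if "x \<in> V" "c x" for x
        using that X[OF FX[OF ioX[OF that]]] by (simp_all add: t_def)
      have tl: "t l \<in> V" "\<not> c (t l)" "line_of (t l) = G (line_of l)" if "l \<in> V" "\<not> c l" for l
        using that kL[OF lnL(2)[OF that]] by (simp_all add: t_def)
      have tV: "t x \<in> V" "c (t x) = c x" if "x \<in> V" for x using tp tl that by blast+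
      have "inj_on t V"
      proof (rule inj_onI)
        fix x y assume xy: "x \<in> V" "y \<in> V" "t x = t y"
        then have cc: "c x = c y" using tV by metis
        show "x = y"
        proof (cases "c x")
          case True
          then have "F (\<iota> x) = F (\<iota> y)" using tp xy cc by metis
          then show ?thesis using inj_onD[OF bij_betw_imp_inj_on[OF F(1)]] True cc xy ioX inj_iff by metis
        next
          case False
          then have "G (line_of x) = G (line_of y)" using tl xy cc by metis
          then show ?thesis using inj_onD[OF bij_betw_imp_inj_on[OF G(1)]] False cc xy lnL line_of_inj by metis
        qed
      qed
      moreover have "y \<in> t ` V" if y: "y \<in> V" for y
      proof (cases "c y")
        case True
        then obtain a where a: "a \<in> ?X" "F a = \<iota> y" using F(1) ioX[OF y True] by (force simp: bij_betw_def)
        then have "\<iota> (t (j a)) = \<iota> y" using tp X by metis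
        then show ?thesis using inj_iff[of "t (j a)" y] tp X[OF a(1)] y True by force
      next
        case False
        then have "line_of y \<in> G ` ?L" using bij_betw_imp_surj_on[OF G(1)] lnL(1)[OF y] by simp
        then obtain L where L: "L \<in> ?L" "G L = line_of y" by (metis imageE)
        then have "L \<in> ?LN" using GLN[OF L(1)] y False by blast
        note kL = kL[OF this]
        have "line_of (t (k L)) = line_of y" using tl(3)[OF kL(1,2)] kL(3) L(2) by simp
        then have "t (k L) = y" using line_of_inj tl(1,2)[OF kL(1,2)] y False by blast
        then show ?thesis using kL(1) by blast
      qed
      ultimately have "bij_betw t V V" using tV by (auto simp: bij_betw_def)
      then have "t \<in> Bij V" by (simp add: Bij_def t_def)
      moreover have pl: "adj (t x) (t l) = adj x l" if "x \<in> V" "c x" "l \<in> V" "\<not> c l" for x l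
        using mem_line_of[OF that] mem_line_of[of "t x" "t l"] inc[of "\<iota> x" "line_of l"] tp tl that ioX lnL
        by simp
      then have "adj (t x) (t y) = adj x y" if "x \<in> V" "y \<in> V" for x y
        using that tV bipartite adj_sym by metis
      ultimately have tA: "t \<in> ?A" using tV by (auto simp: weight_auts_def)
      have "F a = f t a" for a
      proof (cases "a \<in> ?X")
        case True
        then show ?thesis using f_iota[of "j a" t] X[OF True] tp[of "j a"] by simp
      next
        case False
        then show ?thesis using F(2) by (auto simp: f_def extensional_def)
      qed
      then have "F = f t" by blast
      moreover have "G = (\<lambda>L\<in>?L. f t ` L)"
        using G(2) GF \<open>F = f t\<close> by (auto simp: fun_eq_iff extensional_def)
      ultimately show ?thesis using tA by (auto simp: \<phi>_def)
    qed
    ultimately show "bij_betw \<phi> (carrier (Aut_weighted V (inc_weight c adj))) (carrier (Aut_plane P))"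
      using coll by (force simp: bij_betw_def Aut_plane_def)
  qed
  then have "Aut_weighted V (inc_weight c adj) \<cong> Aut_plane P" by (auto simp: is_iso_def)
  then show ?thesis by (rule group.iso_sym[OF group_Aut_weighted])
qed

end

section \<open>Free completion\<close>

text \<open>A new element is named by the unordered pair that it joins, so the completion is a
  subset of one datatype and no limit of stages has to be formed. \<open>New\<close> records the
  colour, which can then be read without descending into the pair.\<close>

datatype 'e fel = Base 'e | New bool "'e fel fset"

primrec fcol :: "('e \<Rightarrow> bool) \<Rightarrow> 'e fel \<Rightarrow> bool" where
  "fcol c (Base e) = c e"
| "fcol c (New b S) = b"

primrec frank :: "'e fel \<Rightarrow> nat" where
  "frank (Base e) = 0"
| "frank (New b S) = Suc (Max (fset (frank |`| S)))"

text \<open>Adjacent base elements count as older than each other; apart from that, an element is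
  older than another only if it occurs in its name. Hence every incidence is recorded at one of its
  two ends.\<close>

primrec older :: "'e set \<Rightarrow> ('e \<Rightarrow> 'e \<Rightarrow> bool) \<Rightarrow> 'e fel \<Rightarrow> 'e fel set" where
  "older V adj (Base e) = Base ` {a \<in> V. adj a e}"
| "older V adj (New b S) = fset S"

definition finc :: "'e set \<Rightarrow> ('e \<Rightarrow> 'e \<Rightarrow> bool) \<Rightarrow> 'e fel \<Rightarrow> 'e fel \<Rightarrow> bool" where
  "finc V adj x y \<longleftrightarrow> x \<in> older V adj y \<or> y \<in> older V adj x"

text \<open>
  Two elements are joined by something else than the new element \<open>New b {|x, y|}\<close>. As \<open>z\<close> is
  then older than \<open>x\<close> or \<open>y\<close>, it need not be required to lie in the free completion; this keeps
  the following definition monotone.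
\<close>

definition prejoined :: "'e set \<Rightarrow> ('e \<Rightarrow> 'e \<Rightarrow> bool) \<Rightarrow> 'e fel \<Rightarrow> 'e fel \<Rightarrow> bool" where
  "prejoined V adj x y \<longleftrightarrow>
    (\<exists>z. finc V adj z x \<and> finc V adj z y \<and> (z \<in> older V adj x \<or> z \<in> older V adj y))"

inductive_set free :: "'e set \<Rightarrow> ('e \<Rightarrow> bool) \<Rightarrow> ('e \<Rightarrow> 'e \<Rightarrow> bool) \<Rightarrow> 'e fel set"
  for V c adj where
  base: "e \<in> V \<Longrightarrow> Base e \<in> free V c adj"
| new: "\<lbrakk>x \<in> free V c adj; y \<in> free V c adj; x \<noteq> y; fcol c x = fcol c y; \<not> prejoined V adj x y\<rbrakk>
    \<Longrightarrow> New (\<not> fcol c x) {|x, y|} \<in> free V c adj"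

definition confined :: "'e set \<Rightarrow> ('e \<Rightarrow> 'e \<Rightarrow> bool) \<Rightarrow> 'e set \<Rightarrow> bool" where
  "confined V adj C \<longleftrightarrow> finite C \<and> C \<subseteq> V \<and> (\<forall>x\<in>C. 3 \<le> card {y \<in> C. adj x y})"

lemma finc_sym: "finc V adj x y \<longleftrightarrow> finc V adj y x"
  by (auto simp: finc_def)

lemma prejoined_sym: "prejoined V adj x y \<longleftrightarrow> prejoined V adj y x"
  by (auto simp: prejoined_def)

lemma frank_less: "x |\<in>| S \<Longrightarrow> frank x < frank (New b S)"
  by (simp add: less_Suc_eq_le)

lemma set_fel_free: "x \<in> free V c adj \<Longrightarrow> set_fel x \<subseteq> V"
  by (induction rule: free.induct) auto

lemma confined_auts_image:
  assumes t: "t \<in> inc_auts V c adj" and C: "confined V adj C"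
  shows "confined V adj (t ` C)"
  unfolding confined_def
proof (intro conjI ballI)
  have CV: "C \<subseteq> V" "finite C" using C by (auto simp: confined_def)
  show "finite (t ` C)" "t ` C \<subseteq> V" using CV inc_autsD(1)[OF t] by auto
  fix x assume "x \<in> t ` C"
  then obtain y where y: "y \<in> C" "x = t y" by blast
  have "{z \<in> t ` C. adj x z} = t ` {z \<in> C. adj y z}" using inc_autsD(4)[OF t] CV y by auto
  moreover have "inj_on t {z \<in> C. adj y z}" using inc_autsD(2)[OF t] CV by (auto simp: inj_on_def)
  ultimately show "3 \<le> card {z \<in> t ` C. adj x z}" using C y by (simp add: card_image confined_def)
qed

section \<open>Linearity and confined configurations of the free completion\<close>

context incidence_graph
begin

abbreviation "F \<equiv> free V c adj"
abbreviation "fc \<equiv> fcol c"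
abbreviation "fi \<equiv> finc V adj"
abbreviation "old \<equiv> older V adj"
abbreviation "pj \<equiv> prejoined V adj"

lemma Base_free [simp]: "Base e \<in> F \<longleftrightarrow> e \<in> V"
  by (auto elim: free.cases intro: free.base)

lemma New_freeE:
  assumes "New b S \<in> F"
  obtains x y where "S = {|x, y|}" "x \<in> F" "y \<in> F" "x \<noteq> y" "fc x = (\<not> b)" "fc y = (\<not> b)" "\<not> pj x y"
  using assms by (cases rule: free.cases) auto

lemma older_free: "x \<in> F \<Longrightarrow> z \<in> old x \<Longrightarrow> z \<in> F"
  by (cases x) (auto elim: New_freeE)

lemma finc_Base [simp]: "a \<in> V \<Longrightarrow> e \<in> V \<Longrightarrow> fi (Base a) (Base e) \<longleftrightarrow> adj a e"
  using adj_sym by (auto simp: finc_def)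

lemma free_bipartite: "\<lbrakk>x \<in> F; y \<in> F; fi x y\<rbrakk> \<Longrightarrow> fc x \<noteq> fc y"
proof -
  have "fc x \<noteq> fc y" if "x \<in> F" "y \<in> old x" for x y
    using that bipartite by (cases x) (auto elim!: New_freeE)
  then show "\<lbrakk>x \<in> F; y \<in> F; fi x y\<rbrakk> \<Longrightarrow> fc x \<noteq> fc y" unfolding finc_def by metis
qed

text \<open>An incidence not recorded in \<open>S\<close> is recorded in the name of the neighbour,
  which then has the larger rank.\<close>

lemma top_neighbour:
  assumes "New b S \<in> F" "p \<in> F" "fi p (New b S)" "frank p \<le> frank (New b S)"
  shows "p |\<in>| S"
  using assms(3)
  unfolding finc_def
proof
  assume p: "New b S \<in> old p"
  then show ?thesis
  proof (cases p)
    case (New b' S')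
    then have "frank (New b S) < frank p" using p frank_less by fastforce
    then show ?thesis using assms(4) by simp
  qed auto
qed simp

text \<open>Take \<open>z\<close> of greatest rank in a hypothetical four-cycle. If \<open>z\<close>
  is new, its neighbours \<open>p\<close> and \<open>q\<close> are the pair it was formed from. The
  opposite element \<open>z'\<close> either joined \<open>p\<close> and \<open>q\<close> beforehand,
  which forbids forming \<open>z\<close>, or was formed from the same pair with the same colour and
  so has the same name.\<close>

lemma no_four_cycle_top:
  assumes F: "z \<in> F" "z' \<in> F" "p \<in> F" "q \<in> F" and ne: "z \<noteq> z'" "p \<noteq> q"
    and inc: "fi p z" "fi q z" "fi p z'" "fi q z'"
    and rank: "frank p \<le> frank z" "frank q \<le> frank z" "frank z' \<le> frank z"
  shows False
proof (cases z)
  case (Base e)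
  then have "frank p = 0" "frank q = 0" "frank z' = 0" using rank by auto
  then obtain a b e' where "p = Base a" "q = Base b" "z' = Base e'" by (cases p; cases q; cases z') auto
  then show False using F ne inc linear[of a b e e'] Base by auto
next
  case (New b S)
  have pq: "p |\<in>| S" "q |\<in>| S" using top_neighbour F inc rank New by blast+
  obtain x y where xy: "S = {|x, y|}" "fc x = (\<not> b)" "fc y = (\<not> b)" "\<not> pj x y"
    using F(1) New New_freeE by metis
  then have S: "S = {|p, q|}" and npj: "\<not> pj p q" using pq ne(2) prejoined_sym[of V adj x y] by auto
  \<comment> \<open>An element \<open>z'\<close> older than \<open>p\<close> or \<open>q\<close>
    would prejoin them.\<close>
  have nold: "z' \<notin> old p" "z' \<notin> old q" using npj inc finc_sym unfolding prejoined_def by metis+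
  then have old: "p \<in> old z'" "q \<in> old z'" using inc by (auto simp: finc_def)
  show False
  proof (cases z')
    case (Base e)
    then show False using old nold F(2) adj_sym by auto
  next
    case New': (New b' S')
    obtain x' y' where xy': "S' = {|x', y'|}" "fc x' = (\<not> b')"
      using F(2) New' New_freeE by metis
    have "fc p \<noteq> b" "fc p \<noteq> b'" using free_bipartite F inc New New' by fastforce+
    moreover have "S' = {|p, q|}" using old xy' ne(2) New' by auto
    ultimately show False using ne(1) New New' S by auto
  qed
qed

lemma free_linear:
  assumes F: "x \<in> F" "y \<in> F" "a \<in> F" "b \<in> F" and "x \<noteq> y" and inc: "fi x a" "fi y a" "fi x b" "fi y b"
  shows "a = b"
proof (rule ccontr)
  assume "a \<noteq> b"
  note inc' = inc inc[THEN finc_sym[THEN iffD1]]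
  \<comment> \<open>Any of the four corners may have the greatest rank; the cycle is turned
    accordingly.\<close>
  consider "frank y \<le> frank x" "frank a \<le> frank x" "frank b \<le> frank x"
    | "frank x \<le> frank y" "frank a \<le> frank y" "frank b \<le> frank y"
    | "frank x \<le> frank a" "frank y \<le> frank a" "frank b \<le> frank a"
    | "frank x \<le> frank b" "frank y \<le> frank b" "frank a \<le> frank b"
    by linarith
  then show False
    by cases (use no_four_cycle_top F inc' \<open>x \<noteq> y\<close> \<open>a \<noteq> b\<close> in metis)+
qed

lemma incidence_graph_free: "incidence_graph F fc fi"
proof
  show "fi x y \<Longrightarrow> fi y x" for x y using finc_sym by metis
  show "\<lbrakk>x \<in> F; y \<in> F; fi x y\<rbrakk> \<Longrightarrow> fc x \<noteq> fc y" for x y by (rule free_bipartite)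
qed (rule free_linear)

lemma free_joined:
  assumes "x \<in> F" "y \<in> F" "fc x = fc y" "x \<noteq> y"
  shows "\<exists>z\<in>F. fi x z \<and> fi y z"
proof (cases "pj x y")
  case True
  then show ?thesis using older_free assms finc_sym unfolding prejoined_def by metis
next
  case False
  then have "New (\<not> fc x) {|x, y|} \<in> F" using assms by (intro free.new) auto
  then show ?thesis by (rule bexI[rotated]) (simp add: finc_def)
qed

text \<open>An element of greatest rank in the configuration cannot be new: its neighbours there
  would be among the two elements that it was formed from, and three are required. So the greatest
  rank is 0.\<close>

lemma confined_free_subset:
  assumes "confined F fi C"
  shows "C \<subseteq> Base ` V"
proof
  fix x assume x: "x \<in> C"
  have C: "finite C" "C \<subseteq> F" "\<And>x. x \<in> C \<Longrightarrow> 3 \<le> card {y \<in> C. fi x y}"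
    using assms by (auto simp: confined_def)
  have "Max (frank ` C) \<in> frank ` C" using C(1) x by (intro Max_in) auto
  then obtain z where z0: "z \<in> C" "frank z = Max (frank ` C)" by (metis imageE)
  have z: "z \<in> C" "\<And>y. y \<in> C \<Longrightarrow> frank y \<le> frank z" using C(1) z0 by simp_all
  have "frank z = 0"
  proof (cases z)
    case (New b S)
    obtain p q where pq: "S = {|p, q|}" using z(1) C(2) New New_freeE by (metis subsetD)
    have "{y \<in> C. fi z y} \<subseteq> {p, q}"
      using top_neighbour[of b S] z C(2) New pq finc_sym by blast
    then have "card {y \<in> C. fi z y} \<le> card {p, q}" by (intro card_mono) auto
    also have "\<dots> \<le> 2" by (simp add: card_insert_if)
    finally show ?thesis using C(3)[OF z(1)] by simp
  qed simp
  then have "frank x = 0" using z(2)[OF x] by simp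
  then show "x \<in> Base ` V" using x C(2) by (cases x) auto
qed

section \<open>Automorphisms of the free completion\<close>

lemma map_fel_inverse:
  assumes "\<And>e. e \<in> V \<Longrightarrow> k (h e) = e" "x \<in> F"
  shows "map_fel k (map_fel h x) = x"
proof -
  have "map_fel (\<lambda>e. k (h e)) x = map_fel (\<lambda>e. e) x"
    by (rule fel.map_cong) (use set_fel_free[OF assms(2)] assms(1) in auto)
  then show ?thesis by (simp add: fel.map_comp o_def fel.map_ident)
qed

lemma map_fel_inj:
  assumes h: "h \<in> inc_auts V c adj" and "x \<in> F" "y \<in> F" "map_fel h x = map_fel h y"
  shows "x = y"
  using weight_auts_inverse[OF h] map_fel_inverse assms by metis

lemma older_map_fel:
  assumes h: "h \<in> inc_auts V c adj" and x: "x \<in> F"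
  shows "old (map_fel h x) = map_fel h ` old x"
proof (cases x)
  case (Base e)
  then have "e \<in> V" using x by simp
  then have "{a \<in> V. adj a (h e)} = h ` {a \<in> V. adj a e}"
    by (rule inc_auts_nbs[OF h])
  then have "Base ` {a \<in> V. adj a (h e)} = map_fel h ` Base ` {a \<in> V. adj a e}"
    by (simp add: image_image)
  then show ?thesis using Base by simp
qed simp

lemma finc_map_fel:
  assumes h: "h \<in> inc_auts V c adj" and x: "x \<in> F" "y \<in> F"
  shows "fi (map_fel h x) (map_fel h y) \<longleftrightarrow> fi x y"
proof -
  have "map_fel h x \<in> old (map_fel h y) \<longleftrightarrow> x \<in> old y" if "x \<in> F" "y \<in> F" for x y
    using map_fel_inj[OF h that(1)] older_free[OF that(2)] by (auto simp: older_map_fel[OF h that(2)])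
  then show ?thesis using x by (simp add: finc_def)
qed

lemma fcol_map_fel: "h \<in> inc_auts V c adj \<Longrightarrow> x \<in> F \<Longrightarrow> fc (map_fel h x) = fc x"
  using inc_autsD(3)[of h V c adj] by (cases x) simp_all

text \<open>This direction is what \<open>map_fel_free\<close> needs: a pair that is not prejoined
  stays so, and the element formed from it has an image.\<close>

lemma prejoined_map_fel:
  assumes h: "h \<in> inc_auts V c adj" and x: "x \<in> F" "y \<in> F" and pj: "pj (map_fel h x) (map_fel h y)"
  shows "pj x y"
proof -
  obtain z where z: "fi z (map_fel h x)" "fi z (map_fel h y)" "z \<in> map_fel h ` old x \<or> z \<in> map_fel h ` old y"
    using pj unfolding prejoined_def older_map_fel[OF h x(1)] older_map_fel[OF h x(2)] by blast
  then obtain u where u: "z = map_fel h u" "u \<in> old x \<or> u \<in> old y" by blast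
  then have "u \<in> F" using older_free x by blast
  have "fi u x" "fi u y" using z(1,2) finc_map_fel[OF h \<open>u \<in> F\<close>] x unfolding u(1) by simp_all
  then show ?thesis using u(2) unfolding prejoined_def by blast
qed

lemma map_fel_free:
  assumes h: "h \<in> inc_auts V c adj"
  shows "x \<in> F \<Longrightarrow> map_fel h x \<in> F"
proof (induction rule: free.induct)
  case (base e)
  then show ?case using inc_autsD(1)[OF h] by simp
next
  case (new x y)
  have "New (\<not> fc (map_fel h x)) {|map_fel h x, map_fel h y|} \<in> F"
    by (rule free.new) (use new fcol_map_fel[OF h] map_fel_inj[OF h] prejoined_map_fel[OF h] in auto)
  then show ?case using fcol_map_fel[OF h] new by simp
qed

text \<open>Confinement is invariant, so an automorphism and its inverse keep the base elements
  among themselves. From there the automorphism is forced, since a new element is the only common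
  neighbour of its pair.\<close>

lemma free_auts_map:
  assumes conf: "\<And>e. e \<in> V \<Longrightarrow> \<exists>C. confined V adj C \<and> e \<in> C"
    and t: "t \<in> inc_auts F fc fi"
  shows "\<exists>h\<in>inc_auts V c adj. \<forall>x\<in>F. t x = map_fel h x"
proof -
  have base: "t (Base e) \<in> Base ` V" if t: "t \<in> inc_auts F fc fi" and e: "e \<in> V" for t e
  proof -
    obtain C where C: "confined V adj C" "e \<in> C" using conf[OF e] by blast
    have "confined F fi (Base ` C)"
      unfolding confined_def
    proof (intro conjI ballI)
      show "finite (Base ` C)" "Base ` C \<subseteq> F" using C by (auto simp: confined_def)
      fix x assume "x \<in> Base ` C"
      then obtain a where a: "x = Base a" "a \<in> C" by blast
      have "fi (Base a) (Base y) \<longleftrightarrow> adj a y" if "y \<in> C" for y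
        using C a that by (intro finc_Base) (auto simp: confined_def)
      then have "{y \<in> Base ` C. fi x y} = Base ` {y \<in> C. adj a y}" unfolding a by blast
      moreover have "3 \<le> card {y \<in> C. adj a y}" using C a by (auto simp: confined_def)
      ultimately show "3 \<le> card {y \<in> Base ` C. fi x y}" by (simp add: card_image inj_on_def)
    qed
    then show ?thesis using confined_free_subset[OF confined_auts_image[OF t]] C(2) by blast
  qed
  define h where "h = (\<lambda>e\<in>V. inv_into UNIV Base (t (Base e)))"
  have hb: "h e \<in> V" "t (Base e) = Base (h e)" if e: "e \<in> V" for e
  proof -
    obtain a where "a \<in> V" "t (Base e) = Base a" using base[OF t e] by blast
    then show "h e \<in> V" "t (Base e) = Base (h e)" using e by (simp_all add: h_def inv_f_f inj_def)
  qed
  obtain s where s: "s \<in> inc_auts F fc fi" "\<And>x. x \<in> F \<Longrightarrow> t (s x) = x"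
    using weight_auts_inverse[OF t] by blast
  have "\<exists>a\<in>V. h a = e" if e: "e \<in> V" for e
  proof -
    obtain a where a: "a \<in> V" "s (Base e) = Base a" using base[OF s(1) e] by blast
    then have "Base (h a) = Base e" using s(2)[of "Base e"] hb[OF a(1)] e by simp
    then show ?thesis using a(1) by blast
  qed
  moreover have "inj_on h V"
  proof (rule inj_onI)
    fix x y assume "x \<in> V" "y \<in> V" "h x = h y"
    then show "x = y" using hb(2) inc_autsD(2)[OF t, of "Base x" "Base y"] by simp
  qed
  ultimately have "h \<in> Bij V" using hb(1) by (auto simp: Bij_def bij_betw_def h_def)
  moreover have "c (h x) = c x \<and> adj (h x) (h y) = adj x y" if "x \<in> V" "y \<in> V" for x y
    using inc_autsD(3,4)[OF t, of "Base x"] inc_autsD(4)[OF t, of "Base x" "Base y"] that hb by simp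
  ultimately have h: "h \<in> inc_auts V c adj" by (auto simp: weight_auts_def)
  have "t x = map_fel h x" if "x \<in> F" for x
    using that
  proof (induction rule: free.induct)
    case (base e)
    then show ?case using hb by simp
  next
    case (new x y)
    let ?z = "New (\<not> fc x) {|x, y|}"
    have z: "?z \<in> F" using new by (intro free.new) auto
    have i: "fi x ?z" "fi y ?z" by (auto simp: finc_def)
    \<comment> \<open>Both elements are common neighbours of \<open>t x\<close> and
      \<open>t y\<close>, so linearity identifies them.\<close>
    show ?case
    proof (rule free_linear)
      show "t x \<in> F" "t y \<in> F" "t ?z \<in> F" "map_fel h ?z \<in> F"
        using inc_autsD(1)[OF t] new z map_fel_free[OF h] by blast+
      show "t x \<noteq> t y" using inc_autsD(2)[OF t] new by blast
      show "fi (t x) (t ?z)" "fi (t y) (t ?z)" using inc_autsD(4)[OF t] new z i by blast+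
      show "fi (t x) (map_fel h ?z)" "fi (t y) (map_fel h ?z)"
        unfolding new.IH using finc_map_fel[OF h] new z i by blast+
    qed
  qed
  then show ?thesis using h by blast
qed

lemma Aut_free_iso:
  assumes conf: "\<And>e. e \<in> V \<Longrightarrow> \<exists>C. confined V adj C \<and> e \<in> C"
  shows "Aut_weighted F (inc_weight fc fi) \<cong> Aut_weighted V (inc_weight c adj)"
  unfolding Aut_weighted_def[of V]
proof (rule functor_iso[where e = Base and m = map_fel])
  show "inj_on Base V" by (simp add: inj_on_def)
  show "map_fel h x = map_fel k x" if "x \<in> F" "\<And>a. a \<in> V \<Longrightarrow> h a = k a" for x h k
    by (rule fel.map_cong) (use that set_fel_free[OF that(1)] in auto)
  show "inc_auts V c adj \<subseteq> Bij V" by (auto simp: weight_auts_def)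
  show "group (BijGroup V \<lparr>carrier := inc_auts V c adj\<rparr>)"
    using group_Aut_weighted unfolding Aut_weighted_def .
  show "\<exists>h. (\<forall>a\<in>V. h a \<in> V) \<and> (\<forall>x\<in>F. t x = map_fel h x)" if t: "t \<in> inc_auts F fc fi" for t
  proof -
    obtain h where "h \<in> inc_auts V c adj" "\<forall>x\<in>F. t x = map_fel h x" using free_auts_map[OF conf t] by blast
    then show ?thesis using inc_autsD(1)[of h V c adj] by blast
  qed
  show "h \<in> inc_auts V c adj"
    if t: "t \<in> inc_auts F fc fi" and h: "h \<in> Bij V" "\<And>x. x \<in> F \<Longrightarrow> t x = map_fel h x" for t h
  proof -
    obtain k where k: "k \<in> inc_auts V c adj" "\<forall>x\<in>F. t x = map_fel k x" using free_auts_map[OF conf t] by blast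
    have "h e = k e" if "e \<in> V" for e using h(2)[of "Base e"] k(2) that by simp
    then have "h = k" using h(1) weight_autsD(1)[OF k(1)] by (auto simp: Bij_def intro: extensionalityI)
    then show ?thesis using k by simp
  qed
qed (simp_all add: fel.map_ident fel.map_comp o_def map_fel_free finc_map_fel fcol_map_fel)

end

text \<open>Two triangles \<open>a\<close> and \<open>b\<close> in perspective from
  \<open>s\<close>. By \<open>not_joined\<close> their sides are missing from \<open>V\<close>, so
  the completion generates the sides and then the intersections of corresponding sides
  freely.\<close>

locale desargues_graph = incidence_graph V c adj for V :: "'e set" and c adj +
  fixes s :: 'e and a b l :: "nat \<Rightarrow> 'e"
  assumes conf: "\<And>e. e \<in> V \<Longrightarrow> \<exists>C. confined V adj C \<and> e \<in> C"
    and in_V: "s \<in> V" "\<And>i. i < 3 \<Longrightarrow> a i \<in> V \<and> b i \<in> V \<and> l i \<in> V"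
    and col: "c s" "\<And>i. i < 3 \<Longrightarrow> c (a i) \<and> c (b i)"
    and dist: "\<And>i j. \<lbrakk>i < 3; j < 3; i \<noteq> j\<rbrakk> \<Longrightarrow> a i \<noteq> a j \<and> b i \<noteq> b j" "\<And>i j. \<lbrakk>i < 3; j < 3\<rbrakk> \<Longrightarrow> a i \<noteq> b j"
    and on_line: "\<And>i. i < 3 \<Longrightarrow> adj s (l i) \<and> adj (a i) (l i) \<and> adj (b i) (l i)"
    and not_joined: "\<And>i j. \<lbrakk>i < 3; j < 3; i \<noteq> j\<rbrakk> \<Longrightarrow>
      \<not> (\<exists>m\<in>V. adj (a i) m \<and> adj (a j) m) \<and> \<not> (\<exists>m\<in>V. adj (b i) m \<and> adj (b j) m)"
begin

definition pair_line :: "(nat \<Rightarrow> 'e) \<Rightarrow> nat \<Rightarrow> nat \<Rightarrow> 'e fel" where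
  "pair_line d i j = New False {|Base (d i), Base (d j)|}"

definition pair_meet :: "nat \<Rightarrow> nat \<Rightarrow> 'e fel" where
  "pair_meet i j = New True {|pair_line a i j, pair_line b i j|}"

lemma pair_line_free:
  assumes "i < 3" "j < 3" "i \<noteq> j" "d = a \<or> d = b"
  shows "pair_line d i j \<in> F"
proof -
  have d: "d i \<in> V" "d j \<in> V" "c (d i)" "c (d j)" "d i \<noteq> d j" "\<not> (\<exists>m\<in>V. adj (d i) m \<and> adj (d j) m)"
    using assms in_V col dist not_joined by blast+
  have "\<not> pj (Base (d i)) (Base (d j))"
    using d adj_sym by (auto simp: prejoined_def finc_def)
  then have "New (\<not> fc (Base (d i))) {|Base (d i), Base (d j)|} \<in> F"
    using d by (intro free.new) auto
  then show ?thesis using d by (simp add: pair_line_def)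
qed

lemma pair_line_inject:
  assumes "i < 3" "j < 3" "i' < 3" "j' < 3" "d = a \<or> d = b" "pair_line d i j = pair_line d i' j'"
  shows "{i, j} = {i', j'}"
proof -
  have "{d i, d j} = {d i', d j'}" using assms(6) by (simp add: pair_line_def fset_eq_iff doubleton_eq_iff) (metis fel.inject(1))
  moreover have "d p = d q \<longleftrightarrow> p = q" if "p < 3" "q < 3" for p q using dist(1)[of p q] that assms(5) by blast
  ultimately show ?thesis using assms(1-4) by (auto simp: doubleton_eq_iff)
qed

lemma pair_line_neq: "\<lbrakk>i < 3; j < 3; i' < 3; j' < 3\<rbrakk> \<Longrightarrow> pair_line a i j \<noteq> pair_line b i' j'"
  using dist(2)[of i i'] dist(2)[of i j'] by (auto simp: pair_line_def fset_eq_iff)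

text \<open>Corresponding sides could only be prejoined by a common vertex, and the triangles share
  none.\<close>

lemma pair_meet_free:
  assumes "i < 3" "j < 3" "i \<noteq> j"
  shows "pair_meet i j \<in> F"
proof -
  have "\<not> pj (pair_line a i j) (pair_line b i j)"
    using assms dist(2)[of i i] dist(2)[of i j] dist(2)[of j i] dist(2)[of j j]
    by (auto simp: prejoined_def finc_def pair_line_def)
  then have "New (\<not> fc (pair_line a i j)) {|pair_line a i j, pair_line b i j|} \<in> F"
    using assms pair_line_free pair_line_neq[of i j i j] by (intro free.new) (auto simp: pair_line_def)
  then show ?thesis by (simp add: pair_meet_def pair_line_def)
qed

text \<open>A new element is formed from a pair, so the three intersections are not all in its name.
  One incidence is then recorded in the name of an intersection, which makes \<open>m\<close> a side
  of a triangle. The name of a side consists of vertices, so the other incidences are of this kind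
  too, and \<open>m\<close> would be a side for the index pairs 0, 1 and 0, 2 at once.\<close>

lemma pair_meets_not_collinear:
  assumes m: "m \<in> F" and inc: "fi (pair_meet 0 1) m" "fi (pair_meet 0 2) m" "fi (pair_meet 1 2) m"
  shows False
proof -
  have X: "pair_meet 0 1 \<noteq> pair_meet 0 2" "pair_meet 0 1 \<noteq> pair_meet 1 2" "pair_meet 0 2 \<noteq> pair_meet 1 2"
  proof -
    have eq: "{i, j} = {i', j'}"
      if "pair_meet i j = pair_meet i' j'" "i < 3" "j < 3" "i' < 3" "j' < 3" for i j i' j'
    proof -
      have "pair_line a i j = pair_line a i' j'"
        using that pair_line_neq[of i j i' j'] by (auto simp: pair_meet_def fset_eq_iff)
      then show ?thesis using pair_line_inject[of i j i' j' a] that by blast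
    qed
    show "pair_meet 0 1 \<noteq> pair_meet 0 2" using eq[of 0 1 0 2] by (auto simp: doubleton_eq_iff)
    show "pair_meet 0 1 \<noteq> pair_meet 1 2" using eq[of 0 1 1 2] by (auto simp: doubleton_eq_iff)
    show "pair_meet 0 2 \<noteq> pair_meet 1 2" using eq[of 0 2 1 2] by (auto simp: doubleton_eq_iff)
  qed
  show False
  proof (cases m)
    case (Base e)
    then show False using inc(1) by (auto simp: finc_def pair_meet_def pair_line_def)
  next
    case (New d S)
    obtain u v where uv: "S = {|u, v|}" using m New New_freeE by metis
    have alt: "m = pair_line a i j \<or> m = pair_line b i j \<or> pair_meet i j |\<in>| S" if "fi (pair_meet i j) m" for i j
      using that New by (auto simp: finc_def pair_meet_def)
    have pl: "pair_meet i j |\<notin>| S" if "m = pair_line a i' j' \<or> m = pair_line b i' j'" for i j i' j'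
      using that New by (auto simp: pair_line_def pair_meet_def)
    have "\<not> (pair_meet 0 1 |\<in>| S \<and> pair_meet 0 2 |\<in>| S \<and> pair_meet 1 2 |\<in>| S)"
      using X uv by auto
    then obtain i j where "m = pair_line a i j \<or> m = pair_line b i j"
      using alt[OF inc(1)] alt[OF inc(2)] alt[OF inc(3)] by blast
    then have m: "m = pair_line a 0 1 \<or> m = pair_line b 0 1" "m = pair_line a 0 2 \<or> m = pair_line b 0 2"
      using alt[OF inc(1)] alt[OF inc(2)] pl by blast+
    have "pair_line d 0 1 \<noteq> pair_line d 0 2" if "d = a \<or> d = b" for d
      using pair_line_inject[of 0 1 0 2 d] that by (auto simp: doubleton_eq_iff)
    moreover have "pair_line a 0 1 \<noteq> pair_line b 0 2" "pair_line a 0 2 \<noteq> pair_line b 0 1"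
      by (rule pair_line_neq; simp)+
    ultimately show False using m by metis
  qed
qed

theorem projective_completion:
  fixes \<iota> :: "'e fel \<Rightarrow> 'p"
  assumes inj: "inj_on \<iota> {x \<in> F. fc x}"
  shows "projective_plane (plane_of \<iota> F fc fi)"
    and "\<not> desarguesian (plane_of \<iota> F fc fi)"
    and "Aut_plane (plane_of \<iota> F fc fi) \<cong> Aut_weighted V (inc_weight c adj)"
proof -
  have nc: "\<not> (\<exists>m\<in>F. fi (Base (d 0)) m \<and> fi (Base (d 1)) m \<and> fi (Base (d 2)) m)" if d: "d = a" for d
  proof
    assume "\<exists>m\<in>F. fi (Base (d 0)) m \<and> fi (Base (d 1)) m \<and> fi (Base (d 2)) m"
    then obtain m where m: "m \<in> F" "fi (Base (d 0)) m" "fi (Base (d 1)) m" "fi (Base (d 2)) m" by blast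
    show False
    proof (cases m)
      case (Base e)
      then show False using m not_joined[of 0 1] in_V(2)[of 0] in_V(2)[of 1] d by auto
    next
      case (New b' S)
      obtain u v where uv: "S = {|u, v|}" using m New New_freeE by metis
      have "Base (d i) |\<in>| S" if "fi (Base (d i)) m" for i using that New by (auto simp: finc_def)
      then have "Base (d 0) |\<in>| S" "Base (d 1) |\<in>| S" "Base (d 2) |\<in>| S" using m by blast+
      then show False using uv dist(1)[of 0 1] dist(1)[of 0 2] dist(1)[of 1 2] d by auto
    qed
  qed
  interpret P: plane_graph F fc fi \<iota>
  proof (intro plane_graph.intro plane_graph_axioms.intro)
    show "incidence_graph F fc fi" by (rule incidence_graph_free)
    show "inj_on \<iota> {x \<in> F. fc x}" by fact
    show "\<exists>x\<in>F. \<exists>y\<in>F. x \<noteq> y \<and> fi x l \<and> fi y l" if l: "l \<in> F" for l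
    proof (cases l)
      case (Base e)
      then obtain C where C: "confined V adj C" "e \<in> C" using conf l by auto
      then have "\<not> card {y \<in> C. adj e y} \<le> Suc 0" by (auto simp: confined_def)
      then obtain x y where xy: "x \<in> C" "y \<in> C" "adj e x" "adj e y" "x \<noteq> y"
        using card_le_Suc0_iff_eq[of "{y \<in> C. adj e y}"] C by (auto simp: confined_def)
      then have "x \<in> V" "y \<in> V" using C by (auto simp: confined_def)
      then show ?thesis using xy Base l adj_sym
        by (intro bexI[of _ "Base x"] bexI[of _ "Base y"]) auto
    next
      case (New b S)
      then obtain x y where xy: "S = {|x, y|}" "x \<in> F" "y \<in> F" "x \<noteq> y" using l New_freeE by metis
      then show ?thesis using New by (intro bexI[of _ x] bexI[of _ y]) (auto simp: finc_def)
    qed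
    show "\<exists>x\<in>F. \<exists>y\<in>F. \<exists>z\<in>F. fc x \<and> fc y \<and> fc z \<and> x \<noteq> y \<and> x \<noteq> z \<and> y \<noteq> z \<and>
      \<not> (\<exists>l\<in>F. fi x l \<and> fi y l \<and> fi z l)"
      using nc[OF refl] in_V(2)[of 0] in_V(2)[of 1] in_V(2)[of 2] col(2)[of 0] col(2)[of 1] col(2)[of 2]
        dist(1)[of 0 1] dist(1)[of 0 2] dist(1)[of 1 2]
      by (intro bexI[of _ "Base (a 0)"] bexI[of _ "Base (a 1)"] bexI[of _ "Base (a 2)"]) simp_all
  qed
  show "projective_plane P.P" by (rule P.projective_P) (rule free_joined)
  then interpret PP: projective_plane P.P .
  have no_unjoined: "\<not> P.unjoined x y" for x y using free_joined by (auto simp: P.unjoined_def)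
  have "Aut_plane P.P \<cong> Aut_weighted F (inc_weight fc fi)"
    by (rule P.Aut_plane_iso) (use no_unjoined in blast)
  then show "Aut_plane P.P \<cong> Aut_weighted V (inc_weight c adj)"
    using Aut_free_iso[OF conf] by (rule iso_trans)
  let ?p = "\<lambda>i. \<iota> (Base (a i))" and ?q = "\<lambda>i. \<iota> (Base (b i))"
  have pts: "?p i \<in> points P.P" "?q i \<in> points P.P" if "i < 3" for i
    using in_V(2)[OF that] col(2)[OF that] by (auto simp: P.points_P)
  have ne: "?p i \<noteq> ?p j" "?q i \<noteq> ?q j" if "i < 3" "j < 3" "i \<noteq> j" for i j
    using P.inj_iff in_V(2) col(2) dist(1) that by (simp_all add: P.inj_iff)
  have ne': "?p i \<noteq> ?q i" if "i < 3" for i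
    using P.inj_iff in_V(2) col(2) dist(2) that by (simp add: P.inj_iff)
  have line: "pair_line d i j \<in> F" "\<not> fc (pair_line d i j)"
    "d = a \<or> d = b \<Longrightarrow> fi (Base (d i)) (pair_line d i j) \<and> fi (Base (d j)) (pair_line d i j)"
    if "i < 3" "j < 3" "i \<noteq> j" "d = a \<or> d = b" for i j d
    using pair_line_free[OF that] by (auto simp: pair_line_def finc_def)
  have jp: "join P.P (?p i) (?p j) = P.line_of (pair_line a i j)"
    and jq: "join P.P (?q i) (?q j) = P.line_of (pair_line b i j)" if "i < 3" "j < 3" "i \<noteq> j" for i j
    by (rule P.join_eq; use that in_V(2) col(2) dist(1) line in simp)+
  have jl: "join P.P (?p i) (?q i) = P.line_of (Base (l i))" if "i < 3" for i
    by (rule P.join_eq; use that in_V(2) col(2) dist(2) on_line in simp)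
  have ml: "meet (P.line_of (pair_line a i j)) (P.line_of (pair_line b i j)) = \<iota> (pair_meet i j)"
    if "i < 3" "j < 3" "i \<noteq> j" for i j
    by (rule P.meet_eq; use that line pair_meet_free pair_line_neq in \<open>simp add: pair_meet_def finc_def\<close>)
  have ln: "P.line_of (pair_line a i j) \<noteq> P.line_of (pair_line b i j)" if "i < 3" "j < 3" "i \<noteq> j" for i j
    using that pair_line_free pair_line_neq[of i j i j] P.line_of_inj[of "pair_line a i j" "pair_line b i j"]
    by (auto simp: pair_line_def)
  have cent: "\<iota> (Base s) \<in> P.line_of (Base (l i))" if "i < 3" for i
    using that in_V on_line by (auto simp: P.line_of_def)
  have "\<not> collinear P.P (\<iota> (pair_meet 0 1)) (\<iota> (pair_meet 0 2)) (\<iota> (pair_meet 1 2))"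
  proof
    assume "collinear P.P (\<iota> (pair_meet 0 1)) (\<iota> (pair_meet 0 2)) (\<iota> (pair_meet 1 2))"
    then obtain L where L: "L \<in> lines P.P" "\<iota> (pair_meet 0 1) \<in> L" "\<iota> (pair_meet 0 2) \<in> L" "\<iota> (pair_meet 1 2) \<in> L"
      by (auto simp: collinear_def)
    obtain m where m: "m \<in> F" "\<not> fc m" "L = P.line_of m" using L(1) P.lineE no_unjoined by metis
    have "fi (pair_meet i j) m" if "\<iota> (pair_meet i j) \<in> L" "i < 3" "j < 3" "i \<noteq> j" for i j
      using that m P.mem_line_of[of "pair_meet i j" m] pair_meet_free by (auto simp: pair_meet_def)
    then show False using pair_meets_not_collinear[OF m(1)] L by simp
  qed
  moreover have "\<iota> (Base s) \<in> points P.P" using in_V col by (auto simp: P.points_P)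
  ultimately show "\<not> desarguesian P.P"
    unfolding desarguesian_def
    \<comment> \<open>The six vertices are supplied one at a time, with \<open>s\<close> as centre;
      the joins and intersections that then occur were computed above.\<close>
    apply (simp only: not_all not_imp Ball_def)
    apply (rule exI[of _ "?p 0"], intro conjI pts, simp)
    apply (rule exI[of _ "?p 1"], intro conjI pts, simp)
    apply (rule exI[of _ "?p 2"], intro conjI pts, simp)
    apply (rule exI[of _ "?q 0"], intro conjI pts, simp)
    apply (rule exI[of _ "?q 1"], intro conjI pts, simp)
    apply (rule exI[of _ "?q 2"], intro conjI pts, simp)
    using cent ne ne' ln ml jp jq jl by (auto intro!: bexI[of _ "\<iota> (Base s)"])
qed

end

section \<open>Attaching Fano planes to the points\<close>

text \<open>Linearity need only be checked for two points on two lines: when \<open>x\<close> and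
  \<open>y\<close> are lines, the same four-cycle is read with the pairs exchanged.\<close>

lemma incidence_graphI:
  assumes col: "\<And>x y. \<lbrakk>x \<in> V; y \<in> V; I x y\<rbrakk> \<Longrightarrow> c x \<and> \<not> c y"
    and lin: "\<And>x y a b. \<lbrakk>x \<in> V; y \<in> V; a \<in> V; b \<in> V; x \<noteq> y; I x a; I y a; I x b; I y b\<rbrakk> \<Longrightarrow> a = b"
  shows "incidence_graph V c (\<lambda>x y. I x y \<or> I y x)"
proof
  show "c x \<noteq> c y" if "x \<in> V" "y \<in> V" "I x y \<or> I y x" for x y
    using col[of x y] col[of y x] that by blast
  fix x y a b
  assume V: "x \<in> V" "y \<in> V" "a \<in> V" "b \<in> V" and xy: "x \<noteq> y"
    and adj: "I x a \<or> I a x" "I y a \<or> I a y" "I x b \<or> I b x" "I y b \<or> I b y"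
  show "a = b"
  proof (cases "c x")
    case True
    then have "I x a" "I x b" using adj col V by blast+
    then have "I y a" "I y b" using adj col V by blast+
    then show ?thesis using lin V xy \<open>I x a\<close> \<open>I x b\<close> by blast
  next
    case False
    then have "I a x" "I b x" using adj col V by blast+
    then have "I a y" "I b y" using adj col V by blast+
    then show ?thesis using lin[of a b x y] V xy \<open>I a x\<close> \<open>I b x\<close> by blast
  qed
qed blast

lemma card_ge3I: "\<lbrakk>finite S; x \<in> S; y \<in> S; z \<in> S; x \<noteq> y; x \<noteq> z; y \<noteq> z\<rbrakk> \<Longrightarrow> 3 \<le> card S"
  using card_mono[of S "{x, y, z}"] by (simp add: card_insert_if)

lemma card_ge4I:
  "\<lbrakk>finite S; x \<in> S; y \<in> S; z \<in> S; u \<in> S; x \<noteq> y; x \<noteq> z; y \<noteq> z; u \<noteq> x; u \<noteq> y; u \<noteq> z\<rbrakk> \<Longrightarrow> 4 \<le> card S"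
  using card_mono[of S "{u, x, y, z}"] by (simp add: card_insert_if)

lemma confined_Un:
  assumes "confined V adj C" "confined V adj D"
  shows "confined V adj (C \<union> D)"
  unfolding confined_def
proof (intro conjI ballI)
  show "finite (C \<union> D)" "C \<union> D \<subseteq> V" using assms by (auto simp: confined_def)
  fix x assume "x \<in> C \<union> D"
  then obtain E where E: "E \<subseteq> C \<union> D" "3 \<le> card {y \<in> E. adj x y}"
    using assms unfolding confined_def by blast
  have "card {y \<in> E. adj x y} \<le> card {y \<in> C \<union> D. adj x y}"
    by (rule card_mono) (use E assms in \<open>auto simp: confined_def\<close>)
  then show "3 \<le> card {y \<in> C \<union> D. adj x y}" using E by simp
qed

lemma confined_insert:
  assumes C: "confined V adj C" and e: "e \<in> V"
    and xyz: "x \<in> C" "y \<in> C" "z \<in> C" "x \<noteq> y" "x \<noteq> z" "y \<noteq> z" "adj e x" "adj e y" "adj e z"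
  shows "confined V adj (insert e C)"
  unfolding confined_def
proof (intro conjI ballI)
  have fin: "finite {y \<in> insert e C. adj u y}" for u using C by (simp add: confined_def)
  show "finite (insert e C)" "insert e C \<subseteq> V" using C e by (auto simp: confined_def)
  fix u assume "u \<in> insert e C"
  then consider "u = e" | "u \<in> C" by blast
  then show "3 \<le> card {y \<in> insert e C. adj u y}"
  proof cases
    case 1
    then show ?thesis by (intro card_ge3I[of _ x y z] fin) (use xyz in auto)
  next
    case 2
    have "card {y \<in> C. adj u y} \<le> card {y \<in> insert e C. adj u y}"
      by (rule card_mono[OF fin]) auto
    then show ?thesis using C 2 by (fastforce simp: confined_def)
  qed
qed

text \<open>Without \<open>VL\<close>, the Fano plane at \<open>p\<close> would have non-trivial
  collineations fixing \<open>Old p\<close> and \<open>Sp\<close>, and these would extend by the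
  identity to the whole graph. The line marks one further point of each plane.\<close>

datatype 'e pel = Old 'e | FP 'e nat | FL 'e nat | Sp | VL

primrec pcol :: "('e \<Rightarrow> bool) \<Rightarrow> 'e pel \<Rightarrow> bool" where
  "pcol c (Old e) = c e"
| "pcol c (FP p i) = True"
| "pcol c (FL p j) = False"
| "pcol c Sp = True"
| "pcol c VL = False"

text \<open>
  The Fano plane, from the perfect difference set \<open>{0, 1, 3}\<close> modulo \<open>7\<close>.
\<close>

definition fano :: "nat \<Rightarrow> nat \<Rightarrow> bool" where
  "fano i j \<longleftrightarrow> i = j \<or> i = (j + 1) mod 7 \<or> i = (j + 3) mod 7"

lemma less_7: "(i::nat) < 7 \<longleftrightarrow> i = 0 \<or> i = 1 \<or> i = 2 \<or> i = 3 \<or> i = 4 \<or> i = 5 \<or> i = 6"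
  by auto

lemma fano_linear:
  assumes "j < 7" "k < 7" "i \<noteq> i'" "fano i j" "fano i' j" "fano i k" "fano i' k"
  shows "j = k"
proof (rule ccontr)
  assume "j \<noteq> k"
  let ?l = "\<lambda>j::nat. {j, (j + 1) mod 7, (j + 3) mod 7}"
  have "\<forall>j\<in>{..<7}. \<forall>k\<in>{..<7}. j \<noteq> k \<longrightarrow> card (?l j \<inter> ?l k) \<le> Suc 0"
    by code_simp
  then have *: "card (?l j \<inter> ?l k) \<le> Suc 0" using assms \<open>j \<noteq> k\<close> by blast
  have "i = i'" using card_le_Suc0_iff_eq[of "?l j \<inter> ?l k"] * assms(4-7) unfolding fano_def by blast
  then show False using assms by blast
qed

text \<open>A line has three points, so only one is left beside two given ones.\<close>

lemma fano_line_cases: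
  assumes "fano i j" "fano i' j" "fano k j" "fano k' j" "i \<noteq> i'" "k \<noteq> i" "k \<noteq> i'" "k' \<noteq> i" "k' \<noteq> i'"
  shows "k = k'"
  using assms unfolding fano_def by blast

text \<open>
  The Fano plane at \<open>p\<close> contains the non-collinear points \<open>p\<close> (number \<open>0\<close>), a point of the
  line \<open>VL\<close> (number \<open>1\<close>) and the point \<open>Sp\<close> common to all these Fano planes (number \<open>2\<close>). Fixing
  these makes it rigid.
\<close>

definition pt :: "'e \<Rightarrow> nat \<Rightarrow> 'e pel" where
  "pt p i = (if i = 0 then Old p else if i = 2 then Sp else FP p i)"

definition plies :: "('e \<Rightarrow> bool) \<Rightarrow> ('e \<Rightarrow> 'e \<Rightarrow> bool) \<Rightarrow> 'e pel \<Rightarrow> 'e pel \<Rightarrow> bool" where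
  "plies c adj x y = (case y of
      Old l \<Rightarrow> \<exists>p. x = Old p \<and> c p \<and> adj p l
    | FL p j \<Rightarrow> \<exists>i<7. x = pt p i \<and> fano i j
    | VL \<Rightarrow> \<exists>p. x = FP p 1
    | _ \<Rightarrow> False)"

definition pcar :: "'e set \<Rightarrow> ('e \<Rightarrow> bool) \<Rightarrow> 'e pel set" where
  "pcar V c = Old ` V \<union> {pt p i | p i. p \<in> V \<and> c p \<and> i < 7} \<union> {FL p j | p j. p \<in> V \<and> c p \<and> j < 7} \<union> {Sp, VL}"

definition padj :: "('e \<Rightarrow> bool) \<Rightarrow> ('e \<Rightarrow> 'e \<Rightarrow> bool) \<Rightarrow> 'e pel \<Rightarrow> 'e pel \<Rightarrow> bool" where
  "padj c adj x y \<longleftrightarrow> plies c adj x y \<or> plies c adj y x"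

lemma pt_eq: "pt p i = pt q k \<longleftrightarrow> i = k \<and> (i = 2 \<or> p = q)"
  by (auto simp: pt_def)

lemma pt_eq_simps [simp]:
  "pt p i = Old q \<longleftrightarrow> i = 0 \<and> p = q" "Old q = pt p i \<longleftrightarrow> i = 0 \<and> p = q"
  "pt p i = FP q k \<longleftrightarrow> i = k \<and> p = q \<and> k \<noteq> 0 \<and> k \<noteq> 2" "FP q k = pt p i \<longleftrightarrow> i = k \<and> p = q \<and> k \<noteq> 0 \<and> k \<noteq> 2"
  "pt p i = Sp \<longleftrightarrow> i = 2" "Sp = pt p i \<longleftrightarrow> i = 2"
  "pt p i \<noteq> FL q j" "FL q j \<noteq> pt p i" "pt p i \<noteq> VL" "VL \<noteq> pt p i"
  by (auto simp: pt_def)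

lemma plies_simps [simp]:
  "plies c adj x (Old l) \<longleftrightarrow> (\<exists>p. x = Old p \<and> c p \<and> adj p l)"
  "plies c adj x (FL p j) \<longleftrightarrow> (\<exists>i<7. x = pt p i \<and> fano i j)"
  "plies c adj x VL \<longleftrightarrow> (\<exists>p. x = FP p 1)"
  "\<not> plies c adj x (FP p i)" "\<not> plies c adj x Sp"
  by (simp_all add: plies_def)

lemma pcar_simps [simp]:
  "Old e \<in> pcar V c \<longleftrightarrow> e \<in> V"
  "FP p i \<in> pcar V c \<longleftrightarrow> p \<in> V \<and> c p \<and> i < 7 \<and> i \<noteq> 0 \<and> i \<noteq> 2"
  "FL p j \<in> pcar V c \<longleftrightarrow> p \<in> V \<and> c p \<and> j < 7"
  "Sp \<in> pcar V c" "VL \<in> pcar V c"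
  by (auto simp: pcar_def)

lemma pt_pcar [simp]: "\<lbrakk>p \<in> V; c p; i < 7\<rbrakk> \<Longrightarrow> pt p i \<in> pcar V c"
  by (auto simp: pcar_def)

lemma padj_FL [simp]:
  "padj c adj x (FL p j) \<longleftrightarrow> (\<exists>i<7. x = pt p i \<and> fano i j)" "padj c adj (FL p j) x \<longleftrightarrow> (\<exists>i<7. x = pt p i \<and> fano i j)"
  by (cases x; simp add: padj_def)+

lemma padj_VL [simp]: "padj c adj x VL \<longleftrightarrow> (\<exists>p. x = FP p 1)" "padj c adj VL x \<longleftrightarrow> (\<exists>p. x = FP p 1)"
  by (cases x; simp add: padj_def)+

lemma padj_pt_FL: "i < 7 \<Longrightarrow> padj c adj (pt p i) (FL p j) \<longleftrightarrow> fano i j"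
  by (auto simp: pt_eq)

lemma padj_no [simp]: "\<not> padj c adj (FP p i) (Old e)" "\<not> padj c adj Sp (Old e)"
  "\<not> padj c adj (FP p i) (FP q k)" "\<not> padj c adj Sp (FP q k)" "\<not> padj c adj (FP q k) Sp" "\<not> padj c adj Sp Sp"
  by (auto simp: padj_def)

text \<open>The offsets are those of the difference set negated: 6 and 4 are -1 and -3 modulo
  7.\<close>

lemma fano_pencil:
  assumes "i < 7" "j < 7"
  shows "fano i j \<longleftrightarrow> j = i \<or> j = (i + 6) mod 7 \<or> j = (i + 4) mod 7"
proof -
  have "\<forall>i\<in>{..<7}. \<forall>j\<in>{..<7}. fano i j \<longleftrightarrow> j = i \<or> j = (i + 6) mod 7 \<or> j = (i + 4) mod 7"
    unfolding fano_def by code_simp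
  then show ?thesis using assms by blast
qed

lemma fano_distinct:
  fixes i :: nat
  assumes "i < 7"
  shows "i \<noteq> (i + 6) mod 7 \<and> i \<noteq> (i + 4) mod 7 \<and> (i + 6) mod 7 \<noteq> (i + 4) mod 7"
    "i \<noteq> (i + 1) mod 7 \<and> i \<noteq> (i + 3) mod 7 \<and> (i + 1) mod 7 \<noteq> (i + 3) mod 7"
  using assms unfolding less_7 by (elim disjE; simp)+

text \<open>The points 0, 1, 2 are not collinear, so every line contains one of the points 3 to 6.
  These will lie on no line outside their own Fano plane.\<close>

lemma fano_free_point: "j < 7 \<Longrightarrow> \<exists>i. fano i j \<and> 3 \<le> i \<and> i < 7"
proof -
  have "\<forall>j\<in>{..<7}. \<exists>i\<in>{3..<7}. fano i j" unfolding fano_def by code_simp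
  then show "j < 7 \<Longrightarrow> \<exists>i. fano i j \<and> 3 \<le> i \<and> i < 7" by (metis atLeastLessThan_iff lessThan_iff)
qed

section \<open>The graph with Fano planes attached, and confinement of its elements\<close>

definition block :: "'e \<Rightarrow> 'e pel set" where
  "block p = pt p ` {..<7} \<union> FL p ` {..<7}"

text \<open>\<open>three\<close> allows an old line to be adjoined to the Fano planes of three of
  its points, \<open>on_some\<close> gives every old point a line beyond its Fano plane, and
  \<open>meets\<close> distinguishes the old lines from \<open>VL\<close>, whose points lie on no
  old line.\<close>

locale inflatable = incidence_graph V c adj for V :: "'e set" and c adj +
  assumes three: "\<And>l. \<lbrakk>l \<in> V; \<not> c l\<rbrakk> \<Longrightarrow>
      \<exists>x\<in>V. \<exists>y\<in>V. \<exists>z\<in>V. x \<noteq> y \<and> x \<noteq> z \<and> y \<noteq> z \<and> adj x l \<and> adj y l \<and> adj z l"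
    and on_some: "\<And>p. \<lbrakk>p \<in> V; c p\<rbrakk> \<Longrightarrow> \<exists>l\<in>V. adj p l"
    and meets: "\<And>l. \<lbrakk>l \<in> V; \<not> c l\<rbrakk> \<Longrightarrow> \<exists>m\<in>V. \<not> c m \<and> m \<noteq> l \<and> (\<exists>x\<in>V. adj x l \<and> adj x m)"
    and has_line: "\<exists>l\<in>V. \<not> c l"
begin

abbreviation "W \<equiv> pcar V c"
abbreviation "pa \<equiv> padj c adj"
abbreviation "pc \<equiv> pcol c"

lemma pa_Old [simp]: "\<lbrakk>e \<in> V; e' \<in> V\<rbrakk> \<Longrightarrow> pa (Old e) (Old e') \<longleftrightarrow> adj e e'"
  using bipartite[of e e'] adj_sym by (auto simp: padj_def)

lemma W_cases:
  assumes "x \<in> W"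
  obtains e where "x = Old e" "e \<in> V"
    | p i where "x = FP p i" "p \<in> V" "c p" "i < 7" "i \<noteq> 0" "i \<noteq> 2"
    | p j where "x = FL p j" "p \<in> V" "c p" "j < 7"
    | "x = Sp" | "x = VL"
  using assms by (cases x) auto

lemma points_of_line:
  assumes "l \<in> V" "\<not> c l"
  obtains x y z where "x \<in> V" "y \<in> V" "z \<in> V" "c x" "c y" "c z" "x \<noteq> y" "x \<noteq> z" "y \<noteq> z" "adj x l" "adj y l" "adj z l"
proof -
  obtain x y z where xyz: "x \<in> V" "y \<in> V" "z \<in> V" "x \<noteq> y" "x \<noteq> z" "y \<noteq> z" "adj x l" "adj y l" "adj z l"
    using three[OF assms] by blast
  moreover have "c x" "c y" "c z"
    using xyz assms bipartite[of x l] bipartite[of y l] bipartite[of z l] by blast+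
  ultimately show ?thesis using that by blast
qed

lemma three_points:
  obtains x y z where "x \<in> V" "y \<in> V" "z \<in> V" "c x" "c y" "c z" "x \<noteq> y" "x \<noteq> z" "y \<noteq> z"
proof -
  obtain l where l: "l \<in> V" "\<not> c l" using has_line by blast
  show ?thesis by (rule points_of_line[OF l]) (rule that)
qed

lemma incidence_graph_W: "incidence_graph W pc pa"
  unfolding padj_def[abs_def]
proof (rule incidence_graphI)
  show "pc x \<and> \<not> pc y" if "x \<in> W" "y \<in> W" "plies c adj x y" for x y
  proof (cases y)
    case (Old l)
    then show ?thesis using that bipartite by auto
  next
    case (FL p j)
    then show ?thesis using that by (auto simp: pt_def)
  qed (use that in auto)
next
  fix x y a b
  assume W: "x \<in> W" "y \<in> W" "a \<in> W" "b \<in> W" and xy: "x \<noteq> y"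
    and l: "plies c adj x a" "plies c adj y a" "plies c adj x b" "plies c adj y b"
  from W(3) show "a = b"
  proof (cases rule: W_cases)
    case (1 e)
    then obtain p q where pq: "x = Old p" "y = Old q" "adj p e" "adj q e" using l by auto
    show ?thesis
      using W(4)
    proof (cases rule: W_cases)
      case (1 e')
      then show ?thesis using l pq W xy \<open>a = Old e\<close> \<open>e \<in> V\<close> linear[of p q e e'] by auto
    qed (use l pq xy in auto)
  next
    case (3 p j)
    then obtain i k where ik: "x = pt p i" "y = pt p k" "i < 7" "k < 7" "fano i j" "fano k j" using l by auto
    then have "i \<noteq> k" using xy by auto
    show ?thesis
      using W(4)
    proof (cases rule: W_cases)
      case b: (3 q j')
      then obtain i' k' where ik': "x = pt q i'" "y = pt q k'" "fano i' j'" "fano k' j'" using l by auto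
      \<comment> \<open>Different Fano planes share only the point numbered 2, and \<open>i\<close>
        and \<open>k\<close> are not both 2, so one of the two points determines
        \<open>p\<close>.\<close>
      then have "i' = i" "k' = k" "p = q" using ik \<open>i \<noteq> k\<close> by (auto simp: pt_eq)
      then show ?thesis using fano_linear[of j j' i k] ik ik' \<open>i \<noteq> k\<close> 3 b by simp
    qed (use l ik xy \<open>i \<noteq> k\<close> in auto)
  next
    case 5
    then obtain p q where pq: "x = FP p 1" "y = FP q 1" using l by auto
    show ?thesis
      using W(4)
    proof (cases rule: W_cases)
      case (3 r j)
      then show ?thesis using l pq xy by auto
    qed (use l pq 5 in auto)
  qed (use l in auto)
qed

sublocale infl: incidence_graph W pc pa
  by (rule incidence_graph_W)

lemma pa_pencil:
  assumes "i < 7"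
  shows "pa (pt p i) (FL p i)" "pa (pt p i) (FL p ((i + 6) mod 7))" "pa (pt p i) (FL p ((i + 4) mod 7))"
  using fano_pencil[OF assms, of i] fano_pencil[OF assms, of "(i + 6) mod 7"]
    fano_pencil[OF assms, of "(i + 4) mod 7"] assms
  by (simp_all add: padj_pt_FL[OF assms] del: padj_FL)

lemma confined_block:
  assumes p: "p \<in> V" "c p"
  shows "confined W pa (block p)"
  unfolding confined_def
proof (intro conjI ballI)
  show "finite (block p)" "block p \<subseteq> W" using p by (auto simp: block_def)
  fix x assume "x \<in> block p"
  then consider i where "x = pt p i" "i < 7" | j where "x = FL p j" "j < 7" by (auto simp: block_def)
  then show "3 \<le> card {y \<in> block p. pa x y}"
  proof cases
    case (1 i)
    show ?thesis
      by (rule card_ge3I[of _ "FL p i" "FL p ((i + 6) mod 7)" "FL p ((i + 4) mod 7)"])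
        (use 1 fano_distinct(1)[OF 1(2)] pa_pencil[OF 1(2), of p] in \<open>auto simp: block_def simp del: padj_FL\<close>)
  next
    case (2 j)
    have "pa (FL p j) (pt p i)" if "i < 7" "fano i j" for i using that by auto
    then show ?thesis
      by (intro card_ge3I[of _ "pt p j" "pt p ((j + 1) mod 7)" "pt p ((j + 3) mod 7)"])
        (use 2 fano_distinct(2)[OF 2(2)] in \<open>auto simp: block_def pt_eq fano_def simp del: padj_FL\<close>)
  qed
qed

text \<open>Points and Fano lines lie in a block. An old line, and likewise \<open>VL\<close>, meets
  three Fano planes in points of equal number, 0 or 1, and is adjoined to the union of three blocks.
  For number 2 these points would all be \<open>Sp\<close>, whence \<open>i \<noteq> 2\<close> in
  \<open>hyper\<close>.\<close>

lemma confined_W: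
  assumes "x \<in> W"
  shows "\<exists>C. confined W pa C \<and> x \<in> C"
proof -
  have blk: "\<exists>C. confined W pa C \<and> x \<in> C" if "x \<in> block p" "p \<in> V" "c p" for x p
    using confined_block that by blast
  have ptb: "pt p i \<in> block p" if "i < 7" for p i using that by (auto simp: block_def)
  have hyper: "\<exists>C. confined W pa C \<and> m \<in> C"
    if V: "p \<in> V" "q \<in> V" "r \<in> V" "c p" "c q" "c r" "p \<noteq> q" "p \<noteq> r" "q \<noteq> r" and i: "i < 7" "i \<noteq> 2"
      and m: "m \<in> W" "pa m (pt p i)" "pa m (pt q i)" "pa m (pt r i)" for m p q r i
  proof -
    have "confined W pa (block p \<union> block q \<union> block r)"
      by (intro confined_Un confined_block V)
    then have "confined W pa (insert m (block p \<union> block q \<union> block r))"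
      by (rule confined_insert[of _ _ _ _ "pt p i" "pt q i" "pt r i"])
        (use V i m ptb[of i p] ptb[of i q] ptb[of i r] in \<open>auto simp: pt_eq\<close>)
    then show ?thesis by blast
  qed
  from assms show ?thesis
  proof (cases rule: W_cases)
    case (1 e)
    show ?thesis
    proof (cases "c e")
      case True
      then show ?thesis using blk[of x e] ptb[of 0 e] 1 by (auto simp: pt_def)
    next
      case False
      obtain p q r where "p \<in> V" "q \<in> V" "r \<in> V" "c p" "c q" "c r" "p \<noteq> q" "p \<noteq> r" "q \<noteq> r"
        "adj p e" "adj q e" "adj r e" by (rule points_of_line[of e]) (use 1 False in auto)
      then show ?thesis using hyper[of p q r 0 x] 1 adj_sym assms by (auto simp: pt_def)
    qed
  next
    case (2 p i)
    then show ?thesis using blk[of x p] ptb[of i p] by (auto simp: pt_def)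
  next
    case (3 p j)
    then show ?thesis using blk[of x p] by (auto simp: block_def)
  next
    case 4
    obtain p where "p \<in> V" "c p" using three_points .
    then show ?thesis using blk[of x p] ptb[of 2 p] 4 by (auto simp: pt_def)
  next
    case 5
    obtain p q r where "p \<in> V" "q \<in> V" "r \<in> V" "c p" "c q" "c r" "p \<noteq> q" "p \<noteq> r" "q \<noteq> r"
      using three_points .
    then show ?thesis using hyper[of p q r 1 x] 5 by (auto simp: pt_def)
  qed
qed

section \<open>Recognition of old lines, \<open>VL\<close> and \<open>Sp\<close>\<close>

definition rich :: "'e pel \<Rightarrow> bool" where
  "rich x \<longleftrightarrow> (\<exists>S \<subseteq> {y \<in> W. pa x y}. finite S \<and> 4 \<le> card S)"

text \<open>A point numbered 3 to 6 is on its three Fano lines only, whereas \<open>Old p\<close>,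
  \<open>FP p 1\<close> and \<open>Sp\<close> are on a fourth line; as there may be infinitely many,
  \<open>rich\<close> speaks of finite subsets. The lines all of whose points are rich are then the
  lines outside the Fano planes.\<close>

definition rich_line :: "'e pel \<Rightarrow> bool" where
  "rich_line y \<longleftrightarrow> y \<in> W \<and> \<not> pc y \<and> (\<forall>x\<in>W. pa x y \<longrightarrow> rich x)"

lemma richI:
  assumes p: "p \<in> V" "c p" "i < 7" and y: "y \<in> W" "pa (pt p i) y" "\<And>j. y \<noteq> FL p j"
  shows "rich (pt p i)"
  unfolding rich_def
proof (intro exI conjI)
  let ?S = "{FL p i, FL p ((i + 6) mod 7), FL p ((i + 4) mod 7), y}"
  show "?S \<subseteq> {y \<in> W. pa (pt p i) y}"
    using p y pa_pencil[OF p(3), of p] by (auto simp del: padj_FL)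
  show "4 \<le> card ?S"
    by (rule card_ge4I[of _ "FL p i" "FL p ((i + 6) mod 7)" "FL p ((i + 4) mod 7)" y])
      (use fano_distinct(1)[OF p(3)] y(3) in auto)
qed simp

lemma rich_Old:
  assumes "p \<in> V" "c p"
  shows "rich (Old p)"
proof -
  obtain l where "l \<in> V" "adj p l" using on_some assms by blast
  then show ?thesis using richI[of p 0 "Old l"] assms by (simp add: pt_def)
qed

lemma rich_FP1: "\<lbrakk>p \<in> V; c p\<rbrakk> \<Longrightarrow> rich (FP p 1)"
  using richI[of p 1 VL] by (simp add: pt_def)

lemma rich_Sp: "rich Sp"
proof -
  obtain p q r where pq: "p \<in> V" "q \<in> V" "r \<in> V" "c p" "c q" "c r" "p \<noteq> q" "p \<noteq> r" "q \<noteq> r"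
    using three_points .
  have "pa (pt p 2) (FL q 2)" by (auto simp: pt_eq fano_def)
  then show ?thesis using richI[of p 2 "FL q 2"] pq by (auto simp: pt_def)
qed

lemma not_rich: "\<lbrakk>3 \<le> i; i < 7\<rbrakk> \<Longrightarrow> \<not> rich (FP p i)"
proof
  assume i: "3 \<le> i" "i < 7" and rich: "rich (FP p i)"
  obtain S where S: "S \<subseteq> {y \<in> W. pa (FP p i) y}" "4 \<le> card S"
    using rich unfolding rich_def by blast
  have "{y \<in> W. pa (FP p i) y} \<subseteq> FL p ` {i, (i + 6) mod 7, (i + 4) mod 7}"
  proof
    fix y assume "y \<in> {y \<in> W. pa (FP p i) y}"
    then have y: "y \<in> W" "pa (FP p i) y" by auto
    from y(1) show "y \<in> FL p ` {i, (i + 6) mod 7, (i + 4) mod 7}"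
    proof (cases rule: W_cases)
      case (3 q j)
      then show ?thesis using y(2) i fano_pencil[of i j] by auto
    qed (use y(2) i in auto)
  qed
  then have "card S \<le> card (FL p ` {i, (i + 6) mod 7, (i + 4) mod 7})"
    using S(1) by (intro card_mono) auto
  also have "\<dots> \<le> card {i, (i + 6) mod 7, (i + 4) mod 7}" by (rule card_image_le) simp
  also have "\<dots> \<le> 3" by (simp add: card_insert_if)
  finally show False using S(2) by simp
qed

lemma rich_line_iff: "rich_line y \<longleftrightarrow> y = VL \<or> (\<exists>l\<in>V. \<not> c l \<and> y = Old l)"
proof
  assume y: "rich_line y"
  then have "y \<in> W" by (simp add: rich_line_def)
  then show "y = VL \<or> (\<exists>l\<in>V. \<not> c l \<and> y = Old l)"
  proof (cases rule: W_cases)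
    case (3 p j)
    obtain i where i: "fano i j" "3 \<le> i" "i < 7" using fano_free_point 3 by blast
    then have "FP p i \<in> W" "pa (FP p i) y" using 3 by auto
    then show ?thesis using y not_rich[OF i(2,3)] by (auto simp: rich_line_def)
  qed (use y in \<open>auto simp: rich_line_def\<close>)
next
  assume "y = VL \<or> (\<exists>l\<in>V. \<not> c l \<and> y = Old l)"
  then show "rich_line y"
  proof (elim disjE bexE conjE)
    show ?thesis if "y = VL" using that rich_FP1 by (auto simp: rich_line_def)
    show ?thesis if l: "l \<in> V" "\<not> c l" "y = Old l" for l
      unfolding rich_line_def
    proof (intro conjI ballI impI)
      fix x assume x: "x \<in> W" "pa x y"
      from x(1) show "rich x"
        by (cases rule: W_cases) (use x(2) l bipartite rich_Old in auto)
    qed (use l in auto)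
  qed
qed

lemma auts_rich:
  assumes t: "t \<in> inc_auts W pc pa" and x: "x \<in> W" "rich x"
  shows "rich (t x)"
proof -
  obtain S where S: "S \<subseteq> {y \<in> W. pa x y}" "finite S" "4 \<le> card S" using x by (auto simp: rich_def)
  have "inj_on t S" using S(1) inc_autsD(2)[OF t] by (auto simp: inj_on_def)
  moreover have "t ` S \<subseteq> {y \<in> W. pa (t x) y}" using S(1) inc_autsD(1,4)[OF t] x(1) by auto
  ultimately show ?thesis using S unfolding rich_def by (intro exI[of _ "t ` S"]) (simp add: card_image)
qed

lemma auts_rich_line:
  assumes t: "t \<in> inc_auts W pc pa" and y: "rich_line y"
  shows "rich_line (t y)"
proof -
  have yW: "y \<in> W" "\<not> pc y" using y by (auto simp: rich_line_def)
  have "rich x" if "x \<in> W" "pa x (t y)" for x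
  proof -
    obtain u where u: "u \<in> W" "x = t u" using weight_auts_surj[OF t \<open>x \<in> W\<close>] by blast
    then have "pa u y" using that inc_autsD(4)[OF t] yW by blast
    then show ?thesis using y u auts_rich[OF t] by (auto simp: rich_line_def)
  qed
  then show ?thesis using inc_autsD(1,3)[OF t] yW by (auto simp: rich_line_def)
qed

text \<open>Among the lines all of whose points are rich, \<open>VL\<close> is the one that meets no
  other, while an old line meets another one by \<open>meets\<close>. The contradiction arises when
  such a pair of old lines is pulled back along the inverse.\<close>

lemma auts_VL:
  assumes t: "t \<in> inc_auts W pc pa"
  shows "t VL = VL"
proof (rule ccontr)
  assume "t VL \<noteq> VL"
  moreover have "rich_line (t VL)" using auts_rich_line[OF t] rich_line_iff by blast
  ultimately obtain l where l: "l \<in> V" "\<not> c l" "t VL = Old l" using rich_line_iff by blast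
  obtain m x where m: "m \<in> V" "\<not> c m" "m \<noteq> l" "x \<in> V" "adj x l" "adj x m" using meets[OF l(1,2)] by blast
  obtain s where s: "s \<in> inc_auts W pc pa" "\<And>x. x \<in> W \<Longrightarrow> t (s x) = x" "\<And>x. x \<in> W \<Longrightarrow> s (t x) = x"
    using weight_auts_inverse[OF t] by blast
  have "s (Old l) = VL" using s(3)[of VL] l by simp
  moreover have "s (Old m) \<noteq> VL" using s(2)[of "Old m"] m l by force
  then obtain m' where m': "m' \<in> V" "\<not> c m'" "s (Old m) = Old m'"
    using auts_rich_line[OF s(1), of "Old m"] rich_line_iff m by blast
  moreover have "pa (s (Old x)) (s (Old l))" "pa (s (Old x)) (s (Old m))" "s (Old x) \<in> W"
    using inc_autsD(1,4)[OF s(1)] m l by auto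
  ultimately show False by auto
qed

lemma auts_Old_line:
  assumes t: "t \<in> inc_auts W pc pa" and l: "l \<in> V" "\<not> c l"
  obtains m where "m \<in> V" "\<not> c m" "t (Old l) = Old m"
proof -
  have "t (Old l) \<noteq> t VL" using inc_autsD(2)[OF t] l by simp
  then show ?thesis using auts_rich_line[OF t, of "Old l"] auts_VL[OF t] l rich_line_iff that by metis
qed

lemma auts_Old:
  assumes t: "t \<in> inc_auts W pc pa" and e: "e \<in> V"
  shows "\<exists>e'\<in>V. t (Old e) = Old e'"
proof (cases "c e")
  case True
  then obtain l where l: "l \<in> V" "adj e l" using on_some e by blast
  then have "\<not> c l" using bipartite[of e l] e True by simp
  then obtain m where m: "m \<in> V" "\<not> c m" "t (Old l) = Old m" using auts_Old_line[OF t l(1)] by metis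
  have "pa (t (Old e)) (t (Old l))" "t (Old e) \<in> W" using inc_autsD(1,4)[OF t] e l by auto
  then show ?thesis unfolding m(3) using m(2) by (cases "t (Old e)") auto
next
  case False
  then show ?thesis using auts_Old_line[OF t e] by metis
qed

text \<open>\<open>Sp\<close> is the rich point that lies on no rich line: old points and points
  numbered 1 lie on one, and the remaining points are not rich.\<close>

lemma auts_Sp:
  assumes t: "t \<in> inc_auts W pc pa"
  shows "t Sp = Sp"
proof -
  have no: "\<not> pa Sp l" if "rich_line l" for l using that by (auto simp: rich_line_iff)
  have W: "t Sp \<in> W" "pc (t Sp)" "rich (t Sp)"
    using inc_autsD(1,3)[OF t, of Sp] auts_rich[OF t _ rich_Sp] by auto
  have no': "\<not> pa (t Sp) l" if l: "rich_line l" for l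
  proof
    assume a: "pa (t Sp) l"
    obtain s where s: "s \<in> inc_auts W pc pa" "\<And>x. x \<in> W \<Longrightarrow> s (t x) = x"
      using weight_auts_inverse[OF t] by blast
    have "l \<in> W" using l by (simp add: rich_line_def)
    then have "pa (s (t Sp)) (s l)" using a inc_autsD(4)[OF s(1)] W(1) by blast
    then show False using no[OF auts_rich_line[OF s(1) l]] s(2)[of Sp] by simp
  qed
  from W(1) show ?thesis
  proof (cases rule: W_cases)
    case (1 e)
    then obtain l where l: "l \<in> V" "adj e l" using on_some W(2) by auto
    then have "rich_line (Old l)" using bipartite[of e l] 1 W(2) by (auto simp: rich_line_iff)
    then show ?thesis using no'[of "Old l"] l 1 by simp
  next
    case (2 p i)
    then show ?thesis using no'[of VL] not_rich[of i p] W(3) by (cases "i = 1") (auto simp: rich_line_iff)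
  qed (use W(2) in auto)
qed

lemma auts_FL:
  assumes t: "t \<in> inc_auts W pc pa" and pq: "p \<in> V" "c p" "q \<in> V" "c q"
    and j: "j < 7" "fano i j" "fano k j" and ik: "i < 7" "k < 7" "i \<noteq> k"
    and T: "t (pt p i) = pt q i" "t (pt p k) = pt q k"
  shows "t (FL p j) = FL q j"
proof (rule infl.linear)
  show "pt q i \<noteq> pt q k" using ik by (simp add: pt_eq)
  show "pa (pt q i) (FL q j)" "pa (pt q k) (FL q j)" using j ik by auto
  show "pa (pt q i) (t (FL p j))" "pa (pt q k) (t (FL p j))"
    unfolding T[symmetric] using inc_autsD(4)[OF t, of _ "FL p j"] pq j ik by auto
qed (use inc_autsD(1)[OF t, of "FL p j"] pq ik j in auto)

text \<open>Two placed points place their Fano line, and on its image only the third point is left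
  for the third point.\<close>

lemma auts_third:
  assumes t: "t \<in> inc_auts W pc pa" and pq: "p \<in> V" "c p" "q \<in> V" "c q"
    and j: "j < 7" "fano i j" "fano k j" "fano n j" and ik: "i < 7" "k < 7" "n < 7" "i \<noteq> k" "n \<noteq> i" "n \<noteq> k"
    and T: "t (pt p i) = pt q i" "t (pt p k) = pt q k"
  shows "t (pt p n) = pt q n"
proof -
  have "pa (t (pt p n)) (t (FL p j))"
    using inc_autsD(4)[OF t, of "pt p n" "FL p j"] pq j ik by auto
  then obtain n' where n': "n' < 7" "fano n' j" "t (pt p n) = pt q n'"
    unfolding auts_FL[OF t pq j(1-3) ik(1,2,4) T] by auto
  have "t (pt p n) \<noteq> t (pt p i)" "t (pt p n) \<noteq> t (pt p k)"
    using inc_autsD(2)[OF t] pq ik by (simp_all add: pt_eq)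
  then have "n' \<noteq> i" "n' \<noteq> k" using n' T by auto
  then have "n' = n" using fano_line_cases[OF j(2,3) n'(2) j(4)] ik by blast
  then show ?thesis using n' by simp
qed

lemma auts_pt:
  assumes t: "t \<in> inc_auts W pc pa" and pq: "p \<in> V" "c p" "q \<in> V" "t (Old p) = Old q"
  shows "c q" "\<And>i. i < 7 \<Longrightarrow> t (pt p i) = pt q i" "\<And>j. j < 7 \<Longrightarrow> t (FL p j) = FL q j"
proof -
  show cq: "c q" using inc_autsD(3)[OF t, of "Old p"] pq by simp
  have 0: "t (pt p 0) = pt q 0" using pq by (simp add: pt_def)
  have 2: "t (pt p 2) = pt q 2" using auts_Sp[OF t] by (simp add: pt_def)
  \<comment> \<open>\<open>VL\<close> preserves the number 1, and the Fano line through
    \<open>Old p\<close> and \<open>FP p 1\<close> forces the image into the Fano plane at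
    \<open>q\<close>.\<close>
  have "t (FP p 1) = FP q 1"
  proof -
    have "pa (t (FP p 1)) (t VL)" using inc_autsD(4)[OF t, of "FP p 1" VL] pq by simp
    then obtain r where r: "t (FP p 1) = FP r 1" using auts_VL[OF t] by auto
    have "pa (t (FP p 1)) (t (FL p 0))" "pa (t (Old p)) (t (FL p 0))" "t (FL p 0) \<in> W"
      using inc_autsD(4)[OF t, of "FP p 1" "FL p 0"] inc_autsD(4)[OF t, of "Old p" "FL p 0"]
        inc_autsD(1)[OF t, of "FL p 0"] pq by (auto simp: fano_def)
    then show ?thesis unfolding r pq by (cases "t (FL p 0)") auto
  qed
  then have 1: "t (pt p 1) = pt q 1" by (simp add: pt_def)
  note third = auts_third[OF t pq(1,2,3) cq]
  have 3: "t (pt p 3) = pt q 3"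
    by (rule third[where i = 0 and k = 1 and j = 0]) (use 0 1 in \<open>simp_all add: fano_def\<close>)
  have 4: "t (pt p 4) = pt q 4"
    by (rule third[where i = 1 and k = 2 and j = 1]) (use 1 2 in \<open>simp_all add: fano_def\<close>)
  have 5: "t (pt p 5) = pt q 5"
    by (rule third[where i = 2 and k = 3 and j = 2]) (use 2 3 in \<open>simp_all add: fano_def\<close>)
  have 6: "t (pt p 6) = pt q 6"
    by (rule third[where i = 0 and k = 2 and j = 6]) (use 0 2 in \<open>simp_all add: fano_def\<close>)
  show pt: "t (pt p i) = pt q i" if "i < 7" for i
    using that 0 1 2 3 4 5 6 unfolding less_7 by blast
  show "t (FL p j) = FL q j" if j: "j < 7" for j
    by (rule auts_FL[OF t pq(1,2,3) cq j, where i = j and k = "(j + 1) mod 7"])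
      (use j fano_distinct(2)[OF j] pt in \<open>auto simp: fano_def\<close>)
qed

lemma auts_map_pel:
  assumes t: "t \<in> inc_auts W pc pa"
  shows "\<exists>h. (\<forall>e\<in>V. h e \<in> V) \<and> (\<forall>x\<in>W. t x = map_pel h x)"
proof -
  define h where "h e = (SOME e'. e' \<in> V \<and> t (Old e) = Old e')" for e
  have h: "h e \<in> V \<and> t (Old e) = Old (h e)" if "e \<in> V" for e
  proof -
    have "\<exists>e'. e' \<in> V \<and> t (Old e) = Old e'" using auts_Old[OF t that] by blast
    then show ?thesis unfolding h_def by (rule someI_ex)
  qed
  have "t x = map_pel h x" if "x \<in> W" for x
    using that
  proof (cases rule: W_cases)
    case (2 p i)
    then have "t (pt p i) = pt (h p) i" using auts_pt(2)[OF t] h by blast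
    then show ?thesis using 2 by (simp add: pt_def)
  next
    case (3 p j)
    then show ?thesis using auts_pt(3)[OF t] h by simp
  qed (use h auts_Sp[OF t] auts_VL[OF t] in auto)
  then show ?thesis using h by blast
qed

lemma plies_map_pel:
  assumes h: "h \<in> inc_auts V c adj" and x: "x \<in> W" "y \<in> W"
  shows "plies c adj (map_pel h x) (map_pel h y) \<longleftrightarrow> plies c adj x y"
  using x(2)
proof (cases rule: W_cases)
  case (1 l)
  show ?thesis using x(1) by (cases rule: W_cases) (use 1 inc_autsD(3,4)[OF h] in auto)
next
  case (3 q j)
  have "map_pel h x = pt (h q) i \<longleftrightarrow> x = pt q i" for i
    using x(1) by (cases rule: W_cases) (use inc_autsD(2)[OF h] 3 in auto)
  then show ?thesis using 3 by simp
next
  case 5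
  show ?thesis using x(1) by (cases rule: W_cases) (use 5 in auto)
qed auto

lemma Aut_inflate_iso: "Aut_weighted W (inc_weight pc pa) \<cong> Aut_weighted V (inc_weight c adj)"
  unfolding Aut_weighted_def[of V]
proof (rule functor_iso[where e = Old and m = map_pel])
  show "map_pel h x = map_pel k x" if "x \<in> W" "\<And>a. a \<in> V \<Longrightarrow> h a = k a" for x h k
    using that(1) by (cases rule: W_cases) (use that(2) in auto)
  show "inc_auts V c adj \<subseteq> Bij V" by (auto simp: weight_auts_def)
  show "group (BijGroup V \<lparr>carrier := inc_auts V c adj\<rparr>)"
    using group_Aut_weighted unfolding Aut_weighted_def .
  show "map_pel h x \<in> W" if h: "h \<in> inc_auts V c adj" and x: "x \<in> W" for h x
    using x by (cases rule: W_cases) (use inc_autsD(1,3)[OF h] in auto)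
  show "(pc (map_pel h x), pa (map_pel h x) (map_pel h y)) = (pc x, pa x y)"
    if h: "h \<in> inc_auts V c adj" and x: "x \<in> W" and y: "y \<in> W" for h x y
  proof -
    have "pc (map_pel h x) = pc x" using x by (cases rule: W_cases) (use inc_autsD(3)[OF h] in auto)
    then show ?thesis using plies_map_pel[OF h] x y by (simp add: padj_def)
  qed
  show "h \<in> inc_auts V c adj"
    if t: "t \<in> inc_auts W pc pa" and h: "h \<in> Bij V" "\<And>x. x \<in> W \<Longrightarrow> t x = map_pel h x" for t h
  proof -
    have "h x \<in> V" if "x \<in> V" for x using h(1) that by (auto simp: Bij_def bij_betw_def)
    moreover have "pc (t (Old x)) = pc (Old x)" "pa (t (Old x)) (t (Old y)) = pa (Old x) (Old y)"
      if "x \<in> V" "y \<in> V" for x y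
      using inc_autsD(3)[OF t, of "Old x"] inc_autsD(4)[OF t, of "Old x" "Old y"] that by auto
    ultimately show ?thesis using h by (simp add: weight_auts_def)
  qed
qed (use auts_map_pel in \<open>auto simp: inj_on_def pel.map_ident pel.map_comp o_def\<close>)

lemma desargues_graph_W:
  obtains p where "desargues_graph W pc pa Sp (\<lambda>i. FP (p i) 3) (\<lambda>i. FP (p i) 5) (\<lambda>i. FL (p i) 2)"
proof -
  obtain x y z where xyz: "x \<in> V" "y \<in> V" "z \<in> V" "c x" "c y" "c z" "x \<noteq> y" "x \<noteq> z" "y \<noteq> z"
    using three_points .
  define p where "p = (\<lambda>i::nat. if i = 0 then x else if i = 1 then y else z)"
  have p: "p i \<in> V" "c (p i)" for i using xyz by (auto simp: p_def)
  have ne: "p i \<noteq> p j" if "i < 3" "j < 3" "i \<noteq> j" for i j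
    using that xyz by (auto simp: p_def)
  have nj: "\<not> (\<exists>m\<in>W. pa (FP q i) m \<and> pa (FP r i) m)" if "q \<noteq> r" "i \<noteq> 1" for q r i
  proof
    assume "\<exists>m\<in>W. pa (FP q i) m \<and> pa (FP r i) m"
    then obtain m where "m \<in> W" "pa (FP q i) m" "pa (FP r i) m" by blast
    then show False using that by (cases m) auto
  qed
  have "desargues_graph W pc pa Sp (\<lambda>i. FP (p i) 3) (\<lambda>i. FP (p i) 5) (\<lambda>i. FL (p i) 2)"
  proof (intro desargues_graph.intro desargues_graph_axioms.intro incidence_graph_W)
    show "\<exists>C. confined W pa C \<and> e \<in> C" if "e \<in> W" for e using confined_W[OF that] .
    show "\<not> (\<exists>m\<in>W. pa (FP (p i) 3) m \<and> pa (FP (p j) 3) m) \<and>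
        \<not> (\<exists>m\<in>W. pa (FP (p i) 5) m \<and> pa (FP (p j) 5) m)" if "i < 3" "j < 3" "i \<noteq> j" for i j
      using nj[OF ne[OF that], of 3] nj[OF ne[OF that], of 5] by simp
  qed (use p ne in \<open>auto simp: fano_def\<close>)
  then show ?thesis using that by blast
qed

end

section \<open>Coding a pair of relations by a simple plane\<close>

text \<open>\<open>Gu u\<close> lies on \<open>Lb False u\<close> alone and tells the two lines of a
  vertex apart. Without it, a permutation of the vertices that reverses both relations would induce
  a spurious automorphism exchanging the two families of vertex lines.\<close>

datatype 'u qel = Ep bool | Al | Pu 'u | Ab bool 'u 'u | Fu 'u 'u | Gu 'u | Lb bool 'u | La 'u 'u

primrec qcol :: "'u qel \<Rightarrow> bool" where
  "qcol (Ep b) = True" | "qcol Al = True" | "qcol (Pu u) = True" | "qcol (Ab b u v) = True"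
| "qcol (Fu u v) = True" | "qcol (Gu u) = True" | "qcol (Lb b u) = False" | "qcol (La u v) = False"

text \<open>
  A vertex \<open>u\<close> becomes a line \<open>Lb False u\<close> through \<open>Ep False\<close> and a line \<open>Lb True u\<close> through \<open>Ep True\<close>,
  which meet in \<open>Pu u\<close>. A pair \<open>R u v\<close> becomes a line \<open>La u v\<close> through \<open>Al\<close> that meets \<open>Lb False u\<close>
  and \<open>Lb True v\<close>. It has a point \<open>Fu u v\<close> on no other line just when \<open>E u v\<close>.
\<close>

definition qlies :: "'u qel \<Rightarrow> 'u qel \<Rightarrow> bool" where
  "qlies x y = (case y of
      Lb b u \<Rightarrow> x = Ep b \<or> x = Pu u \<or> (\<exists>v. x = (if b then Ab True v u else Ab False u v)) \<or> \<not> b \<and> x = Gu u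
    | La u v \<Rightarrow> x = Al \<or> (\<exists>b. x = Ab b u v) \<or> x = Fu u v
    | _ \<Rightarrow> False)"

definition qadj :: "'u qel \<Rightarrow> 'u qel \<Rightarrow> bool" where
  "qadj x y \<longleftrightarrow> qlies x y \<or> qlies y x"

definition qcar :: "'u set \<Rightarrow> ('u \<Rightarrow> 'u \<Rightarrow> bool) \<Rightarrow> ('u \<Rightarrow> 'u \<Rightarrow> bool) \<Rightarrow> 'u qel set" where
  "qcar U R E = range Ep \<union> {Al} \<union> Pu ` U \<union> Gu ` U \<union> {Lb b u | b u. u \<in> U} \<union>
    {La u v | u v. u \<in> U \<and> v \<in> U \<and> R u v} \<union> {Ab b u v | b u v. u \<in> U \<and> v \<in> U \<and> R u v} \<union>
    {Fu u v | u v. u \<in> U \<and> v \<in> U \<and> E u v}"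

lemma qcar_simps [simp]:
  "Ep b \<in> qcar U R E" "Al \<in> qcar U R E" "Pu u \<in> qcar U R E \<longleftrightarrow> u \<in> U" "Gu u \<in> qcar U R E \<longleftrightarrow> u \<in> U"
  "Lb b u \<in> qcar U R E \<longleftrightarrow> u \<in> U" "La u v \<in> qcar U R E \<longleftrightarrow> u \<in> U \<and> v \<in> U \<and> R u v"
  "Ab b u v \<in> qcar U R E \<longleftrightarrow> u \<in> U \<and> v \<in> U \<and> R u v" "Fu u v \<in> qcar U R E \<longleftrightarrow> u \<in> U \<and> v \<in> U \<and> E u v"
  by (auto simp: qcar_def)

lemma qlies_simps [simp]:
  "qlies x (Lb b u) \<longleftrightarrow> x = Ep b \<or> x = Pu u \<or> (\<exists>v. x = (if b then Ab True v u else Ab False u v)) \<or> \<not> b \<and> x = Gu u"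
  "qlies x (La u v) \<longleftrightarrow> x = Al \<or> (\<exists>b. x = Ab b u v) \<or> x = Fu u v"
  "\<not> qlies x (Ep b)" "\<not> qlies x Al" "\<not> qlies x (Pu u)" "\<not> qlies x (Ab b u v)" "\<not> qlies x (Fu u v)" "\<not> qlies x (Gu u)"
  by (simp_all add: qlies_def)

lemma qlies_col: "qlies x y \<Longrightarrow> qcol x \<and> \<not> qcol y"
  by (cases y) (auto split: if_splits)

lemma qadj_Lb: "qadj x (Lb b u) \<longleftrightarrow> x = Ep b \<or> x = Pu u \<or> (\<exists>v. x = (if b then Ab True v u else Ab False u v)) \<or> \<not> b \<and> x = Gu u"
  using qlies_col[of "Lb b u" x] by (auto simp: qadj_def)

lemma qadj_La: "qadj x (La u v) \<longleftrightarrow> x = Al \<or> (\<exists>b. x = Ab b u v) \<or> x = Fu u v"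
  using qlies_col[of "La u v" x] by (auto simp: qadj_def)

lemma qadj_point:
  "qadj (Ep b) l \<longleftrightarrow> (\<exists>u. l = Lb b u)" "qadj Al l \<longleftrightarrow> (\<exists>u v. l = La u v)" "qadj (Pu u) l \<longleftrightarrow> (\<exists>b. l = Lb b u)"
  "qadj (Ab b u v) l \<longleftrightarrow> l = La u v \<or> l = Lb b (if b then v else u)"
  "qadj (Fu u v) l \<longleftrightarrow> l = La u v" "qadj (Gu u) l \<longleftrightarrow> l = Lb False u"
  by (cases l; auto simp: qadj_def)+

text \<open>This recovers a pair from its line: the vertex lines that it meets are that of the first
  entry through \<open>Ep False\<close> and that of the second through
  \<open>Ep True\<close>.\<close>

lemma qadj_La_Lb: "qadj z (La x y) \<Longrightarrow> qadj z (Lb b w) \<Longrightarrow> z = Ab b x y \<and> w = (if b then y else x)"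
  by (cases b) (auto simp: qadj_La qadj_Lb)

lemma qlies_linear:
  assumes "x \<noteq> y" "qlies x a" "qlies y a" "qlies x b" "qlies y b"
  shows "a = b"
proof -
  have "qadj x a" "qadj y a" "qadj x b" "qadj y b" using assms by (simp_all add: qadj_def)
  moreover have "qcol x" "qcol y" using assms qlies_col by blast+
  ultimately show ?thesis using assms(1) by (cases x; cases y) (auto simp: qadj_point split: if_splits)
qed

text \<open>Reflexivity of \<open>R\<close> puts the third point \<open>Ab b u u\<close> on each
  vertex line, and \<open>E_R\<close> puts each \<open>Fu u v\<close> on a line. Three vertices give
  \<open>Al\<close> and both \<open>Ep b\<close> at least three lines. By \<open>mixed\<close> and
  reflexivity of \<open>E\<close>, both kinds of pair lines pass through \<open>Al\<close>, which
  sets it apart from \<open>Ep b\<close>.\<close>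

locale coding_graph =
  fixes U :: "'u set" and R E :: "'u \<Rightarrow> 'u \<Rightarrow> bool"
  assumes R_refl: "\<And>u. u \<in> U \<Longrightarrow> R u u"
    and E_refl: "\<And>u. u \<in> U \<Longrightarrow> E u u"
    and E_R: "\<And>u v. E u v \<Longrightarrow> R u v"
    and three_vertices: "\<exists>u\<in>U. \<exists>v\<in>U. \<exists>w\<in>U. u \<noteq> v \<and> u \<noteq> w \<and> v \<noteq> w"
    and mixed: "\<exists>u\<in>U. \<exists>v\<in>U. R u v \<and> \<not> E u v"
begin

abbreviation "Q \<equiv> qcar U R E"

lemma Q_cases:
  assumes "x \<in> Q"
  obtains b where "x = Ep b" | "x = Al" | u where "x = Pu u" "u \<in> U"
    | b u v where "x = Ab b u v" "u \<in> U" "v \<in> U" "R u v"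
    | u v where "x = Fu u v" "u \<in> U" "v \<in> U" "E u v" "R u v"
    | u where "x = Gu u" "u \<in> U" | b u where "x = Lb b u" "u \<in> U"
    | u v where "x = La u v" "u \<in> U" "v \<in> U" "R u v"
  using assms E_R by (cases x) auto

lemma incidence_graph_Q: "incidence_graph Q qcol qadj"
  unfolding qadj_def[abs_def] by (rule incidence_graphI) (use qlies_col qlies_linear in blast)+

sublocale incidence_graph Q qcol qadj
  by (rule incidence_graph_Q)

section \<open>Incidence invariants of the code\<close>

definition special :: "'u qel \<Rightarrow> bool" where
  "special x \<longleftrightarrow> qcol x \<and> (\<exists>k\<in>Q. \<exists>l\<in>Q. \<exists>m\<in>Q. k \<noteq> l \<and> k \<noteq> m \<and> l \<noteq> m \<and> qadj x k \<and> qadj x l \<and> qadj x m)"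

definition lonely :: "'u qel \<Rightarrow> bool" where
  "lonely x \<longleftrightarrow> qcol x \<and> (\<forall>l\<in>Q. \<forall>m\<in>Q. qadj x l \<longrightarrow> qadj x m \<longrightarrow> l = m)"

definition has_lonely :: "'u qel \<Rightarrow> bool" where
  "has_lonely l \<longleftrightarrow> (\<exists>x\<in>Q. qadj x l \<and> lonely x)"

lemma special_iff: "x \<in> Q \<Longrightarrow> special x \<longleftrightarrow> x = Al \<or> (\<exists>b. x = Ep b)"
proof -
  obtain u v w where uvw: "u \<in> U" "v \<in> U" "w \<in> U" "u \<noteq> v" "u \<noteq> w" "v \<noteq> w" using three_vertices by blast
  have "special (Ep b)" for b
    unfolding special_def
    by (intro conjI bexI[of _ "Lb b u"] bexI[of _ "Lb b v"] bexI[of _ "Lb b w"]) (use uvw in \<open>auto simp: qadj_point\<close>)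
  moreover have "special Al"
    unfolding special_def
    by (intro conjI bexI[of _ "La u u"] bexI[of _ "La v v"] bexI[of _ "La w w"])
      (use uvw R_refl in \<open>auto simp: qadj_point\<close>)
  ultimately show "x \<in> Q \<Longrightarrow> special x \<longleftrightarrow> x = Al \<or> (\<exists>b. x = Ep b)"
    by (cases x) (auto simp: special_def qadj_point)
qed

lemma not_lonelyI: "\<lbrakk>l \<in> Q; m \<in> Q; l \<noteq> m; qadj x l; qadj x m\<rbrakk> \<Longrightarrow> \<not> lonely x"
  unfolding lonely_def by blast

lemma lonely_iff: "x \<in> Q \<Longrightarrow> lonely x \<longleftrightarrow> (\<exists>u v. x = Fu u v) \<or> (\<exists>u. x = Gu u)"
proof -
  obtain u v where uv: "u \<in> U" "v \<in> U" "u \<noteq> v" using three_vertices by blast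
  assume "x \<in> Q"
  then show ?thesis
  proof (cases rule: Q_cases)
    case (1 b)
    have "\<not> lonely (Ep b)"
      by (rule not_lonelyI[of "Lb b u" "Lb b v"]) (use uv in \<open>auto simp: qadj_point\<close>)
    then show ?thesis using 1 by simp
  next
    case 2
    have "\<not> lonely Al"
      by (rule not_lonelyI[of "La u u" "La v v"]) (use uv R_refl in \<open>auto simp: qadj_point\<close>)
    then show ?thesis using 2 by simp
  next
    case (3 u)
    have "\<not> lonely (Pu u)"
      by (rule not_lonelyI[of "Lb True u" "Lb False u"]) (use 3 in \<open>auto simp: qadj_point\<close>)
    then show ?thesis using 3 by simp
  next
    case (4 b u v)
    have "\<not> lonely (Ab b u v)"
      by (rule not_lonelyI[of "La u v" "Lb b (if b then v else u)"]) (use 4 in \<open>auto simp: qadj_point\<close>)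
    then show ?thesis using 4 by simp
  qed (auto simp: lonely_def qadj_point)
qed

lemma has_lonely_iff: "has_lonely l \<longleftrightarrow> (\<exists>x\<in>Q. qadj x l \<and> ((\<exists>u v. x = Fu u v) \<or> (\<exists>u. x = Gu u)))"
  unfolding has_lonely_def using lonely_iff by blast

lemma has_lonely_simps:
  "u \<in> U \<Longrightarrow> has_lonely (Lb b u) \<longleftrightarrow> \<not> b"
  "\<lbrakk>u \<in> U; v \<in> U; R u v\<rbrakk> \<Longrightarrow> has_lonely (La u v) \<longleftrightarrow> E u v"
  by (auto simp: has_lonely_iff qadj_Lb qadj_La)

text \<open>Stated for an arbitrary \<open>\<phi>\<close>, so that it applies to nested quantifiers
  and to any invariant of lines.\<close>

lemma auts_adj_all:
  assumes t: "t \<in> inc_auts Q qcol qadj" and x: "x \<in> Q"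
  shows "(\<forall>l\<in>Q. qadj (t x) l \<longrightarrow> \<phi> l) \<longleftrightarrow> (\<forall>l\<in>Q. qadj x l \<longrightarrow> \<phi> (t l))"
proof
  assume *: "\<forall>l\<in>Q. qadj x l \<longrightarrow> \<phi> (t l)"
  show "\<forall>l\<in>Q. qadj (t x) l \<longrightarrow> \<phi> l"
  proof (intro ballI impI)
    fix l assume l: "l \<in> Q" "qadj (t x) l"
    then obtain k where "k \<in> Q" "l = t k" using weight_auts_surj[OF t] by blast
    then show "\<phi> l" using * l inc_autsD(4)[OF t x] by blast
  qed
next
  assume *: "\<forall>l\<in>Q. qadj (t x) l \<longrightarrow> \<phi> l"
  show "\<forall>l\<in>Q. qadj x l \<longrightarrow> \<phi> (t l)"
    using * inc_autsD(1,4)[OF t] x by blast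
qed

lemma auts_lonely:
  assumes t: "t \<in> inc_auts Q qcol qadj" and x: "x \<in> Q"
  shows "lonely (t x) \<longleftrightarrow> lonely x"
proof -
  have "(\<forall>l\<in>Q. \<forall>m\<in>Q. qadj (t x) l \<longrightarrow> qadj (t x) m \<longrightarrow> l = m) \<longleftrightarrow>
      (\<forall>l\<in>Q. qadj (t x) l \<longrightarrow> (\<forall>m\<in>Q. qadj (t x) m \<longrightarrow> l = m))" by blast
  also have "\<dots> \<longleftrightarrow> (\<forall>l\<in>Q. qadj x l \<longrightarrow> (\<forall>m\<in>Q. qadj x m \<longrightarrow> t l = t m))"
    unfolding auts_adj_all[OF t x] ..
  also have "\<dots> \<longleftrightarrow> (\<forall>l\<in>Q. qadj x l \<longrightarrow> (\<forall>m\<in>Q. qadj x m \<longrightarrow> l = m))"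
    using inc_autsD(2)[OF t] by blast
  finally show ?thesis using inc_autsD(3)[OF t x] unfolding lonely_def by blast
qed

lemma auts_has_lonely:
  assumes t: "t \<in> inc_auts Q qcol qadj" and l: "l \<in> Q"
  shows "has_lonely (t l) \<longleftrightarrow> has_lonely l"
proof
  assume "has_lonely (t l)"
  then obtain x where x: "x \<in> Q" "qadj x (t l)" "lonely x" by (auto simp: has_lonely_def)
  then obtain y where "y \<in> Q" "x = t y" using weight_auts_surj[OF t] by blast
  then show "has_lonely l" using x inc_autsD(4)[OF t _ l] auts_lonely[OF t] by (auto simp: has_lonely_def)
next
  assume "has_lonely l"
  then obtain x where x: "x \<in> Q" "qadj x l" "lonely x" by (auto simp: has_lonely_def)
  then show "has_lonely (t l)"
    using inc_autsD(1,4)[OF t] l auts_lonely[OF t] unfolding has_lonely_def by (intro bexI[of _ "t x"]) auto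
qed

lemma auts_special:
  assumes t: "t \<in> inc_auts Q qcol qadj" and x: "x \<in> Q" "special x"
  shows "special (t x)"
proof -
  obtain k l m where *: "k \<in> Q" "l \<in> Q" "m \<in> Q" "k \<noteq> l" "k \<noteq> m" "l \<noteq> m" "qadj x k" "qadj x l" "qadj x m"
    using x by (auto simp: special_def)
  show ?thesis
    unfolding special_def
    by (intro conjI bexI[of _ "t k"] bexI[of _ "t l"] bexI[of _ "t m"])
      (use * x inc_autsD[OF t] in \<open>auto simp: special_def\<close>)
qed

text \<open>With \<open>none_lonely\<close> this separates the special points: every line through
  \<open>Ep False\<close> carries a lonely point \<open>Gu u\<close>, none through
  \<open>Ep True\<close> has one, and through \<open>Al\<close> there are lines of both
  kinds.\<close>

definition all_lonely :: "'u qel \<Rightarrow> bool" where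
  "all_lonely x \<longleftrightarrow> (\<forall>l\<in>Q. qadj x l \<longrightarrow> has_lonely l)"

definition none_lonely :: "'u qel \<Rightarrow> bool" where
  "none_lonely x \<longleftrightarrow> (\<forall>l\<in>Q. qadj x l \<longrightarrow> \<not> has_lonely l)"

lemma all_none_lonely_Ep: "all_lonely (Ep b) \<longleftrightarrow> \<not> b" "none_lonely (Ep b) \<longleftrightarrow> b"
proof -
  obtain u where u: "u \<in> U" using three_vertices by blast
  have "has_lonely l \<longleftrightarrow> \<not> b" if "l \<in> Q" "qadj (Ep b) l" for l
    using that has_lonely_simps(1) unfolding qadj_point by auto
  moreover have "Lb b u \<in> Q" "qadj (Ep b) (Lb b u)" using u by (simp_all add: qadj_point)
  ultimately show "all_lonely (Ep b) \<longleftrightarrow> \<not> b" "none_lonely (Ep b) \<longleftrightarrow> b"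
    unfolding all_lonely_def none_lonely_def by blast+
qed

lemma all_none_lonely_Al: "\<not> all_lonely Al" "\<not> none_lonely Al"
proof -
  obtain u v where uv: "u \<in> U" "v \<in> U" "R u v" "\<not> E u v" using mixed by blast
  have "La u v \<in> Q" "\<not> has_lonely (La u v)" "La u u \<in> Q" "has_lonely (La u u)"
    using uv R_refl E_refl by (simp_all add: has_lonely_simps(2))
  then show "\<not> all_lonely Al" "\<not> none_lonely Al"
    unfolding all_lonely_def none_lonely_def qadj_point by blast+
qed

lemma auts_special_eq:
  assumes t: "t \<in> inc_auts Q qcol qadj"
  shows "t (Ep b) = Ep b" "t Al = Al"
proof -
  have inv: "all_lonely (t x) \<longleftrightarrow> all_lonely x" "none_lonely (t x) \<longleftrightarrow> none_lonely x" if "x \<in> Q" for x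
    using auts_adj_all[OF t that, of has_lonely] auts_adj_all[OF t that, of "\<lambda>l. \<not> has_lonely l"]
      auts_has_lonely[OF t] unfolding all_lonely_def none_lonely_def by blast+
  have sp: "t x = Al \<or> (\<exists>b. t x = Ep b)" if "x \<in> Q" "special x" for x
    using special_iff[of "t x"] auts_special[OF t that] inc_autsD(1)[OF t] that by blast
  show "t (Ep b) = Ep b"
  proof -
    have "t (Ep b) = Al \<or> (\<exists>b'. t (Ep b) = Ep b')" using sp[of "Ep b"] special_iff[of "Ep b"] by simp
    then show ?thesis
    proof (elim disjE exE)
      show ?thesis if "t (Ep b) = Al"
        using inv[of "Ep b"] all_none_lonely_Al unfolding that all_none_lonely_Ep by simp
      show ?thesis if "t (Ep b) = Ep b'" for b'
        using inv(1)[of "Ep b"] unfolding that all_none_lonely_Ep by simp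
    qed
  qed
  have "t Al = Al \<or> (\<exists>b. t Al = Ep b)" using sp[of Al] special_iff[of Al] by simp
  then show "t Al = Al"
  proof (elim disjE exE)
    show ?thesis if "t Al = Ep b" for b
      using inv[of Al] all_none_lonely_Al unfolding that all_none_lonely_Ep by simp
  qed
qed

text \<open>The map on vertices is read from the lines through \<open>Ep False\<close>; the points
  \<open>Pu u\<close> make those through \<open>Ep True\<close> follow it. A pair line is determined
  by the vertex lines that it meets, and \<open>Fu u v\<close> and \<open>Gu u\<close> by being the
  lonely points of their lines.\<close>

lemma auts_map_qel:
  assumes t: "t \<in> inc_auts Q qcol qadj"
  shows "\<exists>h. (\<forall>u\<in>U. h u \<in> U) \<and> (\<forall>x\<in>Q. t x = map_qel h x)"
proof -
  note tQ = inc_autsD(1)[OF t] and tadj = inc_autsD(4)[OF t, THEN iffD2] and sp = auts_special_eq[OF t]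
  have ex: "\<exists>u'\<in>U. t (Lb b u) = Lb b u'" if "u \<in> U" for b u
  proof -
    have "qadj (t (Ep b)) (t (Lb b u))" using tadj[of "Ep b" "Lb b u"] that by (auto simp: qadj_point)
    moreover have "t (Lb b u) \<in> Q" using tQ[of "Lb b u"] that by simp
    ultimately show ?thesis unfolding sp qadj_point by auto
  qed
  have ab: "\<exists>u'\<in>U. t (Lb False u) = Lb False u' \<and> t (Lb True u) = Lb True u' \<and> t (Pu u) = Pu u'" if u: "u \<in> U" for u
  proof -
    obtain f g where fg: "f \<in> U" "t (Lb False u) = Lb False f" "t (Lb True u) = Lb True g"
      using ex[OF u] by metis
    have "qadj (t (Pu u)) (Lb False f)" "qadj (t (Pu u)) (Lb True g)"
      using tadj[of "Pu u" "Lb False u"] tadj[of "Pu u" "Lb True u"] u fg by (auto simp: qadj_point)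
    then have "t (Pu u) = Pu f \<and> f = g" by (auto simp: qadj_Lb)
    then show ?thesis using fg by blast
  qed
  define h where "h u = (SOME u'. u' \<in> U \<and> t (Lb False u) = Lb False u' \<and> t (Lb True u) = Lb True u' \<and> t (Pu u) = Pu u')" for u
  have h: "h u \<in> U \<and> t (Lb False u) = Lb False (h u) \<and> t (Lb True u) = Lb True (h u) \<and> t (Pu u) = Pu (h u)"
    if "u \<in> U" for u
  proof -
    have "\<exists>u'. u' \<in> U \<and> t (Lb False u) = Lb False u' \<and> t (Lb True u) = Lb True u' \<and> t (Pu u) = Pu u'"
      using ab[OF that] by blast
    then show ?thesis unfolding h_def by (rule someI_ex)
  qed
  have Lb: "t (Lb b u) = Lb b (h u)" if "u \<in> U" for b u using h[OF that] by (cases b) auto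
  have La: "t (La u v) = La (h u) (h v) \<and> t (Ab b u v) = Ab b (h u) (h v)" if uv: "u \<in> U" "v \<in> U" "R u v" for u v b
  proof -
    have "qadj (t Al) (t (La u v))" using tadj[of Al "La u v"] uv by (auto simp: qadj_point)
    then obtain x y where xy: "t (La u v) = La x y" unfolding sp qadj_point by blast
    have "t (Ab b u v) = Ab b x y \<and> (if b then h v else h u) = (if b then y else x)" for b
    proof (rule qadj_La_Lb)
      show "qadj (t (Ab b u v)) (La x y)"
        using tadj[of "Ab b u v" "La u v"] uv by (simp add: qadj_point xy)
      have "qadj (t (Ab b u v)) (t (Lb b (if b then v else u)))"
        using tadj[of "Ab b u v" "Lb b (if b then v else u)"] uv by (simp add: qadj_point)
      then show "qadj (t (Ab b u v)) (Lb b (if b then h v else h u))" using Lb uv by (cases b) simp_all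
    qed
    from this[of b] this[of False] this[of True] show ?thesis using xy by simp
  qed
  have "t x = map_qel h x" if "x \<in> Q" for x
    using that
  proof (cases rule: Q_cases)
    case (5 u v)
    then have "qadj (t x) (t (La u v))" "lonely (t x)" "t x \<in> Q"
      using tadj[of x "La u v"] tQ[of x] auts_lonely[OF t, of x] by (auto simp: qadj_point lonely_iff)
    then show ?thesis using La[of u v] 5 by (auto simp: qadj_La lonely_iff)
  next
    case (6 u)
    then have "qadj (t x) (t (Lb False u))" "lonely (t x)" "t x \<in> Q"
      using tadj[of x "Lb False u"] tQ[of x] auts_lonely[OF t, of x] by (auto simp: qadj_point lonely_iff)
    then show ?thesis using Lb[of u False] 6 by (auto simp: qadj_Lb lonely_iff)
  qed (use h Lb La sp in auto)
  then show ?thesis using h by blast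
qed

abbreviation "code_auts \<equiv> weight_auts U (\<lambda>u v. (R u v, E u v))"

lemma qlies_map_qel:
  assumes inj: "inj_on h U" and x: "x \<in> Q" "y \<in> Q"
  shows "qlies (map_qel h x) (map_qel h y) \<longleftrightarrow> qlies x y"
proof -
  have eq: "h u = h v \<longleftrightarrow> u = v" if "u \<in> U" "v \<in> U" for u v using inj that by (auto simp: inj_on_def)
  from x(2) show ?thesis
  proof (cases rule: Q_cases)
    case (7 b u)
    show ?thesis using x(1) by (cases rule: Q_cases) (use 7 eq in \<open>auto split: if_splits\<close>)
  next
    case (8 u v)
    show ?thesis using x(1) by (cases rule: Q_cases) (use 8 eq in auto)
  qed auto
qed

lemma Aut_code_iso: "Aut_weighted Q (inc_weight qcol qadj) \<cong> Aut_weighted U (\<lambda>u v. (R u v, E u v))"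
  unfolding Aut_weighted_def[of U]
proof (rule functor_iso[where e = Pu and m = map_qel])
  show "map_qel h x = map_qel k x" if "x \<in> Q" "\<And>u. u \<in> U \<Longrightarrow> h u = k u" for x h k
    using that(1) by (cases rule: Q_cases) (use that(2) in auto)
  show "code_auts \<subseteq> Bij U" by (auto simp: weight_auts_def)
  show "group (BijGroup U \<lparr>carrier := code_auts\<rparr>)"
    using group_Aut_weighted unfolding Aut_weighted_def .
  fix h
  show "map_qel h x \<in> Q" if h: "h \<in> code_auts" and x: "x \<in> Q" for x
    using x by (cases rule: Q_cases) (use weight_autsD(2,4)[OF h] in auto)
  show "(qcol (map_qel h x), qadj (map_qel h x) (map_qel h y)) = (qcol x, qadj x y)"
    if h: "h \<in> code_auts" and x: "x \<in> Q" and y: "y \<in> Q" for x y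
  proof -
    have "inj_on h U" using weight_autsD(3)[OF h] by (auto simp: inj_on_def)
    moreover have "qcol (map_qel h x) = qcol x" by (cases x) auto
    ultimately show ?thesis using x y by (simp add: qadj_def qlies_map_qel)
  qed
  show "h \<in> code_auts"
    if t: "t \<in> inc_auts Q qcol qadj" and h: "h \<in> Bij U" "\<And>x. x \<in> Q \<Longrightarrow> t x = map_qel h x" for t
  proof -
    have hU: "h u \<in> U" "h u = h v \<longleftrightarrow> u = v" if "u \<in> U" "v \<in> U" for u v
      using h(1) that by (auto simp: Bij_def bij_betw_def inj_on_def)
    have "R (h u) (h v) = R u v" "E (h u) (h v) = E u v" if uv: "u \<in> U" "v \<in> U" for u v
    proof -
      \<comment> \<open>The relations sit in the carrier: \<open>R u v\<close> and
        \<open>E u v\<close> say that \<open>La u v\<close> and \<open>Fu u v\<close> are present,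
        and the bijection \<open>t\<close> preserves presence both ways.\<close>
      have mem: "y \<in> Q \<longleftrightarrow> map_qel h y \<in> Q" if y: "y = La u v \<or> y = Fu u v" for y
      proof
        show "map_qel h y \<in> Q" if "y \<in> Q" using inc_autsD(1)[OF t that] h(2)[OF that] by simp
        assume "map_qel h y \<in> Q"
        then obtain z where z: "z \<in> Q" "map_qel h y = map_qel h z" using weight_auts_surj[OF t] h(2) by metis
        then show "y \<in> Q" using y hU uv by (cases rule: Q_cases) auto
      qed
      show "R (h u) (h v) = R u v" using mem[of "La u v"] uv hU by simp
      show "E (h u) (h v) = E u v" using mem[of "Fu u v"] uv hU by simp
    qed
    then show ?thesis using h(1) by (simp add: weight_auts_def)
  qed
qed (use auts_map_qel in \<open>auto simp: inj_on_def qel.map_ident qel.map_comp o_def\<close>)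

section \<open>The code as a simple plane and as a basis for the Fano planes\<close>

lemma three_on_line:
  assumes "l \<in> Q" "\<not> qcol l"
  shows "\<exists>x\<in>Q. \<exists>y\<in>Q. \<exists>z\<in>Q. x \<noteq> y \<and> x \<noteq> z \<and> y \<noteq> z \<and> qadj x l \<and> qadj y l \<and> qadj z l"
  using assms(1)
proof (cases rule: Q_cases)
  case (7 b u)
  then show ?thesis using R_refl
    by (intro bexI[of _ "Ep b"] bexI[of _ "Pu u"] bexI[of _ "Ab b u u"]) (auto simp: qadj_Lb)
next
  case (8 u v)
  then show ?thesis
    by (intro bexI[of _ Al] bexI[of _ "Ab False u v"] bexI[of _ "Ab True u v"]) (auto simp: qadj_La)
qed (use assms in auto)

lemma inflatable_Q: "inflatable Q qcol qadj"
proof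
  show "\<exists>l\<in>Q. qadj p l" if p: "p \<in> Q" "qcol p" for p
  proof -
    obtain u where u: "u \<in> U" using three_vertices by blast
    from p(1) show ?thesis
    proof (cases rule: Q_cases)
      case (1 b) then show ?thesis using u by (intro bexI[of _ "Lb b u"]) (simp_all add: qadj_point)
    next
      case 2 then show ?thesis using u R_refl by (intro bexI[of _ "La u u"]) (simp_all add: qadj_point)
    next
      case (3 w) then show ?thesis by (intro bexI[of _ "Lb False w"]) (auto simp: qadj_point)
    next
      case (4 b w w') then show ?thesis by (intro bexI[of _ "La w w'"]) (simp_all add: qadj_point)
    next
      case (5 w w') then show ?thesis by (intro bexI[of _ "La w w'"]) (simp_all add: qadj_point)
    next
      case (6 w) then show ?thesis by (intro bexI[of _ "Lb False w"]) (simp_all add: qadj_point)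
    qed (use p in simp_all)
  qed
  show "\<exists>m\<in>Q. \<not> qcol m \<and> m \<noteq> l \<and> (\<exists>x\<in>Q. qadj x l \<and> qadj x m)" if l: "l \<in> Q" "\<not> qcol l" for l
    using l(1)
  proof (cases rule: Q_cases)
    case (7 b u)
    then show ?thesis by (intro bexI[of _ "Lb (\<not> b) u"] conjI bexI[of _ "Pu u"]) (auto simp: qadj_Lb)
  next
    case (8 u v)
    then show ?thesis
      by (intro bexI[of _ "Lb False u"] conjI bexI[of _ "Ab False u v"]) (auto simp: qadj_Lb qadj_La)
  qed (use l in auto)
  show "\<exists>l\<in>Q. \<not> qcol l" using three_vertices by (meson qcar_simps(5) qcol.simps(7))
qed (rule three_on_line)

lemma simple_plane_Q:
  fixes \<iota> :: "'u qel \<Rightarrow> 'p"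
  assumes inj: "inj_on \<iota> {x \<in> Q. qcol x}"
  shows "simple_plane (plane_of \<iota> Q qcol qadj)"
    and "Aut_plane (plane_of \<iota> Q qcol qadj) \<cong> Aut_weighted U (\<lambda>u v. (R u v, E u v))"
proof -
  interpret P: plane_graph Q qcol qadj \<iota>
  proof (intro plane_graph.intro plane_graph_axioms.intro)
    show "\<exists>x\<in>Q. \<exists>y\<in>Q. x \<noteq> y \<and> qadj x l \<and> qadj y l" if "l \<in> Q" "\<not> qcol l" for l
      using three_on_line[OF that] by blast
    show "\<exists>x\<in>Q. \<exists>y\<in>Q. \<exists>z\<in>Q. qcol x \<and> qcol y \<and> qcol z \<and> x \<noteq> y \<and> x \<noteq> z \<and> y \<noteq> z \<and>
      \<not> (\<exists>l\<in>Q. qadj x l \<and> qadj y l \<and> qadj z l)"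
      by (intro bexI[of _ "Ep False"] bexI[of _ "Ep True"] bexI[of _ Al]) (auto simp: qadj_point)
  qed (rule incidence_graph_Q inj)+
  have thick: "card {x \<in> Q. qadj x l} \<noteq> 2" if l: "l \<in> Q" "\<not> qcol l" for l
  proof
    assume c2: "card {x \<in> Q. qadj x l} = 2"
    then have "finite {x \<in> Q. qadj x l}" by (intro card_ge_0_finite) simp
    moreover obtain x y z where "x \<in> Q" "y \<in> Q" "z \<in> Q" "x \<noteq> y" "x \<noteq> z" "y \<noteq> z" "qadj x l" "qadj y l" "qadj z l"
      using three_on_line[OF l] by blast
    ultimately have "3 \<le> card {x \<in> Q. qadj x l}" by (intro card_ge3I[of _ x y z]) auto
    then show False using c2 by simp
  qed
  have "Aut_plane P.P \<cong> Aut_weighted Q (inc_weight qcol qadj)"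
    by (rule P.Aut_plane_iso) (use thick in blast)
  then show "Aut_plane P.P \<cong> Aut_weighted U (\<lambda>u v. (R u v, E u v))"
    using Aut_code_iso by (rule iso_trans)
  obtain u v w where uvw: "u \<in> U" "v \<in> U" "w \<in> U" "u \<noteq> v" "u \<noteq> w" "v \<noteq> w" using three_vertices by blast
  \<comment> \<open>Only \<open>Ep False\<close>, \<open>Ep True\<close> and \<open>Al\<close> can
    lie on more than two non-trivial lines. The other fourteen points, available from any three
    vertices, bring the number to exactly 17.\<close>
  define S where "S = {Ep False, Ep True, Al, Pu u, Pu v, Pu w, Gu u, Gu v, Gu w, Ab False u u, Ab False v v,
    Ab False w w, Ab True u u, Ab True v v, Ab True w w, Fu u u, Fu v v}"
  show "simple_plane P.P"
  proof (rule P.simple_P)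
    show "S \<subseteq> {x \<in> Q. qcol x}" using uvw R_refl E_refl by (auto simp: S_def)
    show "card S = 17" using uvw by (simp add: S_def)
    show "\<exists>l m. \<forall>k\<in>Q. qadj x k \<longrightarrow> k = l \<or> k = m" if x: "x \<in> Q" "qcol x" "x \<notin> S" for x
      using x(1)
    proof (cases rule: Q_cases)
      case (1 b)
      then show ?thesis using x by (cases b) (auto simp: S_def)
    next
      case (3 u)
      then show ?thesis by (intro exI[of _ "Lb False u"] exI[of _ "Lb True u"]) (auto simp: qadj_point)
    next
      case (4 b u v)
      then show ?thesis
        by (intro exI[of _ "La u v"] exI[of _ "Lb b (if b then v else u)"]) (auto simp: qadj_point)
    qed (use x in \<open>auto simp: S_def qadj_point\<close>)
  qed (rule thick)
qed

end

section \<open>Coding a structure by a pair of relations\<close>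

text \<open>Induction on the label \<open>k\<close> of \<open>u\<close>. If \<open>t u\<close> has a
  smaller label, the induction hypothesis says that \<open>t\<close> keeps that label, although
  \<open>t\<close> must lower it as it lowered that of \<open>u\<close>. If \<open>t u\<close> has a
  larger label, then \<open>u\<close> is the image of some \<open>z\<close> with label below
  \<open>k\<close>, and the label of \<open>z\<close> should have been kept.\<close>

lemma wellorder_rigid:
  fixes lab :: "'u \<Rightarrow> 'l" and r :: "'l rel"
  assumes r: "Well_order r" "Field r = UNIV"
    and t: "\<And>u. u \<in> U \<Longrightarrow> t u \<in> U" "\<And>v. v \<in> U \<Longrightarrow> \<exists>u\<in>U. v = t u"
    and iso: "\<And>u v. u \<in> U \<Longrightarrow> v \<in> U \<Longrightarrow> (lab (t u), lab (t v)) \<in> r \<longleftrightarrow> (lab u, lab v) \<in> r"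
    and u: "u \<in> U"
  shows "lab (t u) = lab u"
proof -
  have tot: "(x, y) \<in> r \<or> (y, x) \<in> r" and antisym: "(x, y) \<in> r \<Longrightarrow> (y, x) \<in> r \<Longrightarrow> x = y" for x y
    using r by (auto simp: order_on_defs total_on_def refl_on_def antisym_def) (metis UNIV_I)+
  have wf: "wf (r - Id)" using r(1) by (simp add: well_order_on_def)
  have lt: "(x, y) \<in> r - Id \<longleftrightarrow> (y, x) \<notin> r" for x y using tot[of x y] antisym[of x y] by auto
  have lt_iso: "(lab (t u), lab (t v)) \<in> r - Id \<longleftrightarrow> (lab u, lab v) \<in> r - Id" if "u \<in> U" "v \<in> U" for u v
    unfolding lt iso[OF that(2,1)] ..
  have "\<forall>u\<in>U. lab u = k \<longrightarrow> lab (t u) = k" for k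
  proof (rule wf_induct[OF wf], intro ballI impI)
    fix k u
    assume IH: "\<forall>k'. (k', k) \<in> r - Id \<longrightarrow> (\<forall>u\<in>U. lab u = k' \<longrightarrow> lab (t u) = k')" and u: "u \<in> U" "lab u = k"
    show "lab (t u) = k"
    proof (rule ccontr)
      assume "lab (t u) \<noteq> k"
      then consider "(lab (t u), k) \<in> r - Id" | "(k, lab (t u)) \<in> r - Id" using tot by blast
      then show False
      proof cases
        case 1
        then have "lab (t (t u)) = lab (t u)" using IH t(1)[OF u(1)] by blast
        moreover have "(lab (t (t u)), lab (t u)) \<in> r - Id" using 1 lt_iso[of "t u" u] t(1) u by simp
        ultimately show False by simp
      next
        case 2
        obtain z where z: "z \<in> U" "u = t z" using t(2) u(1) by blast
        have "(lab (t z), lab (t u)) \<in> r - Id" using 2 u z by simp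
        then have *: "(lab z, k) \<in> r - Id" using lt_iso[OF z(1) u(1)] u(2) by simp
        then have "lab (t z) = lab z" using IH z(1) by blast
        then show False using * u z by simp
      qed
    qed
  qed
  then show ?thesis using u by blast
qed

section \<open>The graph of repetition-free lists\<close>

type_synonym 'a node = "'a list \<times> nat"

definition orbit :: "('a \<Rightarrow> 'a) set \<Rightarrow> 'a list \<Rightarrow> 'a list set" where
  "orbit G xs = {map g xs | g. g \<in> G}"

text \<open>The nodes \<open>([], 1)\<close> and \<open>([], 2)\<close> make the configuration large enough when \<open>A\<close> is small.\<close>

definition nodes :: "'a set \<Rightarrow> 'a node set" where
  "nodes A = {(xs, 0) | xs. distinct xs \<and> set xs \<subseteq> A} \<union> {([a], 1) | a. a \<in> A} \<union> {([], 1), ([], 2)}"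

text \<open>One order of all labels of the type serves every \<open>A\<close> and \<open>G\<close>.
  The number in a label separates \<open>([a], 0)\<close> from \<open>([a], 1)\<close>, whose lists
  have the same orbit.\<close>

definition label_order :: "('a list set \<times> nat) rel" where
  "label_order = (SOME r. Well_order r \<and> Field r = UNIV)"

definition below :: "('a \<Rightarrow> 'a) set \<Rightarrow> 'a node \<Rightarrow> 'a node \<Rightarrow> bool" where
  "below G u v \<longleftrightarrow> ((orbit G (fst u), snd u), (orbit G (fst v), snd v)) \<in> label_order"

text \<open>
  The steps of the first kind force an automorphism to respect prefixes, and those of the second kind
  last entries; hence it acts entrywise on lists.
\<close>

definition step :: "'a node \<Rightarrow> 'a node \<Rightarrow> bool" where
  "step u v \<longleftrightarrow> (\<exists>xs a. u = (xs, 0) \<and> v = (xs @ [a], 0) \<or> u = (xs @ [a], 0) \<and> v = ([a], 1))"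

text \<open>The conjunct \<open>below G u v\<close> keeps this relation inside \<open>below\<close>,
  as the code requires. No edge is lost: \<open>below\<close> is total, so each survives in some
  direction.\<close>

definition linked :: "('a \<Rightarrow> 'a) set \<Rightarrow> 'a node \<Rightarrow> 'a node \<Rightarrow> bool" where
  "linked G u v \<longleftrightarrow> below G u v \<and> (u = v \<or> step u v \<or> step v u)"

definition act :: "('a \<Rightarrow> 'a) \<Rightarrow> 'a node \<Rightarrow> 'a node" where
  "act h u = (map h (fst u), snd u)"

lemma label_order: "Well_order (label_order :: ('a list set \<times> nat) rel)" "Field (label_order :: ('a list set \<times> nat) rel) = UNIV"
proof -
  have "\<exists>r :: ('a list set \<times> nat) rel. Well_order r \<and> Field r = UNIV" by (rule well_ordering)
  from someI_ex[OF this] show "Well_order (label_order :: ('a list set \<times> nat) rel)"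
    "Field (label_order :: ('a list set \<times> nat) rel) = UNIV"
    unfolding label_order_def by blast+
qed

lemma below_total: "below G u v \<or> below G v u"
proof -
  have "(x, y) \<in> label_order \<or> (y, x) \<in> label_order" for x y :: "'a list set \<times> nat"
    using label_order[where 'a = 'a] unfolding order_on_defs total_on_def refl_on_def by (metis UNIV_I)
  then show ?thesis unfolding below_def by blast
qed

lemma nodes_cases:
  assumes "u \<in> nodes A"
  obtains xs where "u = (xs, 0)" "distinct xs" "set xs \<subseteq> A" | a where "u = ([a], 1)" "a \<in> A"
    | n where "u = ([], n)" "n = 1 \<or> n = 2"
  using assms by (auto simp: nodes_def)

lemma nodes_simps [simp]:
  "(xs, 0) \<in> nodes A \<longleftrightarrow> distinct xs \<and> set xs \<subseteq> A" "([a], Suc 0) \<in> nodes A \<longleftrightarrow> a \<in> A"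
  "([], Suc 0) \<in> nodes A" "([], 2) \<in> nodes A"
  by (auto simp: nodes_def)

lemma finite_nodes: "finite A \<Longrightarrow> finite (nodes A)"
proof -
  assume "finite A"
  then have "finite ((\<lambda>xs. (xs, 0::nat)) ` {xs. set xs \<subseteq> A \<and> distinct xs} \<union> (\<lambda>a. ([a], 1)) ` A \<union> {([], 1), ([], 2)})"
    by (simp add: finite_subset_distinct)
  then show ?thesis by (rule finite_subset[rotated]) (auto simp: nodes_def)
qed

lemma step_act: "step u v \<Longrightarrow> step (act h u) (act h v)"
  by (auto simp: step_def act_def)

lemma coding_graph_nodes: "coding_graph (nodes A) (below G) (linked G)"
proof
  show refl: "below G u u" for u using below_total[of G u u] by blast
  show "linked G u u" for u using refl by (simp add: linked_def)
  show "\<exists>u\<in>nodes A. \<exists>v\<in>nodes A. \<exists>w\<in>nodes A. u \<noteq> v \<and> u \<noteq> w \<and> v \<noteq> w"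
    by (intro bexI[of _ "([], 0)"] bexI[of _ "([], 1)"] bexI[of _ "([], 2)"]) auto
  have "\<not> step ([], 1) ([], 2)" "\<not> step ([], 2) ([], 1)" by (auto simp: step_def)
  then have "\<not> linked G ([], 1) ([], 2)" "\<not> linked G ([], 2) ([], 1)" by (auto simp: linked_def)
  moreover have "([], 1) \<in> nodes A" "([], 2) \<in> nodes A" by simp_all
  ultimately show "\<exists>u\<in>nodes A. \<exists>v\<in>nodes A. below G u v \<and> \<not> linked G u v"
    using below_total by blast
qed (simp add: linked_def)

text \<open>\<open>closed\<close> is closedness in the topology of pointwise convergence; by it the
  group can be recovered from its orbits on finite lists.\<close>

locale finitary_closed =
  fixes A :: "'a set" and G :: "('a \<Rightarrow> 'a) set"
  assumes Bij: "G \<subseteq> Bij A" and group: "group (BijGroup A \<lparr>carrier := G\<rparr>)"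
    and closed: "\<And>h. \<lbrakk>h \<in> Bij A; \<And>X. \<lbrakk>finite X; X \<subseteq> A\<rbrakk> \<Longrightarrow> \<exists>g\<in>G. \<forall>x\<in>X. h x = g x\<rbrakk> \<Longrightarrow> h \<in> G"
begin

lemma
  assumes g: "g \<in> G"
  shows G_closed: "\<And>x. x \<in> A \<Longrightarrow> g x \<in> A" and G_inj: "inj_on g A"
    and G_inverse: "\<exists>k\<in>G. \<forall>x\<in>A. k (g x) = x \<and> g (k x) = x"
proof -
  interpret group "BijGroup A \<lparr>carrier := G\<rparr>" by (rule group)
  have gB: "g \<in> Bij A" using g Bij by blast
  then show "\<And>x. x \<in> A \<Longrightarrow> g x \<in> A" "inj_on g A" by (auto simp: Bij_def bij_betw_def)
  obtain k where k: "k \<in> G" "g \<otimes>\<^bsub>BijGroup A \<lparr>carrier := G\<rparr>\<^esub> k = \<one>\<^bsub>BijGroup A \<lparr>carrier := G\<rparr>\<^esub>"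
      "k \<otimes>\<^bsub>BijGroup A \<lparr>carrier := G\<rparr>\<^esub> g = \<one>\<^bsub>BijGroup A \<lparr>carrier := G\<rparr>\<^esub>"
    using r_inv[of g] l_inv[of g] inv_closed[of g] g by auto
  have "k \<in> Bij A" using k(1) Bij by blast
  then have "compose A g k = (\<lambda>x\<in>A. x)" "compose A k g = (\<lambda>x\<in>A. x)"
    using k(2,3) gB by (simp_all only: Bij_mult) (simp_all add: BijGroup_def)
  then have "k (g x) = x \<and> g (k x) = x" if "x \<in> A" for x
    using that by (metis compose_eq restrict_apply')
  then show "\<exists>k\<in>G. \<forall>x\<in>A. k (g x) = x \<and> g (k x) = x" using k(1) by blast
qed

lemma G_compose: "g \<in> G \<Longrightarrow> k \<in> G \<Longrightarrow> compose A g k \<in> G"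
proof -
  assume gk: "g \<in> G" "k \<in> G"
  interpret group "BijGroup A \<lparr>carrier := G\<rparr>" by (rule group)
  have "g \<otimes>\<^bsub>BijGroup A \<lparr>carrier := G\<rparr>\<^esub> k \<in> carrier (BijGroup A \<lparr>carrier := G\<rparr>)"
    by (rule m_closed) (use gk in simp_all)
  moreover have "g \<otimes>\<^bsub>BijGroup A \<lparr>carrier := G\<rparr>\<^esub> k = compose A g k"
    by (rule Bij_mult) (use gk Bij in auto)
  ultimately show "compose A g k \<in> G" by simp
qed

lemma orbit_map_subset:
  assumes g: "g \<in> G" and xs: "set xs \<subseteq> A"
  shows "orbit G (map g xs) \<subseteq> orbit G xs"
proof
  fix ys assume "ys \<in> orbit G (map g xs)"
  then obtain k where k: "k \<in> G" "ys = map k (map g xs)" by (auto simp: orbit_def)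
  then have "ys = map (compose A k g) xs" using xs by (auto simp: compose_eq)
  then show "ys \<in> orbit G xs" using G_compose[OF k(1) g] by (auto simp: orbit_def)
qed

lemma orbit_map:
  assumes g: "g \<in> G" and xs: "set xs \<subseteq> A"
  shows "orbit G (map g xs) = orbit G xs"
proof
  show "orbit G (map g xs) \<subseteq> orbit G xs" by (rule orbit_map_subset[OF assms])
  obtain k where k: "k \<in> G" "\<forall>x\<in>A. k (g x) = x" using G_inverse[OF g] by blast
  then have "map k (map g xs) = xs" using xs by (auto intro!: map_idI)
  then show "orbit G xs \<subseteq> orbit G (map g xs)"
    using orbit_map_subset[OF k(1), of "map g xs"] G_closed[OF g] xs by auto
qed

lemma self_orbit: "set xs \<subseteq> A \<Longrightarrow> xs \<in> orbit G xs"
proof -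
  assume xs: "set xs \<subseteq> A"
  interpret group "BijGroup A \<lparr>carrier := G\<rparr>" by (rule group)
  have "(\<lambda>x\<in>A. x) \<in> G" using one_closed by (simp add: BijGroup_def)
  moreover have "map (\<lambda>x\<in>A. x) xs = xs" using xs by (auto intro!: map_idI)
  ultimately show ?thesis unfolding orbit_def by force
qed

abbreviation "N \<equiv> nodes A"
abbreviation "node_auts \<equiv> weight_auts N (\<lambda>u v. (below G u v, linked G u v))"

lemma node_set: "u \<in> N \<Longrightarrow> set (fst u) \<subseteq> A"
  by (erule nodes_cases) auto

lemma act_nodes: "g \<in> G \<Longrightarrow> u \<in> N \<Longrightarrow> act g u \<in> N"
proof (erule nodes_cases)
  show "act g u \<in> N" if "g \<in> G" "u = (xs, 0)" "distinct xs" "set xs \<subseteq> A" for xs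
    using that G_closed[OF that(1)] inj_on_subset[OF G_inj[OF that(1)] that(4)]
    by (auto simp: act_def distinct_map)
qed (auto simp: act_def G_closed)

lemma act_inverse:
  assumes "\<And>x. x \<in> A \<Longrightarrow> k (g x) = x" "u \<in> N"
  shows "act k (act g u) = u"
proof -
  have "map k (map g (fst u)) = fst u" using node_set[OF assms(2)] assms(1) by (simp, intro map_idI) auto
  then show ?thesis by (simp add: act_def)
qed

lemma step_act_iff: "g \<in> G \<Longrightarrow> u \<in> N \<Longrightarrow> v \<in> N \<Longrightarrow> step (act g u) (act g v) \<longleftrightarrow> step u v"
  using step_act G_inverse[of g] act_inverse by metis

lemma act_inj: "g \<in> G \<Longrightarrow> u \<in> N \<Longrightarrow> v \<in> N \<Longrightarrow> act g u = act g v \<longleftrightarrow> u = v"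
  using G_inverse[of g] act_inverse by metis

lemma below_act: "g \<in> G \<Longrightarrow> u \<in> N \<Longrightarrow> v \<in> N \<Longrightarrow> below G (act g u) (act g v) \<longleftrightarrow> below G u v"
  using orbit_map node_set by (simp add: below_def act_def)

lemma linked_act: "g \<in> G \<Longrightarrow> u \<in> N \<Longrightarrow> v \<in> N \<Longrightarrow> linked G (act g u) (act g v) \<longleftrightarrow> linked G u v"
  by (simp add: linked_def below_act step_act_iff act_inj)

text \<open>\<open>below\<close> compares well-ordered labels, so rigidity keeps every node in its
  orbit. The group element depends on the node; finding one map for all nodes is left to the
  edges.\<close>

lemma node_auts_orbit:
  assumes t: "t \<in> node_auts" and u: "u \<in> N"
  shows "\<exists>g\<in>G. t u = act g u"
proof -
  have tN: "\<And>u. u \<in> N \<Longrightarrow> t u \<in> N" by (rule weight_autsD(2)[OF t])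
  have "(orbit G (fst (t u)), snd (t u)) = (orbit G (fst u), snd u)"
  proof (rule wellorder_rigid[where lab = "\<lambda>u. (orbit G (fst u), snd u)" and t = t and U = N, OF label_order])
    show "\<exists>u\<in>N. v = t u" if "v \<in> N" for v using weight_auts_surj[OF t that] by blast
    show "((orbit G (fst (t u)), snd (t u)), (orbit G (fst (t v)), snd (t v))) \<in> label_order \<longleftrightarrow>
      ((orbit G (fst u), snd u), (orbit G (fst v), snd v)) \<in> label_order" if "u \<in> N" "v \<in> N" for u v
      using weight_autsD(4)[OF t that] by (simp add: below_def)
  qed (use tN u in auto)
  moreover have "fst (t u) \<in> orbit G (fst (t u))" using self_orbit node_set tN[OF u] by blast
  ultimately show ?thesis by (auto simp: orbit_def act_def prod_eq_iff)
qed

lemma node_auts_step: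
  assumes t: "t \<in> node_auts" and uv: "u \<in> N" "v \<in> N" "step u v"
  shows "step (t u) (t v) \<or> step (t v) (t u)"
proof -
  have "u \<noteq> v" using uv by (auto simp: step_def)
  moreover have "linked G u v \<or> linked G v u" using below_total[of G u v] uv by (auto simp: linked_def)
  then have "linked G (t u) (t v) \<or> linked G (t v) (t u)"
    using weight_autsD(4)[OF t uv(1,2)] weight_autsD(4)[OF t uv(2,1)] by simp
  ultimately show ?thesis using weight_autsD(3)[OF t uv(1,2)] by (auto simp: linked_def)
qed

text \<open>Induction on lists from the right: the group element found for \<open>xs @ [a]\<close>
  agrees with \<open>h\<close> on \<open>xs\<close> by the edge to the prefix and at
  \<open>a\<close> by the edge to the last entry. Entries are nodes \<open>([a], 1)\<close> of their
  own, so the two kinds of edges cannot be confused.\<close>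

lemma node_auts_act:
  assumes t: "t \<in> node_auts"
  shows "\<exists>h. (\<forall>a\<in>A. h a \<in> A) \<and> (\<forall>u\<in>N. t u = act h u)"
proof -
  define h where "h a = hd (fst (t ([a], 1)))" for a
  have h: "t ([a], 1) = ([h a], 1) \<and> h a \<in> A" if a: "a \<in> A" for a
  proof -
    obtain g where g: "g \<in> G" "t ([a], 1) = act g ([a], 1)"
      using node_auts_orbit[OF t, of "([a], 1)"] a by auto
    then show ?thesis using G_closed[OF g(1) a] by (simp add: h_def act_def)
  qed
  have lists: "t (xs, 0) = (map h xs, 0)" if "distinct xs" "set xs \<subseteq> A" for xs
    using that
  proof (induction xs rule: rev_induct)
    case Nil
    obtain g where "g \<in> G" "t ([], 0) = act g ([], 0)" using node_auts_orbit[OF t, of "([], 0)"] by auto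
    then show ?case by (simp add: act_def)
  next
    case (snoc a xs)
    have N: "(xs, 0) \<in> N" "(xs @ [a], 0) \<in> N" "([a], 1) \<in> N" using snoc.prems by auto
    obtain g where g: "t (xs @ [a], 0) = act g (xs @ [a], 0)" using node_auts_orbit[OF t N(2)] by blast
    have "step (xs, 0) (xs @ [a], 0)" "step (xs @ [a], 0) ([a], 1)" by (auto simp: step_def)
    then have s: "step (t (xs, 0)) (t (xs @ [a], 0)) \<or> step (t (xs @ [a], 0)) (t (xs, 0))"
      "step (t (xs @ [a], 0)) (t ([a], 1)) \<or> step (t ([a], 1)) (t (xs @ [a], 0))"
      using node_auts_step[OF t] N by blast+
    have xs: "t (xs, 0) = (map h xs, 0)" using snoc by simp
    \<comment> \<open>Lengths decide the direction of the edge, as the longer list must be the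
      extension.\<close>
    have "map g xs = map h xs" using s(1) unfolding xs g by (auto simp: step_def act_def dest: arg_cong[of _ _ length])
    moreover have "g a = h a" using s(2) h[of a] snoc.prems unfolding g by (auto simp: step_def act_def)
    ultimately show ?case using g by (simp add: act_def)
  qed
  have "t u = act h u" if "u \<in> N" for u
    using that
  proof (cases rule: nodes_cases)
    case (1 xs)
    then show ?thesis using lists by (simp add: act_def)
  next
    case (2 a)
    then show ?thesis using h by (simp add: act_def)
  next
    case (3 n)
    then show ?thesis using node_auts_orbit[OF t that] by (auto simp: act_def)
  qed
  then show ?thesis using h by blast
qed

lemma Aut_nodes_iso:
  "Aut_weighted N (\<lambda>u v. (below G u v, linked G u v)) \<cong> BijGroup A \<lparr>carrier := G\<rparr>"
proof (rule functor_iso[where e = "\<lambda>a. ([a], 1)" and m = act])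
  show "act h u = act k u" if "u \<in> N" "\<And>a. a \<in> A \<Longrightarrow> h a = k a" for u h k
    using node_set[OF that(1)] that(2) by (auto simp: act_def)
  show "h \<in> G" if t: "t \<in> node_auts" and h: "h \<in> Bij A" "\<And>u. u \<in> N \<Longrightarrow> t u = act h u" for t h
  \<comment> \<open>A finite set is listed without repetition, and the orbit of this single list
    yields a group element that agrees with \<open>h\<close> on the set.\<close>
  proof (rule closed[OF h(1)])
    fix X assume "finite X" "X \<subseteq> A"
    then obtain xs where xs: "set xs = X" "distinct xs" using finite_distinct_list by blast
    then have u: "(xs, 0) \<in> N" using \<open>X \<subseteq> A\<close> by simp
    then obtain g where "g \<in> G" "t (xs, 0) = act g (xs, 0)" using node_auts_orbit[OF t] by blast
    then show "\<exists>g\<in>G. \<forall>x\<in>X. h x = g x" using h(2)[OF u] xs by (auto simp: act_def)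
  qed
qed (use node_auts_act Bij group act_nodes below_act linked_act in \<open>auto simp: act_def inj_on_def\<close>)

end

text \<open>Arities are finite, so each instance of a preservation condition concerns finitely many
  elements.\<close>

lemma (in fo_structure) finitary_closed_automorphisms:
  "finitary_closed (universe M) (model_automorphisms M)"
proof (rule finitary_closed.intro)
  show "model_automorphisms M \<subseteq> Bij (universe M)" by (auto simp: model_automorphisms_def)
  show "group (BijGroup (universe M) \<lparr>carrier := model_automorphisms M\<rparr>)"
    using group_Aut_model[OF fo_structure_axioms] unfolding Aut_model_def .
  fix h assume h: "h \<in> Bij (universe M)"
    and loc: "\<And>X. \<lbrakk>finite X; X \<subseteq> universe M\<rbrakk> \<Longrightarrow> \<exists>g\<in>model_automorphisms M. \<forall>x\<in>X. h x = g x"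
  show "h \<in> model_automorphisms M"
    unfolding model_automorphisms_def
  proof (intro CollectI conjI ballI)
    fix s xs assume s: "s \<in> funs M" and xs: "xs \<in> tuples (universe M) (fun_arity M s)"
    \<comment> \<open>The value joins the arguments in the finite set, since \<open>h\<close> is
      applied to it as well.\<close>
    obtain g where g: "g \<in> model_automorphisms M" "\<forall>x\<in>insert (fun_int M s xs) (set xs). h x = g x"
      using loc[of "insert (fun_int M s xs) (set xs)"] fun_int_closed[OF s xs] xs by (auto simp: tuples_def)
    then have eq: "map h xs = map g xs" by simp
    show "h (fun_int M s xs) = fun_int M s (map h xs)"
      unfolding eq using g s xs by (simp add: model_automorphisms_def)
  next
    fix r xs assume r: "r \<in> rels M" and xs: "xs \<in> tuples (universe M) (rel_arity M r)"
    obtain g where g: "g \<in> model_automorphisms M" "\<forall>x\<in>set xs. h x = g x"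
      using loc[of "set xs"] xs by (auto simp: tuples_def)
    then have eq: "map h xs = map g xs" by simp
    show "rel_int M r xs \<longleftrightarrow> rel_int M r (map h xs)"
      unfolding eq using g r xs by (simp add: model_automorphisms_def)
  qed (rule h)
qed

section \<open>Cardinalities\<close>

lemma lepoll_iff_ordLeq: "A \<lesssim> B \<longleftrightarrow> (card_of A, card_of B) \<in> ordLeq"
  by (simp add: lepoll_def card_of_ordLeq)

lemma finite_qcar:
  assumes "finite U"
  shows "finite (qcar U R E)"
proof -
  have "qcar U R E \<subseteq> range Ep \<union> {Al} \<union> (\<Union>u\<in>U. \<Union>v\<in>U. \<Union>b.
    {Pu u, Gu u, Lb b u, La u v, Ab b u v, Fu u v})"
    by (auto simp: qcar_def)
  then show ?thesis by (rule finite_subset) (use assms in simp)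
qed

context
  fixes K :: "'k set"
  assumes K: "infinite K"
begin

lemma countable_lepoll_infinite: "countable (X :: 'x set) \<Longrightarrow> X \<lesssim> K"
proof -
  assume "countable X"
  then have "X \<lesssim> (UNIV :: nat set)" by (auto simp: countable_def lepoll_def)
  also have "\<dots> \<lesssim> K" using K by (simp add: infinite_le_lepoll)
  finally show ?thesis .
qed

lemma Times_lepoll_infinite: "\<lbrakk>(X :: 'x set) \<lesssim> K; (Y :: 'y set) \<lesssim> K\<rbrakk> \<Longrightarrow> X \<times> Y \<lesssim> K"
  using card_of_Sigma_ordLeq_infinite[OF K, of X "\<lambda>_. Y"] by (simp add: lepoll_iff_ordLeq)

lemma UN_lepoll_infinite: "(\<And>n :: nat. X n \<lesssim> K) \<Longrightarrow> (\<Union>n. X n :: 'x set) \<lesssim> K"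
  using card_of_UNION_ordLeq_infinite[OF K, of "UNIV :: nat set" X] countable_lepoll_infinite[of "UNIV :: nat set"]
  by (simp add: lepoll_iff_ordLeq)

lemma Un_lepoll_infinite: "\<lbrakk>(X :: 'x set) \<lesssim> K; Y \<lesssim> K\<rbrakk> \<Longrightarrow> X \<union> Y \<lesssim> K"
proof -
  assume XY: "X \<lesssim> K" "Y \<lesssim> K"
  have "X \<union> Y = (\<Union>n :: nat. if n = 0 then X else Y)" by (auto split: if_splits)
  then show ?thesis using UN_lepoll_infinite[of "\<lambda>n. if n = 0 then X else Y"] XY by simp
qed

lemma image_lepoll_infinite: "(X :: 'x set) \<lesssim> K \<Longrightarrow> Y \<subseteq> f ` X \<Longrightarrow> (Y :: 'y set) \<lesssim> K"
  by (meson image_lepoll lepoll_trans subset_imp_lepoll)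

lemma lists_lepoll_infinite:
  assumes "(X :: 'x set) \<lesssim> K"
  shows "lists X \<lesssim> K"
proof -
  have "{xs \<in> lists X. length xs = n} \<lesssim> K" for n
  proof (induction n)
    case 0
    have "{xs \<in> lists X. length xs = 0} = {[]}" by auto
    then show ?case using countable_lepoll_infinite[of "{[]}"] by simp
  next
    case (Suc n)
    show ?case
      by (rule image_lepoll_infinite[OF Times_lepoll_infinite[OF assms Suc], of _ "\<lambda>(x, xs). x # xs"])
        (force simp: length_Suc_conv)
  qed
  then have "(\<Union>n. {xs \<in> lists X. length xs = n}) \<lesssim> K" by (rule UN_lepoll_infinite)
  moreover have "lists X = (\<Union>n. {xs \<in> lists X. length xs = n})" by blast
  ultimately show ?thesis by simp
qed

text \<open>Apart from the free completion, an element of a carrier consists of a constructor, with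
  numbers in some cases, and finitely many elements of the previous stage, so it has such a
  code.\<close>

lemma coded_lepoll_infinite:
  assumes "(U :: 'u set) \<lesssim> K" "inj_on f X" "\<And>x. x \<in> (X :: 'x set) \<Longrightarrow> f x \<in> (UNIV :: nat set) \<times> lists U"
  shows "X \<lesssim> K"
proof -
  have "X \<lesssim> (UNIV :: nat set) \<times> lists U" using assms(2,3) by (auto simp: lepoll_def)
  also have "\<dots> \<lesssim> K"
    by (intro Times_lepoll_infinite lists_lepoll_infinite assms(1) countable_lepoll_infinite) simp
  finally show ?thesis .
qed

lemma nodes_lepoll: "nodes K \<lesssim> K"
proof (rule coded_lepoll_infinite[OF lepoll_refl, of prod.swap])
  show "inj_on prod.swap (nodes K)" by (auto simp: inj_on_def)
qed (auto simp: nodes_def)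

lemma qcar_lepoll:
  assumes "(U :: 'u set) \<lesssim> K"
  shows "qcar U R E \<lesssim> K"
proof (rule coded_lepoll_infinite[OF assms])
  define f :: "'u qel \<Rightarrow> nat \<times> 'u list" where
    "f x = (case x of Ep b \<Rightarrow> (if b then 0 else 1, []) | Al \<Rightarrow> (2, []) | Pu u \<Rightarrow> (3, [u])
      | Ab b u v \<Rightarrow> (if b then 4 else 5, [u, v]) | Fu u v \<Rightarrow> (6, [u, v]) | Gu u \<Rightarrow> (7, [u])
      | Lb b u \<Rightarrow> (if b then 8 else 9, [u]) | La u v \<Rightarrow> (10, [u, v]))" for x
  show "inj_on f (qcar U R E)"
    by (rule inj_on_subset[OF injI]) (auto simp: f_def split: qel.splits if_splits)
  show "f x \<in> UNIV \<times> lists U" if "x \<in> qcar U R E" for x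
    using that by (cases x) (auto simp: f_def)
qed

lemma pcar_lepoll:
  assumes "(V :: 'e set) \<lesssim> K"
  shows "pcar V c \<lesssim> K"
proof (rule coded_lepoll_infinite[OF assms])
  define f :: "'e pel \<Rightarrow> nat \<times> 'e list" where
    "f x = (case x of Old e \<Rightarrow> (0, [e]) | FP p i \<Rightarrow> (2 * i + 1, [p]) | FL p j \<Rightarrow> (2 * j + 2, [p])
      | Sp \<Rightarrow> (0, []) | VL \<Rightarrow> (1, []))" for x
  have parity: "2 * i \<noteq> Suc (2 * j)" "Suc (2 * j) \<noteq> 2 * i" for i j :: nat by presburger+
  show "inj_on f (pcar V c)"
    by (rule inj_on_subset[OF injI]) (auto simp: f_def parity split: pel.splits)
  show "f x \<in> UNIV \<times> lists V" if "x \<in> pcar V c" for x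
    using that by (cases x) (auto simp: f_def)
qed

text \<open>Names nest to arbitrary depth, so the bound goes by rank: elements of rank at most
  \<open>Suc n\<close> are base elements or formed from pairs of rank at most \<open>n\<close>, and
  the ranks are countably many.\<close>

lemma free_lepoll:
  assumes "(V :: 'e set) \<lesssim> K"
  shows "free V c adj \<lesssim> K"
proof -
  let ?F = "\<lambda>n. {x \<in> free V c adj. frank x \<le> n}"
  have V: "Base ` V \<lesssim> K" by (rule image_lepoll_infinite[OF assms order_refl])
  have "?F n \<lesssim> K" for n
  proof (induction n)
    case 0
    have "?F 0 \<subseteq> Base ` V" by (auto elim: free.cases)
    then show ?case using V lepoll_trans subset_imp_lepoll by blast
  next
    case (Suc n)
    let ?f = "\<lambda>(b, x, y). New b {|x, y|}"
    have "(UNIV :: bool set) \<times> ?F n \<times> ?F n \<lesssim> K"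
      by (intro Times_lepoll_infinite Suc countable_lepoll_infinite) simp
    then have "?f ` (UNIV \<times> ?F n \<times> ?F n) \<lesssim> K" by (rule image_lepoll_infinite[OF _ order_refl])
    then have "Base ` V \<union> ?f ` (UNIV \<times> ?F n \<times> ?F n) \<lesssim> K" by (rule Un_lepoll_infinite[OF V])
    moreover have "?F (Suc n) \<subseteq> Base ` V \<union> ?f ` (UNIV \<times> ?F n \<times> ?F n)"
    proof
      fix z assume "z \<in> ?F (Suc n)"
      then have z: "z \<in> free V c adj" "frank z \<le> Suc n" by auto
      from z(1) show "z \<in> Base ` V \<union> ?f ` (UNIV \<times> ?F n \<times> ?F n)"
      proof (cases rule: free.cases)
        case (new x y)
        have "frank x < frank z" "frank y < frank z" unfolding new(1) by (rule frank_less; simp)+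
        then have "(\<not> fcol c x, x, y) \<in> UNIV \<times> ?F n \<times> ?F n" using new z(2) by auto
        then show ?thesis unfolding new(1) by (intro UnI2 image_eqI[where x = "(\<not> fcol c x, x, y)"]) auto
      qed simp
    qed
    ultimately show ?case using lepoll_trans subset_imp_lepoll by blast
  qed
  then have "(\<Union>n. ?F n) \<lesssim> K" by (rule UN_lepoll_infinite)
  moreover have "free V c adj = (\<Union>n. ?F n)" by blast
  ultimately show ?thesis by simp
qed

end

theorem corollary6:
  fixes M :: "('a, 'f, 'r) model"
  assumes "fo_structure M"
  shows "(finite (universe M) \<longrightarrow>
           (\<exists>P :: nat incidence.
             simple_plane P \<and> finite (points P) \<and> Aut_plane P \<cong> Aut_model M)) \<and>
         (infinite (universe M) \<longrightarrow>
           (\<exists>P :: 'a incidence.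
             simple_plane P \<and> universe M \<approx> points P \<and> Aut_plane P \<cong> Aut_model M)) \<and>
         (infinite (universe M) \<longrightarrow>
           (\<exists>P :: 'a incidence.
             projective_plane P \<and> \<not> desarguesian P \<and>
             universe M \<approx> points P \<and> Aut_plane P \<cong> Aut_model M))"
proof -
  interpret fo_structure M by fact
  let ?A = "universe M" and ?G = "model_automorphisms M"
  interpret finitary_closed ?A ?G by (rule finitary_closed_automorphisms)
  interpret C: coding_graph N "below ?G" "linked ?G" by (rule coding_graph_nodes)
  interpret I: inflatable C.Q qcol qadj by (rule C.inflatable_Q)
  \<comment> \<open>\<open>?p\<close> embeds the universe among the points and so bounds their
    number from below.\<close>
  let ?p = "\<lambda>a. Pu ([a], 1)" and ?X = "{x \<in> C.Q. qcol x}" and ?Y = "{x \<in> I.infl.F. I.infl.fc x}"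
  have iso_M: "Aut_weighted N (\<lambda>u v. (below ?G u v, linked ?G u v)) \<cong> Aut_model M"
    using Aut_nodes_iso unfolding Aut_model_def .
  have simple: "simple_plane (plane_of \<iota> C.Q qcol qadj) \<and> Aut_plane (plane_of \<iota> C.Q qcol qadj) \<cong> Aut_model M"
    if "inj_on \<iota> ?X" for \<iota> :: "'a node qel \<Rightarrow> 'p"
    using C.simple_plane_Q[OF that] iso_trans[OF _ iso_M] by blast
  \<comment> \<open>With bounds in both directions the points can be renamed as the elements of the
    universe, so that the set of points becomes the universe itself.\<close>
  have bij: "\<exists>\<iota>. bij_betw \<iota> X ?A" if inf: "infinite ?A" and X: "X \<lesssim> ?A"
    and f: "inj_on f ?A" "f ` ?A \<subseteq> X" for X :: "'x set" and f
  proof -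
    have "?A \<lesssim> X" using f by (auto simp: lepoll_def)
    then show ?thesis using lepoll_antisym[OF X] by (simp add: eqpoll_def)
  qed
  show ?thesis
  proof (intro conjI impI)
    assume "finite ?A"
    then have "finite N" by (rule finite_nodes)
    then have "finite ?X" by (intro finite_subset[OF _ finite_qcar]) auto
    then obtain \<iota> :: "'a node qel \<Rightarrow> nat" where "inj_on \<iota> ?X"
      using finite_imp_inj_to_nat_seg by metis
    moreover have "finite (points (plane_of \<iota> C.Q qcol qadj))"
      using \<open>finite ?X\<close> by (simp add: plane_of_def)
    ultimately show "\<exists>P :: nat incidence. simple_plane P \<and> finite (points P) \<and> Aut_plane P \<cong> Aut_model M"
      using simple by blast
  next
    assume inf: "infinite ?A"
    have Q: "C.Q \<lesssim> ?A" by (intro qcar_lepoll nodes_lepoll inf)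
    have X: "?X \<lesssim> ?A" by (rule lepoll_trans[OF subset_imp_lepoll Q]) auto
    have "inj_on ?p ?A" "?p ` ?A \<subseteq> ?X" by (auto simp: inj_on_def)
    then obtain \<iota> where \<iota>: "bij_betw \<iota> ?X ?A" using bij[OF inf X] by blast
    have "points (plane_of \<iota> C.Q qcol qadj) = ?A" using \<iota> by (simp add: plane_of_def bij_betw_def)
    then show "\<exists>P :: 'a incidence. simple_plane P \<and> ?A \<approx> points P \<and> Aut_plane P \<cong> Aut_model M"
      using simple[OF bij_betw_imp_inj_on[OF \<iota>]] by (intro exI[of _ "plane_of \<iota> C.Q qcol qadj"]) simp
  next
    assume inf: "infinite ?A"
    have F: "I.infl.F \<lesssim> ?A" by (intro free_lepoll pcar_lepoll qcar_lepoll nodes_lepoll inf)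
    have Y: "?Y \<lesssim> ?A" by (rule lepoll_trans[OF subset_imp_lepoll F]) auto
    have "inj_on (\<lambda>a. Base (Old (?p a))) ?A" "(\<lambda>a. Base (Old (?p a))) ` ?A \<subseteq> ?Y"
      by (auto simp: inj_on_def)
    then obtain \<iota> where \<iota>: "bij_betw \<iota> ?Y ?A" using bij[OF inf Y] by blast
    obtain p where "desargues_graph I.W I.pc I.pa Sp (\<lambda>i. FP (p i) 3) (\<lambda>i. FP (p i) 5) (\<lambda>i. FL (p i) 2)"
      by (rule I.desargues_graph_W)
    then interpret D: desargues_graph I.W I.pc I.pa Sp "\<lambda>i. FP (p i) 3" "\<lambda>i. FP (p i) 5" "\<lambda>i. FL (p i) 2" .
    let ?P = "plane_of \<iota> I.infl.F I.infl.fc I.infl.fi"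
    have inj: "inj_on \<iota> ?Y" using \<iota> by (simp add: bij_betw_def)
    have "Aut_plane ?P \<cong> Aut_model M"
      by (rule iso_trans[OF D.projective_completion(3)[OF inj] iso_trans[OF I.Aut_inflate_iso iso_trans[OF C.Aut_code_iso iso_M]]])
    moreover have "points ?P = ?A" using \<iota> by (simp add: plane_of_def bij_betw_def)
    ultimately show "\<exists>P :: 'a incidence. projective_plane P \<and> \<not> desarguesian P \<and> ?A \<approx> points P \<and> Aut_plane P \<cong> Aut_model M"
      using D.projective_completion(1,2)[OF inj] by (intro exI[of _ ?P]) simp
  qed
qed

end
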